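(* Let $\mathbb{K}$ be a field, let $G=(V,E)$ be a finite forest, let $\Delta(G)$ be the maximum degree of a vertex of $G$, and let $d=\Delta(G)+1$. Then the Lovász-Saks-Schrijver ring $R_G(d)$ is normal.
   Context: Let $G=(V,E)$ be a finite simple graph with $V=[n]=\{1,\dots,n\}$. For a field $\mathbb{K}$ and a positive integer $d$, put $S=\mathbb{K}[y_{ij} \mid i\in[n],\ j\in[d]]$ and, for each edge $e=\{i,j\}\in E$, $f_e=\sum_{k=1}^{d} y_{ik}y_{jk}$. The Lovász-Saks-Schrijver ideal is $L_G(d)=(f_e\mid e\in E)\subseteq S$ and the Lovász-Saks-Schrijver (LSS) ring is $R_G(d)=S/L_G(d)$. *)

theory Defs
  imports "HOL-Algebra.QuotRing" "HOL-Algebra.Polynomials" "HOL-Library.Poly_Mapping"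
begin

section \<open>Graphs\<close>

definition simple_graph :: "'v set \<Rightarrow> 'v set set \<Rightarrow> bool" where
  "simple_graph V E \<longleftrightarrow> finite V \<and> (\<forall>e\<in>E. e \<subseteq> V \<and> card e = 2)"

definition graph_cycle :: "'v set set \<Rightarrow> 'v list \<Rightarrow> bool" where
  "graph_cycle E vs \<longleftrightarrow> 3 \<le> length vs \<and> distinct vs \<and>
     (\<forall>i<length vs. {vs ! i, vs ! (Suc i mod length vs)} \<in> E)"

definition forest :: "'v set \<Rightarrow> 'v set set \<Rightarrow> bool" where
  "forest V E \<longleftrightarrow> simple_graph V E \<and> \<not> (\<exists>vs. graph_cycle E vs)"

definition vertex_degree :: "'v set set \<Rightarrow> 'v \<Rightarrow> nat" where
  "vertex_degree E v = card {e \<in> E. v \<in> e}"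

text \<open>The \<open>0\<close> is inserted only to give the graph without vertices maximum degree \<open>0\<close>.\<close>

definition max_degree :: "'v set \<Rightarrow> 'v set set \<Rightarrow> nat" where
  "max_degree V E = Max (insert 0 (vertex_degree E ` V))"


section \<open>Polynomial rings over a field in a set of variables\<close>

text \<open>
  A monomial is a finitely supported exponent map \<open>'v \<Rightarrow>\<^sub>0 nat\<close>, and a polynomial is a
  finitely supported map from monomials to coefficients; its product is the convolution product.
  The ring in the variables \<open>I\<close> consists of the polynomials all of whose monomials
  involve only variables from \<open>I\<close>.
\<close>

definition polynomial_ring :: "'v set \<Rightarrow> (('v \<Rightarrow>\<^sub>0 nat) \<Rightarrow>\<^sub>0 'k::field) ring" where
  "polynomial_ring I = \<lparr>carrier = {p. \<forall>m\<in>Poly_Mapping.keys p. Poly_Mapping.keys m \<subseteq> I},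
     monoid.mult = (*), one = 1, ring.zero = 0, add = (+)\<rparr>"

definition variable :: "'v \<Rightarrow> ('v \<Rightarrow>\<^sub>0 nat) \<Rightarrow>\<^sub>0 'k::field" where
  "variable v = Poly_Mapping.single (Poly_Mapping.single v 1) 1"


section \<open>Lovasz-Saks-Schrijver rings\<close>

definition lss_gen :: "nat \<Rightarrow> nat \<Rightarrow> nat \<Rightarrow> ((nat \<times> nat) \<Rightarrow>\<^sub>0 nat) \<Rightarrow>\<^sub>0 'k::field" where
  "lss_gen d i j = (\<Sum>k=1..d. variable (i, k) * variable (j, k))"

text \<open>Since \<^term>\<open>lss_gen d i j\<close> is symmetric in \<open>i\<close> and \<open>j\<close>, each edge gives one generator.\<close>

definition lss_ideal ::
  "nat \<Rightarrow> nat set set \<Rightarrow> nat \<Rightarrow> (((nat \<times> nat) \<Rightarrow>\<^sub>0 nat) \<Rightarrow>\<^sub>0 'k::field) set" where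
  "lss_ideal n E d =
     Idl\<^bsub>polynomial_ring ({1..n} \<times> {1..d})\<^esub> {lss_gen d i j | i j. {i, j} \<in> E}"

definition lss_ring ::
  "nat \<Rightarrow> nat set set \<Rightarrow> nat \<Rightarrow> (((nat \<times> nat) \<Rightarrow>\<^sub>0 nat) \<Rightarrow>\<^sub>0 'k::field) set ring" where
  "lss_ring n E d = polynomial_ring ({1..n} \<times> {1..d}) Quot lss_ideal n E d"


section \<open>Localization\<close>

text \<open>
  \<open>fraction R M a s\<close> is the class of \<open>a / s\<close> in the localization of \<open>R\<close> at the multiplicatively
  closed set \<open>M\<close>. Since \<open>R\<close> may have zero divisors, \<open>a / s = b / t\<close> means
  \<open>u (a t) = u (b s)\<close> for some \<open>u\<close> in \<open>M\<close>.
\<close>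

definition fraction_rel ::
  "('a, 'm) ring_scheme \<Rightarrow> 'a set \<Rightarrow> (('a \<times> 'a) \<times> ('a \<times> 'a)) set" where
  "fraction_rel R M = {((a, s), (b, t)). a \<in> carrier R \<and> b \<in> carrier R \<and> s \<in> M \<and> t \<in> M \<and>
     (\<exists>u\<in>M. u \<otimes>\<^bsub>R\<^esub> (a \<otimes>\<^bsub>R\<^esub> t) = u \<otimes>\<^bsub>R\<^esub> (b \<otimes>\<^bsub>R\<^esub> s))}"

definition fraction :: "('a, 'm) ring_scheme \<Rightarrow> 'a set \<Rightarrow> 'a \<Rightarrow> 'a \<Rightarrow> ('a \<times> 'a) set" where
  "fraction R M a s = fraction_rel R M `` {(a, s)}"

text \<open>As for \<^const>\<open>rcoset_mult\<close>, all members of the unions below coincide.\<close>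

definition localization :: "('a, 'm) ring_scheme \<Rightarrow> 'a set \<Rightarrow> ('a \<times> 'a) set ring" where
  "localization R M =
     \<lparr>carrier = (carrier R \<times> M) // fraction_rel R M,
      monoid.mult = (\<lambda>x y. \<Union>(a, s)\<in>x. \<Union>(b, t)\<in>y. fraction R M (a \<otimes>\<^bsub>R\<^esub> b) (s \<otimes>\<^bsub>R\<^esub> t)),
      one = fraction R M \<one>\<^bsub>R\<^esub> \<one>\<^bsub>R\<^esub>,
      ring.zero = fraction R M \<zero>\<^bsub>R\<^esub> \<one>\<^bsub>R\<^esub>,
      add = (\<lambda>x y. \<Union>(a, s)\<in>x. \<Union>(b, t)\<in>y.
        fraction R M (a \<otimes>\<^bsub>R\<^esub> t \<oplus>\<^bsub>R\<^esub> b \<otimes>\<^bsub>R\<^esub> s) (s \<otimes>\<^bsub>R\<^esub> t))\<rparr>"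

definition fraction_field :: "('a, 'm) ring_scheme \<Rightarrow> ('a \<times> 'a) set ring" where
  "fraction_field R = localization R (carrier R - {\<zero>\<^bsub>R\<^esub>})"

definition to_fraction_field :: "('a, 'm) ring_scheme \<Rightarrow> 'a \<Rightarrow> ('a \<times> 'a) set" where
  "to_fraction_field R a = fraction R (carrier R - {\<zero>\<^bsub>R\<^esub>}) a \<one>\<^bsub>R\<^esub>"


section \<open>Normal rings\<close>

definition integral_over :: "('a, 'm) ring_scheme \<Rightarrow> 'a set \<Rightarrow> 'a \<Rightarrow> bool" where
  "integral_over L A x \<longleftrightarrow>
     (\<exists>p\<in>carrier (univ_poly L A). p \<noteq> [] \<and> lead_coeff p = \<one>\<^bsub>L\<^esub> \<and> ring.eval L p x = \<zero>\<^bsub>L\<^esub>)"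

definition integrally_closed_domain :: "('a, 'm) ring_scheme \<Rightarrow> bool" where
  "integrally_closed_domain R \<longleftrightarrow> domain R \<and>
     (\<forall>x\<in>carrier (fraction_field R).
        integral_over (fraction_field R) (to_fraction_field R ` carrier R) x \<longrightarrow>
        x \<in> to_fraction_field R ` carrier R)"

text \<open>
  A commutative ring is normal if its localization at every prime ideal is an
  integrally closed domain; the ring itself is not required to be a domain.
\<close>

definition normal_ring :: "('a, 'm) ring_scheme \<Rightarrow> bool" where
  "normal_ring R \<longleftrightarrow> cring R \<and>
     (\<forall>P. primeideal P R \<longrightarrow> integrally_closed_domain (localization R (carrier R - P)))"

end

theory Submission
  imports Defs "HOL-Library.Product_Lexorder" "HOL-Computational_Algebra.Fraction_Field"
begin

text \<open>
  Write \<open>y(i,k)\<close> for the variables, \<open>T\<close> for the polynomial ring, \<open>f(e)\<close> for the generator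
  of an edge \<open>e\<close> and \<open>J\<close> for the ideal of all \<open>f(e)\<close>. Let \<open>\<Delta>\<close> be the maximum degree and \<open>d = \<Delta> + 1\<close>.
  The proof uses the first \<open>\<Delta>\<close> coordinates to control the ideal \<open>J\<close> by its initial forms,
  and the one remaining coordinate to solve the equations.

  A forest arises by adding leaves one at a time, so its edges have a proper colouring \<open>c\<close> with
  the colours \<open>1, \<dots>, \<Delta>\<close>. When the edge \<open>e = {v, l}\<close> with the new leaf \<open>l\<close> is added, a large weight
  on \<open>y(l, c(e))\<close> makes \<open>y(v, c(e)) y(l, c(e))\<close> the initial form of \<open>f(e)\<close>
  (\<open>leaf_order_leading_colors\<close>). As the colouring is proper, these squarefree monomials
  are pairwise coprime, and they stay coprime when a variable \<open>y(u,d)\<close> is added to them. An ideal whose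
  generators have such initial forms has the ideal of these monomials as its initial ideal
  (\<open>top_part_in_monomial_ideal\<close>). It is therefore radical, and a further polynomial with coprime
  initial form is a nonzerodivisor modulo it (\<open>ideal_span_radical\<close>, \<open>ideal_span_nonzerodivisor\<close>).
  So every last coordinate \<open>y(u,d)\<close> is a nonzerodivisor modulo \<open>J\<close>, and \<open>J + (y(u,d))\<close> is radical.

  Once the last coordinates are invertible, the equation \<open>f(e) = 0\<close> determines \<open>y(l,d)\<close> from \<open>y(v,d)\<close>
  and the variables with smaller second index. Hence the last coordinates of the children can be
  eliminated, and \<open>J\<close> is the kernel of a homomorphism \<open>\<psi>\<close> from \<open>T\<close> to its fraction field that fixes the
  remaining variables (\<open>psi_eq_0_iff\<close>). In particular \<open>T/J\<close> is a domain, isomorphic to \<open>\<psi>(T)\<close>.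

  Let \<open>z\<close> in the fraction field of \<open>\<psi>(T)\<close> be integral over \<open>\<psi>(T)\<close>. Polynomial rings are integrally
  closed, so \<open>\<psi>(M) z\<close> lies in \<open>\<psi>(T)\<close> for some product \<open>M\<close> of last coordinates. The factors of \<open>M\<close> can
  be removed one at a time: if \<open>w\<close> is integral over \<open>\<psi>(T)\<close> and \<open>y w\<close> is in \<open>\<psi>(T)\<close> for a last
  coordinate \<open>y\<close>, then the integral equation of \<open>w\<close>, multiplied by a power of \<open>y\<close>, shows that a power
  of \<open>y w\<close> is divisible by \<open>y\<close> in \<open>\<psi>(T)\<close>. As \<open>J + (y)\<close> is radical, \<open>y w\<close> is itself
  divisible by \<open>y\<close>, so \<open>w\<close> is in \<open>\<psi>(T)\<close> (\<open>range_psi_descend\<close>). Thus \<open>T/J\<close> is integrally closed,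
  and so are its localizations, by clearing denominators (\<open>normal_ring_if_embedded\<close>).
\<close>

type_synonym ('v, 'k) mpoly = "('v \<Rightarrow>\<^sub>0 nat) \<Rightarrow>\<^sub>0 'k"

abbreviation (input) lookup :: "('a \<Rightarrow>\<^sub>0 'b::zero) \<Rightarrow> 'a \<Rightarrow> 'b" where
  "lookup \<equiv> Poly_Mapping.lookup"
abbreviation (input) keys :: "('a \<Rightarrow>\<^sub>0 'b::zero) \<Rightarrow> 'a set" where
  "keys \<equiv> Poly_Mapping.keys"
abbreviation (input) single :: "'a \<Rightarrow> 'b \<Rightarrow> 'a \<Rightarrow>\<^sub>0 'b::zero" where
  "single \<equiv> Poly_Mapping.single"

section \<open>Finitely supported maps\<close>

lemma poly_mapping_eq_sum_single:
  "p = (\<Sum>m\<in>keys p. single m (lookup p m))"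
proof (rule poly_mapping_eqI)
  fix k
  show "lookup p k = lookup (\<Sum>m\<in>keys p. single m (lookup p m)) k"
    unfolding lookup_sum lookup_single when_def
    by (subst sum.delta) (auto simp: in_keys_iff)
qed

lemma poly_mapping_single_induct [case_names zero single add]:
  assumes "P 0" "\<And>m c. P (single m c)" "\<And>p q. P p \<Longrightarrow> P q \<Longrightarrow> P (p + q)"
  shows "P (p :: 'a \<Rightarrow>\<^sub>0 'b::comm_monoid_add)"
proof -
  have "finite A \<Longrightarrow> P (\<Sum>m\<in>A. single m (lookup p m))" for A
    by (induction A rule: finite_induct) (use assms in auto)
  then show ?thesis
    using poly_mapping_eq_sum_single[of p] finite_keys by metis
qed

lemma keys_add_nat: "keys (m + m' :: 'v \<Rightarrow>\<^sub>0 nat) = keys m \<union> keys m'"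
  by (auto simp: in_keys_iff lookup_add)

lemma keys_minus_subset: "keys (p - q :: 'a \<Rightarrow>\<^sub>0 'b::ab_group_add) \<subseteq> keys p \<union> keys q"
  by (auto simp: in_keys_iff lookup_minus)

lemma lookup_single_times:
  "lookup (single a c * p :: ('v, 'k::comm_semiring_1) mpoly) (a + m) = c * lookup p m"
proof (induction p rule: poly_mapping_single_induct)
  case (single m' c')
  then show ?case by (simp add: mult_single lookup_single when_def)
qed (auto simp: lookup_add algebra_simps)


section \<open>Ideals generated by a set\<close>

interpretation gen: Modules.module "(*) :: 'a::comm_ring_1 \<Rightarrow> 'a \<Rightarrow> 'a"
  by standard (auto simp: algebra_simps)

\<comment> \<open>For the ring as a module over itself this rule is associativity read backwards; with
  \<open>algebra_simps\<close> it would make the simplifier loop.\<close>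
declare gen.scale_scale [simp del]

abbreviation ideal_span :: "'a::comm_ring_1 set \<Rightarrow> 'a set" where
  "ideal_span \<equiv> gen.span"

lemma ideal_span_scale_right: "x \<in> ideal_span F \<Longrightarrow> x * c \<in> ideal_span F"
  using gen.span_scale[of x F c] by (simp add: mult.commute)

lemma ideal_span_cong:
  assumes "x - y \<in> ideal_span F" shows "x \<in> ideal_span F \<longleftrightarrow> y \<in> ideal_span F"
  using gen.span_add_eq[OF assms, of y] by simp

lemma diff_dvd_power_diff: "(x - y :: 'a::comm_ring_1) dvd x ^ k - y ^ k"
proof (induction k)
  case (Suc k)
  have "x ^ Suc k - y ^ Suc k = x * (x ^ k - y ^ k) + (x - y) * y ^ k"
    by (simp add: algebra_simps)
  then show ?case using Suc by (auto intro!: dvd_add)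
qed auto


section \<open>Setting variables to zero\<close>

text \<open>
  The terms that involve a variable outside \<open>U\<close> are dropped. Since the keys of a product of
  monomials are the union of their keys, this is the ring homomorphism that sends the variables
  outside \<open>U\<close> to zero; it serves both as the retraction onto the polynomials in \<open>U\<close> and as the
  reduction modulo a monomial prime ideal.
\<close>

definition restrict_vars :: "'v set \<Rightarrow> ('v, 'k::zero) mpoly \<Rightarrow> ('v, 'k) mpoly" where
  "restrict_vars U p = Poly_Mapping.mapp (\<lambda>m c. c when keys m \<subseteq> U) p"

lemma lookup_restrict_vars: "lookup (restrict_vars U p) m = (lookup p m when keys m \<subseteq> U)"
  by (auto simp: restrict_vars_def lookup_mapp when_def in_keys_iff)

lemma restrict_vars_0 [simp]: "restrict_vars U 0 = 0"
  by (rule poly_mapping_eqI) (simp add: lookup_restrict_vars)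

lemma restrict_vars_1 [simp]: "restrict_vars U (1 :: ('v, 'k::comm_ring_1) mpoly) = 1"
  by (rule poly_mapping_eqI) (auto simp: lookup_restrict_vars lookup_one when_def)

lemma restrict_vars_add: "restrict_vars U (p + q) = restrict_vars U p + restrict_vars U q"
  by (rule poly_mapping_eqI) (simp add: lookup_restrict_vars lookup_add when_add_distrib)

lemma restrict_vars_diff:
  "restrict_vars U (p - q :: ('v, 'k::comm_ring_1) mpoly) = restrict_vars U p - restrict_vars U q"
  by (rule poly_mapping_eqI) (simp add: lookup_restrict_vars lookup_minus when_diff_distrib)

lemma restrict_vars_single:
  "restrict_vars U (single m c) = (if keys m \<subseteq> U then single m c else 0)"
  by (rule poly_mapping_eqI) (auto simp: lookup_restrict_vars lookup_single when_def)

lemma restrict_vars_mult: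
  "restrict_vars U (p * q :: ('v, 'k::comm_ring_1) mpoly) = restrict_vars U p * restrict_vars U q"
proof (induction p rule: poly_mapping_single_induct)
  case (single m c)
  show ?case
    by (induction q rule: poly_mapping_single_induct)
       (auto simp: mult_single restrict_vars_single restrict_vars_add keys_add_nat algebra_simps)
qed (auto simp: restrict_vars_add algebra_simps)

lemma restrict_vars_power:
  "restrict_vars U (p ^ k :: ('v, 'k::comm_ring_1) mpoly) = restrict_vars U p ^ k"
  by (induction k) (auto simp: restrict_vars_mult)

lemma restrict_vars_id: "(\<And>m. m \<in> keys p \<Longrightarrow> keys m \<subseteq> U) \<Longrightarrow> restrict_vars U p = p"
  by (rule poly_mapping_eqI) (auto simp: lookup_restrict_vars when_def in_keys_iff)

lemma keys_restrict_vars: "keys (restrict_vars U p) = {m \<in> keys p. keys m \<subseteq> U}"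
  unfolding set_eq_iff mem_Collect_eq in_keys_iff[where s = p]
    in_keys_iff[where s = "restrict_vars U p"] lookup_restrict_vars when_def by auto

section \<open>Weights\<close>

definition weight :: "('v \<Rightarrow> nat) \<Rightarrow> ('v \<Rightarrow>\<^sub>0 nat) \<Rightarrow> nat" where
  "weight w m = (\<Sum>v\<in>keys m. lookup m v * w v)"

lemma weight_eq_sum:
  "finite A \<Longrightarrow> keys m \<subseteq> A \<Longrightarrow> weight w m = (\<Sum>v\<in>A. lookup m v * w v)"
  unfolding weight_def by (rule sum.mono_neutral_left) (auto simp: in_keys_iff)

lemma weight_add: "weight w (m + m') = weight w m + weight w m'"
proof -
  let ?A = "keys m \<union> keys m'"
  have "weight w (m + m') = (\<Sum>v\<in>?A. lookup (m + m') v * w v)"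
    by (rule weight_eq_sum) (auto simp: keys_add_nat)
  moreover have "weight w m = (\<Sum>v\<in>?A. lookup m v * w v)"
    "weight w m' = (\<Sum>v\<in>?A. lookup m' v * w v)"
    by (rule weight_eq_sum; auto)+
  ultimately show ?thesis by (simp add: lookup_add sum.distrib algebra_simps)
qed

lemma weight_zero [simp]: "weight w 0 = 0"
  by (simp add: weight_def)

lemma weight_single [simp]: "weight w (single v k) = k * w v"
  by (cases "k = 0") (simp_all add: weight_def)

definition homogeneous :: "('v \<Rightarrow> nat) \<Rightarrow> nat \<Rightarrow> ('v, 'k::zero) mpoly \<Rightarrow> bool" where
  "homogeneous w n p \<longleftrightarrow> (\<forall>m\<in>keys p. weight w m = n)"

definition lower :: "('v \<Rightarrow> nat) \<Rightarrow> nat \<Rightarrow> ('v, 'k::zero) mpoly \<Rightarrow> bool" where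
  "lower w n p \<longleftrightarrow> (\<forall>m\<in>keys p. weight w m < n)"

lemma lower_0 [simp]: "lower w n 0"
  and homogeneous_0 [simp]: "homogeneous w n 0"
  by (auto simp: lower_def homogeneous_def)

lemma lower_zero_iff [simp]: "lower w 0 p \<longleftrightarrow> p = 0"
  by (auto simp: lower_def)

lemma lower_mono: "lower w n p \<Longrightarrow> n \<le> n' \<Longrightarrow> lower w n' p"
  unfolding lower_def by (meson less_le_trans)

lemma lower_add: "lower w n p \<Longrightarrow> lower w n q \<Longrightarrow> lower w n (p + q)"
  using keys_add[of p q] unfolding lower_def by blast

lemma lower_diff: "lower w n p \<Longrightarrow> lower w n q \<Longrightarrow> lower w n (p - q :: ('v, 'k::ab_group_add) mpoly)"
  using keys_minus_subset[of p q] unfolding lower_def by blast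

lemma lower_sum: "(\<And>i. i \<in> A \<Longrightarrow> lower w n (f i)) \<Longrightarrow> lower w n (sum f A)"
  by (induction A rule: infinite_finite_induct) (auto intro: lower_add)

lemma homogeneous_add: "homogeneous w n p \<Longrightarrow> homogeneous w n q \<Longrightarrow> homogeneous w n (p + q)"
  using keys_add[of p q] unfolding homogeneous_def by blast

lemma homogeneous_diff:
  "homogeneous w n p \<Longrightarrow> homogeneous w n q \<Longrightarrow> homogeneous w n (p - q :: ('v, 'k::ab_group_add) mpoly)"
  using keys_minus_subset[of p q] unfolding homogeneous_def by blast

lemma homogeneous_mult:
  "homogeneous w n p \<Longrightarrow> homogeneous w n' q \<Longrightarrow>
   homogeneous w (n + n') (p * q :: ('v, 'k::comm_ring_1) mpoly)"
  unfolding homogeneous_def by (auto simp: weight_add dest!: keys_mult[THEN subsetD])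

lemma homogeneous_lower_mult:
  "homogeneous w n p \<Longrightarrow> lower w n' q \<Longrightarrow> lower w (n + n') (p * q :: ('v, 'k::comm_ring_1) mpoly)"
  unfolding homogeneous_def lower_def by (auto simp: weight_add dest!: keys_mult[THEN subsetD])

lemma lower_lower_mult:
  "lower w n p \<Longrightarrow> lower w n' q \<Longrightarrow> lower w (n + n') (p * q :: ('v, 'k::comm_ring_1) mpoly)"
  unfolding lower_def by (fastforce simp: weight_add dest!: keys_mult[THEN subsetD] intro: add_strict_mono)

lemma homogeneous_lower_imp_0: "homogeneous w n p \<Longrightarrow> lower w n p \<Longrightarrow> p = 0"
  proof -
  assume "homogeneous w n p" "lower w n p"
  then have "keys p = {}" unfolding homogeneous_def lower_def by force
  then show "p = 0" by simp
qed

lemma homogeneous_single: "weight w m = n \<Longrightarrow> homogeneous w n (single m c)"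
  by (auto simp: homogeneous_def)

text \<open>
  The polynomial \<open>q\<close> is the initial form of \<open>p\<close> with respect to the weights \<open>w\<close>, and \<open>n\<close> is its weight.
  A relation is used instead of a function because the zero polynomial has no initial form.
\<close>

definition top_part :: "('v \<Rightarrow> nat) \<Rightarrow> nat \<Rightarrow> ('v, 'k::comm_ring_1) mpoly \<Rightarrow> ('v, 'k) mpoly \<Rightarrow> bool" where
  "top_part w n q p \<longleftrightarrow> q \<noteq> 0 \<and> homogeneous w n q \<and> lower w n (p - q)"

lemma top_part_exists:
  assumes "p \<noteq> 0"
  obtains n q where "top_part w n q p"
proof -
  define n where "n = Max (weight w ` keys p)"
  define q where "q = Poly_Mapping.mapp (\<lambda>m c. c when weight w m = n) p"
  have q: "lookup q m = (lookup p m when weight w m = n)" for m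
    by (auto simp: q_def lookup_mapp when_def in_keys_iff)
  have ne: "weight w ` keys p \<noteq> {}" using assms by simp
  then have "n \<in> weight w ` keys p" unfolding n_def by (intro Max_in) auto
  then obtain m where "m \<in> keys p" "weight w m = n" by auto
  then have "q \<noteq> 0" using q[of m] by (auto simp: in_keys_iff)
  moreover have "homogeneous w n q"
    by (auto simp: homogeneous_def in_keys_iff q)
  moreover have "lower w n (p - q)"
    unfolding lower_def
  proof
    fix m assume "m \<in> keys (p - q)"
    then have "lookup p m \<noteq> 0" "weight w m \<noteq> n"
      by (auto simp: in_keys_iff lookup_minus q when_def split: if_splits)
    moreover from this have "weight w m \<le> n"
      unfolding n_def by (intro Max_ge) (auto simp: in_keys_iff)
    ultimately show "weight w m < n" by simp
  qed
  ultimately show ?thesis using that by (auto simp: top_part_def)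
qed

lemma top_part_degree_le:
  assumes "top_part w n q p" "lower w N p" shows "n < N"
proof (rule ccontr)
  assume "\<not> n < N"
  then have "lower w n p" using lower_mono[OF assms(2)] by simp
  then have "lower w n q" using assms(1) lower_diff[of w n p "p - q"] by (simp add: top_part_def)
  then show False using assms(1) homogeneous_lower_imp_0[of w n q] by (auto simp: top_part_def)
qed

lemma top_part_nonzero: "top_part w n q p \<Longrightarrow> p \<noteq> 0"
  using top_part_degree_le[of w n q p 0] by auto

lemma top_part_lower_Suc:
  assumes "top_part w n q p" shows "lower w (Suc n) p"
proof -
  have "lower w (Suc n) q" using assms by (auto simp: top_part_def homogeneous_def lower_def)
  moreover have "lower w (Suc n) (p - q)" using assms by (auto simp: top_part_def intro: lower_mono)
  ultimately show ?thesis using lower_add[of w "Suc n" q "p - q"] by simp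
qed

lemma top_part_degree_unique:
  "top_part w n q p \<Longrightarrow> top_part w n' q' p \<Longrightarrow> n = n'"
proof -
  assume a: "top_part w n q p" "top_part w n' q' p"
  have "n < Suc n'" "n' < Suc n"
    using top_part_degree_le[OF a(1) top_part_lower_Suc[OF a(2)]]
      top_part_degree_le[OF a(2) top_part_lower_Suc[OF a(1)]] by auto
  then show "n = n'" by simp
qed

lemma top_part_unique:
  assumes "top_part w n q p" "top_part w n' q' p" shows "q = q'"
proof -
  have n: "n' = n" using top_part_degree_unique[OF assms(2,1)] by simp
  have "lower w n (q - q')"
    using lower_diff[of w n "p - q'" "p - q"] assms unfolding n by (simp add: top_part_def)
  moreover have "homogeneous w n (q - q')" using assms unfolding n
    by (intro homogeneous_diff) (auto simp: top_part_def)
  ultimately show ?thesis using homogeneous_lower_imp_0[of w n "q - q'"] by simp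
qed

lemma top_part_add_lower:
  "top_part w n q p \<Longrightarrow> lower w n r \<Longrightarrow> top_part w n q (p + r)"
  using lower_add[of w n "p - q" r] by (auto simp: top_part_def algebra_simps)

text \<open>
  Initial forms are multiplicative because the product of the two initial forms cannot vanish in
  a domain. The order on the variables only serves to make the polynomial ring an instance
  of \<^class>\<open>idom\<close>.
\<close>

lemma top_part_mult:
  fixes p p' :: "('v::linorder, 'k::idom) mpoly"
  assumes "top_part w n q p" "top_part w n' q' p'"
  shows "top_part w (n + n') (q * q') (p * p')"
proof -
  have "p * p' - q * q' = q * (p' - q') + q' * (p - q) + (p - q) * (p' - q')"
    by (simp add: algebra_simps)
  moreover have "lower w (n + n') (q * (p' - q'))" "lower w (n + n') (q' * (p - q))"
    "lower w (n + n') ((p - q) * (p' - q'))"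
    using assms homogeneous_lower_mult[of w n q n' "p' - q'"]
      homogeneous_lower_mult[of w n' q' n "p - q"] lower_lower_mult[of w n "p - q" n' "p' - q'"]
    by (simp_all add: top_part_def add.commute)
  ultimately have "lower w (n + n') (p * p' - q * q')"
    by (simp only:) (intro lower_add)
  then show ?thesis
    using assms by (simp add: top_part_def homogeneous_mult)
qed

lemma top_part_power:
  fixes p :: "('v::linorder, 'k::idom) mpoly"
  assumes "top_part w n q p"
  shows "top_part w (k * n) (q ^ k) (p ^ k)"
proof (induction k)
  case 0
  have "homogeneous w 0 (1 :: ('v, 'k) mpoly)" by (auto simp: homogeneous_def)
  then show ?case by (simp add: top_part_def)
next
  case (Suc k)
  then show ?case using top_part_mult[OF assms Suc] by simp
qed

lemma top_part_minus_lower: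
  assumes "top_part w n q p" "lower w n (h - q)"
  shows "lower w n (p - h)"
proof -
  have "p - h = (p - q) - (h - q)" by simp
  then show ?thesis using assms lower_diff unfolding top_part_def by metis
qed

section \<open>Ideals with coprime squarefree leading monomials\<close>

text \<open>
  Squarefree monomials are represented by their sets of variables: divisibility of a monomial
  becomes inclusion in its set of keys, and coprimality becomes disjointness.
\<close>

definition squarefree_monomial :: "'v set \<Rightarrow> 'v \<Rightarrow>\<^sub>0 nat" where
  "squarefree_monomial S = (\<Sum>v\<in>S. single v 1)"

lemma lookup_squarefree_monomial:
  "finite S \<Longrightarrow> lookup (squarefree_monomial S) v = (if v \<in> S then 1 else 0)"
  by (simp add: squarefree_monomial_def lookup_sum lookup_single when_def)

lemma keys_squarefree_monomial: "finite S \<Longrightarrow> keys (squarefree_monomial S) = S"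
  by (auto simp: in_keys_iff lookup_squarefree_monomial split: if_splits)

lemma squarefree_monomial_factor:
  assumes "finite S" "S \<subseteq> keys m"
  obtains t where "m = squarefree_monomial S + t"
proof
  show "m = squarefree_monomial S + (m - squarefree_monomial S)"
  proof (rule poly_mapping_eqI)
    fix v
    have "v \<in> S \<Longrightarrow> lookup m v \<noteq> 0" using assms(2) by (auto simp: in_keys_iff)
    then show "lookup m v = lookup (squarefree_monomial S + (m - squarefree_monomial S)) v"
      using assms(1) by (auto simp: lookup_add lookup_minus lookup_squarefree_monomial)
  qed
qed

text \<open>
  The ideal generated by the squarefree monomials with variable sets \<open>S i\<close>. Membership is a condition
  on each monomial separately, which is what makes the arguments with initial forms work.
\<close>

definition monomial_ideal :: "('i \<Rightarrow> 'v set) \<Rightarrow> 'i set \<Rightarrow> ('v, 'k::zero) mpoly set" where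
  "monomial_ideal S A = {q. \<forall>m\<in>keys q. \<exists>i\<in>A. S i \<subseteq> keys m}"

lemma monomial_ideal_mono: "A \<subseteq> B \<Longrightarrow> monomial_ideal S A \<subseteq> monomial_ideal S B"
  unfolding monomial_ideal_def by blast

lemma monomial_ideal_add:
  "p \<in> monomial_ideal S A \<Longrightarrow> q \<in> monomial_ideal S A \<Longrightarrow> p + q \<in> monomial_ideal S A"
  using keys_add[of p q] unfolding monomial_ideal_def by blast

lemma monomial_ideal_uminus:
  "p \<in> monomial_ideal S A \<Longrightarrow> - p \<in> monomial_ideal S (A :: 'i set)"
  for p :: "('v, 'k::comm_ring_1) mpoly"
  by (simp add: monomial_ideal_def in_keys_iff)

text \<open>
  A squarefree monomial ideal is an intersection of prime ideals generated by variables. If a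
  monomial \<open>m\<close> of \<open>q\<close> is not in the ideal, then every generator involves a variable outside \<open>m\<close>.
  Setting the variables outside \<open>m\<close> to zero therefore kills \<open>q ^ k\<close>, hence \<open>q\<close>, but keeps the term
  at \<open>m\<close>.
\<close>

lemma monomial_ideal_radical:
  fixes q :: "('v::linorder, 'k::idom) mpoly"
  assumes "q ^ k \<in> monomial_ideal S A"
  shows "q \<in> monomial_ideal S A"
  unfolding monomial_ideal_def
proof safe
  fix m assume m: "m \<in> keys q"
  show "\<exists>i\<in>A. S i \<subseteq> keys m"
  proof (rule ccontr)
    assume no: "\<not> (\<exists>i\<in>A. S i \<subseteq> keys m)"
    have "keys (restrict_vars (keys m) (q ^ k)) = {}"
      using assms no unfolding keys_restrict_vars monomial_ideal_def by blast
    then have "restrict_vars (keys m) q ^ k = 0"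
      by (simp add: restrict_vars_power)
    then have "restrict_vars (keys m) q = 0" by simp
    moreover have "m \<in> keys (restrict_vars (keys m) q)"
      using m unfolding keys_restrict_vars by blast
    ultimately show False by simp
  qed
qed

lemma monomial_ideal_cancel:
  fixes q :: "('v, 'k::idom) mpoly"
  assumes "single (squarefree_monomial T) 1 * q \<in> monomial_ideal S A" "finite T"
    and "\<And>i. i \<in> A \<Longrightarrow> S i \<inter> T = {}"
  shows "q \<in> monomial_ideal S A"
  unfolding monomial_ideal_def
proof safe
  fix m assume "m \<in> keys q"
  then have "squarefree_monomial T + m \<in> keys (single (squarefree_monomial T) 1 * q)"
    unfolding in_keys_iff by (simp add: lookup_single_times)
  then obtain i where "i \<in> A" "S i \<subseteq> keys (squarefree_monomial T + m)"
    using assms(1) unfolding monomial_ideal_def by blast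
  then show "\<exists>i\<in>A. S i \<subseteq> keys m"
    using assms(2,3) by (auto simp: keys_add_nat keys_squarefree_monomial)
qed

definition leads :: "('v \<Rightarrow> nat) \<Rightarrow> ('i \<Rightarrow> ('v, 'k::comm_ring_1) mpoly) \<Rightarrow> ('i \<Rightarrow> 'v set) \<Rightarrow> 'i set \<Rightarrow> bool" where
  "leads w f S A \<longleftrightarrow> finite A \<and> disjoint_family_on S A \<and>
     (\<forall>i\<in>A. finite (S i) \<and>
        top_part w (weight w (squarefree_monomial (S i))) (single (squarefree_monomial (S i)) 1) (f i))"

lemma leads_subset: "leads w f S A \<Longrightarrow> B \<subseteq> A \<Longrightarrow> leads w f S B"
  unfolding leads_def disjoint_family_on_def by (meson finite_subset subset_iff)

text \<open>
  A generator dividing each monomial of \<open>q\<close> is chosen; replacing its initial monomial by the generator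
  itself changes \<open>q\<close> only in lower weights.
\<close>

lemma monomial_ideal_lift:
  fixes q :: "('v, 'k::comm_ring_1) mpoly"
  assumes "leads w f S A" "q \<in> monomial_ideal S A" "homogeneous w n q"
  obtains h where "h \<in> ideal_span (f ` A)" "lower w n (h - q)"
proof -
  have "\<exists>t. i \<in> A \<and> m = squarefree_monomial (S i) + t" if "S i \<subseteq> keys m" "i \<in> A" for i m
    using squarefree_monomial_factor[OF _ that(1)] assms(1) that(2) unfolding leads_def by metis
  then have "\<forall>m\<in>keys q. \<exists>i t. i \<in> A \<and> m = squarefree_monomial (S i) + t"
    using assms(2) unfolding monomial_ideal_def by blast
  then obtain i t where it: "\<And>m. m \<in> keys q \<Longrightarrow> i m \<in> A \<and> m = squarefree_monomial (S (i m)) + t m"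
    by metis
  define h where "h = (\<Sum>m\<in>keys q. single (t m) (lookup q m) * f (i m))"
  have "h \<in> ideal_span (f ` A)"
    unfolding h_def using it by (intro gen.span_sum gen.span_scale gen.span_base) blast
  moreover have "h - q = (\<Sum>m\<in>keys q. single (t m) (lookup q m) * f (i m) - single m (lookup q m))"
    unfolding h_def sum_subtractf using poly_mapping_eq_sum_single[of q] by simp
  moreover have "lower w n (single (t m) (lookup q m) * f (i m) - single m (lookup q m))"
    if m: "m \<in> keys q" for m
  proof -
    let ?s = "squarefree_monomial (S (i m))"
    have i: "i m \<in> A" and eq: "m = ?s + t m" using it[OF m] by auto
    have tp: "top_part w (weight w ?s) (single ?s 1) (f (i m))"
      using assms(1) i unfolding leads_def by blast
    have "weight w m = n" using assms(3) m unfolding homogeneous_def by blast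
    moreover have "weight w m = weight w (t m) + weight w ?s"
      by (subst eq) (simp add: weight_add)
    moreover have "lower w (weight w (t m) + weight w ?s)
        (single (t m) (lookup q m) * (f (i m) - single ?s 1))"
      using tp unfolding top_part_def
      by (intro homogeneous_lower_mult homogeneous_single) auto
    moreover have "single (t m) (lookup q m) * single ?s 1 = single m (lookup q m)"
      using eq by (simp add: mult_single add.commute)
    ultimately show ?thesis by (simp add: right_diff_distrib)
  qed
  ultimately show ?thesis
    using that by (simp add: lower_sum)
qed

text \<open>
  The generators form a Groebner basis with respect to the weights, because their initial monomials
  are pairwise coprime. By induction on the number of generators, an element of the ideal is
  \<open>u + g * f j\<close> with \<open>u\<close> in the ideal of the earlier ones. If the top parts of \<open>u\<close> and \<open>g * f j\<close> do
  not cancel, one of them or their sum is the top part. If they cancel, then the top part of \<open>g\<close>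
  times the monomial of \<open>f j\<close> lies in the earlier monomial ideal, so by coprimality the top part of \<open>g\<close>
  does, and \<open>g\<close> can be replaced by a cofactor of smaller weight.
\<close>

theorem top_part_in_monomial_ideal:
  fixes f :: "'i \<Rightarrow> ('v::linorder, 'k::idom) mpoly"
  assumes "leads w f S A" "p \<in> ideal_span (f ` A)" "top_part w n q p"
  shows "q \<in> monomial_ideal S A"
proof -
  have "finite A" using assms(1) by (simp add: leads_def)
  then show ?thesis using assms
  proof (induction A arbitrary: p n q rule: finite_induct)
    case empty
    then show ?case using top_part_nonzero by auto
  next
    case (insert j A)
    have lA: "leads w f S A" using insert.prems(1) by (rule leads_subset) auto
    let ?s = "squarefree_monomial (S j)" let ?x = "single ?s 1 :: ('v, 'k) mpoly"
    have finj: "finite (S j)" and tj: "top_part w (weight w ?s) ?x (f j)"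
      using insert.prems(1) by (auto simp: leads_def)
    have disj: "i \<in> A \<Longrightarrow> S i \<inter> S j = {}" for i
      using insert.prems(1) insert.hyps(2) by (auto simp: leads_def disjoint_family_on_def)
    have "?x \<noteq> 0" using tj by (simp add: top_part_def)
    have mono: "monomial_ideal S A \<subseteq> (monomial_ideal S (insert j A) :: ('v, 'k) mpoly set)"
      by (rule monomial_ideal_mono) auto
    have mj: "g * ?x \<in> monomial_ideal S (insert j A)" for g
      using keys_mult[of g ?x] finj
      by (fastforce simp: monomial_ideal_def keys_add_nat keys_squarefree_monomial)
    \<comment> \<open>Induction on a bound \<open>N\<close> for the weight of the cofactor of \<open>f j\<close>.\<close>
    have *: "lower w N g \<Longrightarrow> p - g * f j \<in> ideal_span (f ` A) \<Longrightarrow> q \<in> monomial_ideal S (insert j A)"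
      for N g
    proof (induction N arbitrary: g)
      case 0
      then have "p \<in> ideal_span (f ` A)" by simp
      from insert.IH[OF lA this insert.prems(3)] mono show ?case by blast
    next
      case (Suc N)
      show ?case
      proof (cases "g = 0")
        case True
        then have "p \<in> ideal_span (f ` A)" using Suc.prems by simp
        from insert.IH[OF lA this insert.prems(3)] mono show ?thesis by blast
      next
        case False
        then obtain k g0 where g0: "top_part w k g0 g" using top_part_exists by blast
        have k: "k \<le> N" using top_part_degree_le[OF g0 Suc.prems(1)] by simp
        show ?thesis
        proof (cases "g0 \<in> monomial_ideal S A")
          case True
          moreover have "homogeneous w k g0" using g0 by (simp add: top_part_def)
          ultimately obtain h where h: "h \<in> ideal_span (f ` A)" "lower w k (h - g0)"
            using monomial_ideal_lift[OF lA] by blast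
          have "lower w N (g - h)"
            using top_part_minus_lower[OF g0 h(2)] k lower_mono by blast
          moreover have "p - (g - h) * f j \<in> ideal_span (f ` A)"
            using gen.span_add[OF Suc.prems(2) ideal_span_scale_right[OF h(1), of "f j"]]
            by (simp add: algebra_simps)
          ultimately show ?thesis by (rule Suc.IH)
        next
          case notin: False
          define u where "u = p - g * f j"
          have p: "p = u + g * f j" by (simp add: u_def)
          have u: "u \<in> ideal_span (f ` A)" using Suc.prems(2) by (simp add: u_def)
          let ?K = "k + weight w ?s"
          have tg: "top_part w ?K (g0 * ?x) (g * f j)" using g0 tj by (rule top_part_mult)
          show ?thesis
          proof (cases "u = 0")
            case True
            then have "q = g0 * ?x" using insert.prems(3) tg p top_part_unique by fastforce
            then show ?thesis using mj by simp
          next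
            case False
            then obtain l u0 where u0: "top_part w l u0 u" using top_part_exists by blast
            have u0A: "u0 \<in> monomial_ideal S A" by (rule insert.IH[OF lA u u0])
            consider "l < ?K" | "?K < l" | "l = ?K" by linarith
            then show ?thesis
            proof cases
              case 1
              then have "lower w ?K u" using top_part_lower_Suc[OF u0] by (rule_tac lower_mono) auto
              then have "top_part w ?K (g0 * ?x) p"
                using top_part_add_lower[OF tg] p by (simp add: add.commute)
              then show ?thesis using insert.prems(3) top_part_unique mj by metis
            next
              case 2
              then have "lower w l (g * f j)" using top_part_lower_Suc[OF tg] by (rule_tac lower_mono) auto
              then have "top_part w l u0 p" using top_part_add_lower[OF u0] p by simp
              then show ?thesis using insert.prems(3) top_part_unique u0A mono by blast
            next
              case 3
              have "u0 + g0 * ?x \<noteq> 0"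
              proof
                assume "u0 + g0 * ?x = 0"
                then have "?x * g0 = - u0" by (simp add: mult.commute eq_neg_iff_add_eq_0 add.commute)
                then have "?x * g0 \<in> monomial_ideal S A" using u0A monomial_ideal_uminus by metis
                then have "g0 \<in> monomial_ideal S A"
                  by (rule monomial_ideal_cancel) (use finj disj in auto)
                then show False using notin by blast
              qed
              moreover have "homogeneous w l (u0 + g0 * ?x)"
                using u0 tg 3 by (auto simp: top_part_def intro: homogeneous_add)
              moreover have "lower w l (p - (u0 + g0 * ?x))"
                using lower_add[of w l "u - u0" "g * f j - g0 * ?x"] u0 tg 3
                by (simp add: top_part_def p algebra_simps)
              ultimately have "top_part w l (u0 + g0 * ?x) p" by (simp add: top_part_def)
              then have "q = u0 + g0 * ?x" using insert.prems(3) top_part_unique by blast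
              then show ?thesis using u0A mono mj monomial_ideal_add by blast
            qed
          qed
        qed
      qed
    qed
    from insert.prems(2) obtain g where g: "p - g * f j \<in> ideal_span (f ` A)"
      using gen.span_breakdown_eq[of p "f j" "f ` A"] by auto
    show ?case
    proof (cases "g = 0")
      case True
      then show ?thesis using *[of 0 g] g by simp
    next
      case False
      then obtain k g0 where "top_part w k g0 g" using top_part_exists by blast
      then show ?thesis using *[OF top_part_lower_Suc g] by blast
    qed
  qed
qed

text \<open>
  Division with remainder by the generators: an element whose initial form is in the initial ideal
  can be changed modulo the ideal to one of smaller weight. If the property \<open>P\<close>, which is stable
  under such changes, always forces this, the process ends at zero.
\<close>

lemma ideal_span_descent:
  fixes f :: "'i \<Rightarrow> ('v::linorder, 'k::idom) mpoly"
  assumes "leads w f S A" "P p"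
    and "\<And>p n q. P p \<Longrightarrow> top_part w n q p \<Longrightarrow> q \<in> monomial_ideal S A"
    and "\<And>p h. P p \<Longrightarrow> h \<in> ideal_span (f ` A) \<Longrightarrow> P (p - h)"
  shows "p \<in> ideal_span (f ` A)"
proof -
  have "lower w N p \<Longrightarrow> P p \<Longrightarrow> p \<in> ideal_span (f ` A)" for N p
  proof (induction N arbitrary: p)
    case 0
    then show ?case by (simp add: gen.span_zero)
  next
    case (Suc N)
    show ?case
    proof (cases "p = 0")
      case True
      then show ?thesis by (simp add: gen.span_zero)
    next
      case False
      then obtain n q where t: "top_part w n q p" using top_part_exists by blast
      have "q \<in> monomial_ideal S A" "homogeneous w n q"
        using assms(3)[OF Suc.prems(2) t] t by (auto simp: top_part_def)
      then obtain h where h: "h \<in> ideal_span (f ` A)" "lower w n (h - q)"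
        using monomial_ideal_lift[OF assms(1)] by blast
      have "n \<le> N" using top_part_degree_le[OF t Suc.prems(1)] by simp
      then have "lower w N (p - h)" using top_part_minus_lower[OF t h(2)] lower_mono by blast
      then have "p - h \<in> ideal_span (f ` A)" by (rule Suc.IH) (rule assms(4)[OF Suc.prems(2) h(1)])
      then show ?thesis using gen.span_add[OF _ h(1)] by fastforce
    qed
  qed
  moreover obtain N where "lower w N p"
    using top_part_exists[of p] top_part_lower_Suc lower_0 by metis
  ultimately show ?thesis using assms(2) by blast
qed

theorem ideal_span_radical:
  fixes f :: "'i \<Rightarrow> ('v::linorder, 'k::idom) mpoly"
  assumes "leads w f S A" "p ^ k \<in> ideal_span (f ` A)"
  shows "p \<in> ideal_span (f ` A)"
proof (rule ideal_span_descent[where P = "\<lambda>p. p ^ k \<in> ideal_span (f ` A)", OF assms])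
  fix p n q assume "p ^ k \<in> ideal_span (f ` A)" "top_part w n q p"
  then have "q ^ k \<in> monomial_ideal S A"
    using top_part_in_monomial_ideal[OF assms(1)] top_part_power by blast
  then show "q \<in> monomial_ideal S A" by (rule monomial_ideal_radical)
next
  fix p h assume p: "p ^ k \<in> ideal_span (f ` A)" and h: "h \<in> ideal_span (f ` A)"
  obtain c where "p ^ k - (p - h) ^ k = (p - (p - h)) * c"
    using diff_dvd_power_diff[of p "p - h" k] by (auto elim: dvdE)
  then have "p ^ k - (p - h) ^ k \<in> ideal_span (f ` A)"
    using ideal_span_scale_right[OF h, of c] by simp
  then show "(p - h) ^ k \<in> ideal_span (f ` A)" using p ideal_span_cong by blast
qed

theorem ideal_span_nonzerodivisor:
  fixes f :: "'i \<Rightarrow> ('v::linorder, 'k::idom) mpoly"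
  assumes "leads w f S (insert j A)" "j \<notin> A" "f j * p \<in> ideal_span (f ` A)"
  shows "p \<in> ideal_span (f ` A)"
proof -
  have lA: "leads w f S A" using assms(1) by (rule leads_subset) auto
  show ?thesis
  proof (rule ideal_span_descent[where P = "\<lambda>p. f j * p \<in> ideal_span (f ` A)", OF lA assms(3)])
    fix p n q assume p: "f j * p \<in> ideal_span (f ` A)" "top_part w n q p"
    let ?s = "squarefree_monomial (S j)"
    have "top_part w (weight w ?s + n) (single ?s 1 * q) (f j * p)"
      by (rule top_part_mult[OF _ p(2)]) (use assms(1) in \<open>auto simp: leads_def\<close>)
    then have "single ?s 1 * q \<in> monomial_ideal S A"
      using top_part_in_monomial_ideal[OF lA p(1)] by blast
    then show "q \<in> monomial_ideal S A"
      by (rule monomial_ideal_cancel)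
        (use assms(1,2) in \<open>auto simp: leads_def disjoint_family_on_def\<close>)
  next
    fix p h assume "f j * p \<in> ideal_span (f ` A)" "h \<in> ideal_span (f ` A)"
    then show "f j * (p - h) \<in> ideal_span (f ` A)"
      by (simp add: right_diff_distrib gen.span_diff gen.span_scale)
  qed
qed

section \<open>Forests\<close>

definition undirected :: "'v \<times> 'v \<Rightarrow> 'v set" where
  "undirected e = {fst e, snd e}"

lemma undirected_simp [simp]: "undirected (v, l) = {v, l}"
  by (simp add: undirected_def)

definition endpoints :: "('v \<times> 'v) set \<Rightarrow> 'v set" where
  "endpoints A = (\<Union>e\<in>A. undirected e)"

text \<open>
  The head of the list is the edge added last; its second component is the new leaf. The edges
  are thereby oriented from parent to child.
\<close>

fun leaf_order :: "('v \<times> 'v) list \<Rightarrow> bool" where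
  "leaf_order [] \<longleftrightarrow> True"
| "leaf_order ((v, l) # es) \<longleftrightarrow> v \<noteq> l \<and> l \<notin> endpoints (set es) \<and> leaf_order es"

lemma endpoints_insert [simp]: "endpoints (insert (v, l) A) = {v, l} \<union> endpoints A"
  and endpoints_empty [simp]: "endpoints {} = {}"
  by (auto simp: endpoints_def)

lemma undirected_subset_endpoints: "e \<in> A \<Longrightarrow> undirected e \<subseteq> endpoints A"
  unfolding endpoints_def by blast

definition path_in :: "'v set set \<Rightarrow> 'v list \<Rightarrow> bool" where
  "path_in E xs \<longleftrightarrow> distinct xs \<and> 2 \<le> length xs \<and>
     (\<forall>i. Suc i < length xs \<longrightarrow> {xs ! i, xs ! Suc i} \<in> E)"

text \<open>
  An end point of a longest path is a leaf: a neighbour of it outside the path would extend the path,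
  and a neighbour on the path other than the next vertex would close a cycle.
\<close>

lemma forest_has_leaf:
  assumes "forest V E" "E \<noteq> {}"
  obtains v l where "{v, l} \<in> E" "v \<noteq> l" "\<And>e. e \<in> E \<Longrightarrow> l \<in> e \<Longrightarrow> e = {v, l}"
proof -
  have fin: "finite V" and two: "\<And>e. e \<in> E \<Longrightarrow> e \<subseteq> V \<and> card e = 2"
    and nocycle: "\<And>vs. \<not> graph_cycle E vs"
    using assms(1) by (auto simp: forest_def simple_graph_def)
  have bound: "length xs \<le> card V" if p: "path_in E xs" for xs
  proof -
    have "x \<in> V" if x: "x \<in> set xs" for x
    proof -
      obtain i where i: "i < length xs" "xs ! i = x" using x by (auto simp: in_set_conv_nth)
      show "x \<in> V"
      proof (cases "Suc i < length xs")
        case True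
        then have "{xs ! i, xs ! Suc i} \<in> E" using p unfolding path_in_def by blast
        then show ?thesis using two i(2) by blast
      next
        case False
        then obtain j where j: "i = Suc j" "Suc j < length xs"
          using i p by (cases i) (auto simp: path_in_def)
        then have "{xs ! j, xs ! Suc j} \<in> E" using p unfolding path_in_def by blast
        then show ?thesis using two i(2) j(1) by blast
      qed
    qed
    then have "card (set xs) \<le> card V" using fin by (intro card_mono) auto
    then show ?thesis using p by (simp add: path_in_def distinct_card)
  qed
  obtain e where "e \<in> E" using assms(2) by blast
  then obtain a b where ab: "e = {a, b}" "a \<noteq> b" using two[of e] unfolding card_2_iff by blast
  then have "path_in E [a, b]" using \<open>e \<in> E\<close> by (simp add: path_in_def)
  moreover have "length xs < Suc (card V)" if "path_in E xs" for xs
    using bound[OF that] by simp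
  ultimately obtain xs where xs: "path_in E xs"
    and max: "\<And>ys. path_in E ys \<Longrightarrow> length ys \<le> length xs"
    using ex_has_greatest_nat[of "path_in E" "[a, b]" length "Suc (card V)"] by metis
  have len: "2 \<le> length xs" and dist: "distinct xs"
    and step: "\<And>i. Suc i < length xs \<Longrightarrow> {xs ! i, xs ! Suc i} \<in> E"
    using xs by (auto simp: path_in_def)
  have "e = {xs ! 1, xs ! 0}" if e: "e \<in> E" "xs ! 0 \<in> e" for e
  proof -
    obtain u where u: "e = {u, xs ! 0}" "u \<noteq> xs ! 0"
      using two[OF e(1)] e(2) unfolding card_2_iff by (auto simp: insert_commute)
    have "u \<in> set xs"
    proof (rule ccontr)
      assume "u \<notin> set xs"
      then have "path_in E (u # xs)"
        using len dist step e(1) u by (auto simp: path_in_def nth_Cons split: nat.split)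
      then show False using max by fastforce
    qed
    then obtain i where i: "i < length xs" "xs ! i = u" by (auto simp: in_set_conv_nth)
    have "i \<noteq> 0" using i(2) u(2) by metis
    moreover have "i < 2"
    proof (rule ccontr)
      assume "\<not> i < 2"
      have lt: "length (take (Suc i) xs) = Suc i" using i(1) by simp
      have "{take (Suc i) xs ! j, take (Suc i) xs ! (Suc j mod length (take (Suc i) xs))} \<in> E"
        if j: "j < length (take (Suc i) xs)" for j
      proof (cases "j = i")
        case True
        then show ?thesis using i(2) u(1) e(1) unfolding lt by simp
      next
        case False
        then show ?thesis using i(1) j step[of j] unfolding lt by simp
      qed
      then have "graph_cycle E (take (Suc i) xs)"
        using lt dist \<open>\<not> i < 2\<close> by (simp add: graph_cycle_def)
      then show False using nocycle by blast
    qed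
    ultimately have "i = 1" by simp
    then show ?thesis using i u by simp
  qed
  moreover have "{xs ! 1, xs ! 0} \<in> E" using step[of 0] len by (simp add: insert_commute)
  moreover have "xs ! 1 \<noteq> xs ! 0" using nth_eq_iff_index_eq[OF dist, of 1 0] len by linarith
  ultimately show ?thesis using that by blast
qed

lemma forest_subset: "forest V E \<Longrightarrow> E' \<subseteq> E \<Longrightarrow> forest V E'"
  unfolding forest_def simple_graph_def graph_cycle_def by blast

theorem forest_has_leaf_order:
  assumes "forest V E"
  obtains es where "leaf_order es" "undirected ` set es = E"
proof -
  have "finite E"
    using assms finite_subset[of E "Pow V"] by (auto simp: forest_def simple_graph_def)
  then have "\<exists>es. leaf_order es \<and> undirected ` set es = E"
    using assms
  proof (induction "card E" arbitrary: E)
    case 0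
    then show ?case by (intro exI[of _ "[]"]) auto
  next
    case (Suc N)
    then have "E \<noteq> {}" by auto
    then obtain v l where vl: "{v, l} \<in> E" "v \<noteq> l" "\<And>e. e \<in> E \<Longrightarrow> l \<in> e \<Longrightarrow> e = {v, l}"
      using forest_has_leaf[OF Suc.prems(2)] by blast
    have "forest V (E - {{v, l}})" using Suc.prems(2) by (rule forest_subset) auto
    moreover have "N = card (E - {{v, l}})" using Suc.hyps(2) vl(1) by simp
    ultimately obtain es where es: "leaf_order es" "undirected ` set es = E - {{v, l}}"
      using Suc.hyps(1)[of "E - {{v, l}}"] Suc.prems(1) by auto
    have "l \<notin> endpoints (set es)"
    proof
      assume "l \<in> endpoints (set es)"
      then obtain e where "e \<in> set es" "l \<in> undirected e"
        unfolding endpoints_def by blast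
      then have "undirected e \<in> E - {{v, l}}" using es(2) by blast
      then show False using vl(3)[of "undirected e"] \<open>l \<in> undirected e\<close> by simp
    qed
    then have "leaf_order ((v, l) # es)" using es(1) vl(2) by simp
    moreover have "undirected ` set ((v, l) # es) = E" using es(2) vl(1) by (simp add: insert_absorb)
    ultimately show ?case by blast
  qed
  then show ?thesis using that by blast
qed

lemma leaf_order_neq: "leaf_order es \<Longrightarrow> (v, l) \<in> set es \<Longrightarrow> v \<noteq> l"
  by (induction es rule: leaf_order.induct) auto

lemma inj_on_undirected: "leaf_order es \<Longrightarrow> inj_on undirected (set es)"
proof (induction es rule: leaf_order.induct)
  case (2 v l es)
  have "undirected (v, l) \<noteq> undirected e" if "e \<in> set es" for e
    using 2(2) undirected_subset_endpoints[OF that] by auto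
  then have "undirected (v, l) \<notin> undirected ` set es" by blast
  then show ?case using 2 unfolding list.set leaf_order.simps inj_on_insert by blast
qed auto

definition edges_at :: "('v \<times> 'v) set \<Rightarrow> 'v \<Rightarrow> ('v \<times> 'v) set" where
  "edges_at A v = {e \<in> A. v \<in> undirected e}"

lemma card_edges_at_le:
  assumes "leaf_order es" "finite V" "endpoints (set es) \<subseteq> V"
  shows "card (edges_at (set es) v) \<le> max_degree V (undirected ` set es)"
proof (cases "v \<in> V")
  case True
  have "card (edges_at (set es) v) \<le> vertex_degree (undirected ` set es) v"
    unfolding vertex_degree_def
  proof (rule card_inj_on_le[where f = undirected])
    show "inj_on undirected (edges_at (set es) v)"
      using inj_on_undirected[OF assms(1)] by (rule inj_on_subset) (auto simp: edges_at_def)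
  qed (auto simp: edges_at_def)
  also have "\<dots> \<le> max_degree V (undirected ` set es)"
    unfolding max_degree_def using assms(2) True by (intro Max_ge) auto
  finally show ?thesis .
next
  case False
  then have "edges_at (set es) v = {}"
    using assms(3) unfolding edges_at_def endpoints_def by blast
  then show ?thesis by simp
qed

text \<open>
  The colours are coordinates. The last condition says that among the terms \<open>y(v,k) y(l,k)\<close> of the
  generator of an edge, the term at the colour of the edge has strictly the largest weight.
\<close>

definition leading_colors ::
  "nat \<Rightarrow> nat \<Rightarrow> ('v \<times> 'v) set \<Rightarrow> ('v \<times> 'v \<Rightarrow> nat) \<Rightarrow> ('v \<times> nat \<Rightarrow> nat) \<Rightarrow> bool" where
  "leading_colors D d A c w \<longleftrightarrow> (\<forall>e\<in>A. c e \<in> {1..D}) \<and>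
    (\<forall>e\<in>A. \<forall>e'\<in>A. e \<noteq> e' \<longrightarrow> c e = c e' \<longrightarrow> undirected e \<inter> undirected e' = {}) \<and>
    (\<forall>v l k. (v, l) \<in> A \<longrightarrow> k \<in> {1..d} \<longrightarrow> k \<noteq> c (v, l) \<longrightarrow>
       w (v, k) + w (l, k) < w (v, c (v, l)) + w (l, c (v, l)))"

text \<open>
  A new leaf edge at \<open>v\<close> is given a colour that is not yet used at \<open>v\<close>, which exists by the degree bound.
  All other conditions concern old vertices only, so the weights at the new leaf are free:
  its colour gets a weight exceeding all weights at \<open>v\<close>, and its other coordinates get weight zero.
\<close>

theorem leaf_order_leading_colors:
  assumes "leaf_order es" "\<And>v. card (edges_at (set es) v) \<le> D"
  shows "\<exists>c w. leading_colors D d (set es) c w"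
  using assms
proof (induction es rule: leaf_order.induct)
  case 1
  then show ?case by (simp add: leading_colors_def)
next
  case (2 v l es)
  have new: "v \<noteq> l" "l \<notin> endpoints (set es)" "leaf_order es" using 2(2) by auto
  have notin: "(v, l) \<notin> set es"
    using new(2) undirected_subset_endpoints[of "(v, l)" "set es"] by auto
  have le: "card (edges_at (set es) u) \<le> D" for u
  proof -
    have "card (edges_at (set es) u) \<le> card (edges_at (set ((v, l) # es)) u)"
      by (rule card_mono) (auto simp: edges_at_def)
    then show ?thesis using 2(3)[of u] by simp
  qed
  obtain c w where "leading_colors D d (set es) c w"
    using 2(1)[OF new(3) le] by blast
  then have c: "\<And>e. e \<in> set es \<Longrightarrow> c e \<in> {1..D}"
    and cc: "\<And>e e'. e \<in> set es \<Longrightarrow> e' \<in> set es \<Longrightarrow> e \<noteq> e' \<Longrightarrow> c e = c e' \<Longrightarrow>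
         undirected e \<inter> undirected e' = {}"
    and w: "\<And>v l k. (v, l) \<in> set es \<Longrightarrow> k \<in> {1..d} \<Longrightarrow> k \<noteq> c (v, l) \<Longrightarrow>
         w (v, k) + w (l, k) < w (v, c (v, l)) + w (l, c (v, l))"
    unfolding leading_colors_def by simp_all
  have "edges_at (set ((v, l) # es)) v = insert (v, l) (edges_at (set es) v)"
    by (auto simp: edges_at_def)
  moreover have "finite (edges_at (set es) v)" "(v, l) \<notin> edges_at (set es) v"
    using notin by (auto simp: edges_at_def)
  ultimately have "card (edges_at (set es) v) < D" using 2(3)[of v] by simp
  then have "card (c ` edges_at (set es) v) < card {1..D}"
    using card_image_le[OF \<open>finite (edges_at (set es) v)\<close>, of c] by simp
  then have "\<not> {1..D} \<subseteq> c ` edges_at (set es) v"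
    using card_mono[of "c ` edges_at (set es) v" "{1..D}"] \<open>finite (edges_at (set es) v)\<close> by force
  then obtain k0 where k0: "k0 \<in> {1..D}" "k0 \<notin> c ` edges_at (set es) v" by blast
  define c' where "c' = c((v, l) := k0)"
  define w' where "w' = (\<lambda>(u, k). if u = l then (if k = k0 then 1 + (\<Sum>k\<in>{1..d}. w (v, k)) else 0) else w (u, k))"
  have c'_old: "c' e = c e" if "e \<in> set es" for e using that notin by (auto simp: c'_def)
  have "\<forall>e\<in>set ((v, l) # es). c' e \<in> {1..D}"
    using c k0(1) c'_old by (auto simp: c'_def)
  moreover have disj: "undirected e \<inter> undirected (v, l) = {}" if "e \<in> set es" "c e = k0" for e
  proof -
    have "l \<notin> undirected e" using undirected_subset_endpoints[OF that(1)] new(2) by blast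
    moreover have "v \<notin> undirected e" using k0(2) that by (auto simp: edges_at_def)
    ultimately show ?thesis by simp
  qed
  have "\<forall>e\<in>set ((v, l) # es). \<forall>e'\<in>set ((v, l) # es).
      e \<noteq> e' \<longrightarrow> c' e = c' e' \<longrightarrow> undirected e \<inter> undirected e' = {}"
  proof (intro ballI impI)
    fix e e' assume *: "e \<in> set ((v, l) # es)" "e' \<in> set ((v, l) # es)" "e \<noteq> e'" "c' e = c' e'"
    consider "e = (v, l)" "e' \<in> set es" | "e' = (v, l)" "e \<in> set es" | "e \<in> set es" "e' \<in> set es"
      using * by auto
    then show "undirected e \<inter> undirected e' = {}"
    proof cases
      case 1
      then show ?thesis using disj[of e'] * c'_old[of e'] by (auto simp: c'_def)
    next
      case 2
      then show ?thesis using disj[of e] * c'_old[of e] by (auto simp: c'_def)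
    next
      case 3
      then show ?thesis using cc * c'_old by simp
    qed
  qed
  moreover have "\<forall>a b k. (a, b) \<in> set ((v, l) # es) \<longrightarrow> k \<in> {1..d} \<longrightarrow> k \<noteq> c' (a, b) \<longrightarrow>
         w' (a, k) + w' (b, k) < w' (a, c' (a, b)) + w' (b, c' (a, b))"
  proof (intro allI impI)
    fix a b k
    assume *: "(a, b) \<in> set ((v, l) # es)" "k \<in> {1..d}" "k \<noteq> c' (a, b)"
    show "w' (a, k) + w' (b, k) < w' (a, c' (a, b)) + w' (b, c' (a, b))"
    proof (cases "(a, b) \<in> set es")
      case True
      then have "a \<noteq> l" "b \<noteq> l" using undirected_subset_endpoints[OF True] new(2) by auto
      then show ?thesis using w[OF True *(2)] *(3) c'_old[OF True] by (simp add: w'_def)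
    next
      case False
      then have "a = v" "b = l" using * by auto
      moreover have "w (v, k) \<le> (\<Sum>k\<in>{1..d}. w (v, k))"
        using *(2) by (intro member_le_sum) auto
      ultimately show ?thesis using * new(1) by (simp add: w'_def c'_def)
    qed
  qed
  ultimately have "leading_colors D d (set ((v, l) # es)) c' w'"
    unfolding leading_colors_def by blast
  then show ?case by blast
qed

section \<open>Polynomial rings are completely integrally closed\<close>

definition polys_in :: "'v set \<Rightarrow> ('v, 'k::zero) mpoly set" where
  "polys_in U = {p. \<forall>m\<in>keys p. keys m \<subseteq> U}"

lemma polys_in_0 [simp]: "0 \<in> polys_in U"
  and polys_in_1 [simp]: "(1 :: ('v, 'k::comm_ring_1) mpoly) \<in> polys_in U"
  by (auto simp: polys_in_def)

lemma polys_in_add: "p \<in> polys_in U \<Longrightarrow> q \<in> polys_in U \<Longrightarrow> p + q \<in> polys_in U"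
  using keys_add[of p q] unfolding polys_in_def by blast

lemma polys_in_uminus: "p \<in> polys_in U \<Longrightarrow> - p \<in> polys_in U"
  for p :: "('v, 'k::comm_ring_1) mpoly"
  by (simp add: polys_in_def in_keys_iff)

lemma polys_in_mult:
  fixes p :: "('v, 'k::comm_ring_1) mpoly"
  assumes "p \<in> polys_in U" "q \<in> polys_in U"
  shows "p * q \<in> polys_in U"
  unfolding polys_in_def mem_Collect_eq
proof
  fix m assume "m \<in> keys (p * q)"
  then obtain a b where "m = a + b" "a \<in> keys p" "b \<in> keys q" using keys_mult by blast
  then show "keys m \<subseteq> U" using assms by (auto simp: keys_add_nat polys_in_def)
qed

lemma polys_in_power: "p \<in> polys_in U \<Longrightarrow> p ^ k \<in> polys_in U"
  for p :: "('v, 'k::comm_ring_1) mpoly"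
  by (induction k) (auto intro: polys_in_mult)

lemma polys_in_sum: "(\<And>i. i \<in> A \<Longrightarrow> f i \<in> polys_in U) \<Longrightarrow> sum f A \<in> polys_in U"
  by (induction A rule: infinite_finite_induct) (auto intro: polys_in_add)

lemma polys_in_single: "keys m \<subseteq> U \<Longrightarrow> single m c \<in> polys_in U"
  by (simp add: polys_in_def)

abbreviation degree_weight :: "'v \<Rightarrow> 'v \<Rightarrow> nat" where
  "degree_weight x \<equiv> (\<lambda>v. if v = x then 1 else 0)"

lemma weight_degree_weight: "weight (degree_weight x) m = lookup m x"
proof -
  have "weight (degree_weight x) m = (\<Sum>v\<in>insert x (keys m). lookup m v * degree_weight x v)"
    by (rule weight_eq_sum) auto
  also have "\<dots> = (\<Sum>v\<in>insert x (keys m). if v = x then lookup m v else 0)"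
    by (rule sum.cong) auto
  finally show ?thesis by (simp add: sum.delta)
qed

text \<open>
  With the weight that is one on \<open>x\<close> and zero elsewhere, the weight is the degree in \<open>x\<close>, and the top
  part of a polynomial is its leading coefficient times a power of \<open>x\<close>.
\<close>

lemma homogeneous_in_variable:
  fixes p :: "('v, 'k::comm_ring_1) mpoly"
  assumes "homogeneous (degree_weight x) n p" "p \<in> polys_in (insert x U)"
  obtains \<alpha> where "p = single (single x n) 1 * \<alpha>" "\<alpha> \<in> polys_in (U - {x})"
proof
  let ?\<alpha> = "\<Sum>m\<in>keys p. single (m - single x n) (lookup p m)"
  have m: "single x n + (m - single x n) = m" if "m \<in> keys p" for m
  proof -
    have "lookup m x = n"
      using assms(1) that unfolding homogeneous_def weight_degree_weight by blast
    then show ?thesis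
      by (intro poly_mapping_eqI) (auto simp: lookup_add lookup_minus lookup_single when_def)
  qed
  have "single (single x n) 1 * ?\<alpha> = (\<Sum>m\<in>keys p. single m (lookup p m))"
    unfolding sum_distrib_left mult_single using m by (intro sum.cong) auto
  then show "p = single (single x n) 1 * ?\<alpha>" using poly_mapping_eq_sum_single[of p] by simp
  show "?\<alpha> \<in> polys_in (U - {x})"
  proof (intro polys_in_sum polys_in_single)
    fix m assume "m \<in> keys p"
    then have "lookup m x = n" "keys m \<subseteq> insert x U"
      using assms unfolding homogeneous_def weight_degree_weight polys_in_def by blast+
    moreover have "v \<in> keys m \<and> (v = x \<longrightarrow> lookup m x \<noteq> n)" if "v \<in> keys (m - single x n)" for v
      using that unfolding in_keys_iff by (auto simp: lookup_minus lookup_single when_def)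
    ultimately show "keys (m - single x n) \<subseteq> U - {x}" by blast
  qed
qed

lemma polys_in_homogeneous_0:
  "\<alpha> \<in> polys_in (U - {x}) \<Longrightarrow> homogeneous (degree_weight x) 0 \<alpha>"
  unfolding homogeneous_def weight_degree_weight polys_in_def
  using not_in_keys_iff_lookup_eq_zero by fast

text \<open>
  Division by a polynomial whose leading coefficient \<open>\<beta>\<close> in \<open>x\<close> need not be invertible. Multiplying the
  dividend by \<open>\<beta>\<close> and subtracting a multiple of \<open>b\<close> cancels its leading term.
\<close>

lemma pseudo_division:
  fixes b :: "('v::linorder, 'k::idom) mpoly"
  assumes b: "top_part (degree_weight x) n (single (single x n) 1 * \<beta>) b"
    and \<beta>: "\<beta> \<in> polys_in (U - {x})"
  shows "\<exists>s q. lower (degree_weight x) n (\<beta> ^ s * a - q * b)"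
proof -
  let ?w = "degree_weight x"
  have "lower ?w N a \<Longrightarrow> \<exists>s q. lower ?w n (\<beta> ^ s * a - q * b)" for N
  proof (induction N arbitrary: a)
    case 0
    then show ?case by (intro exI[of _ 0]) simp
  next
    case (Suc N)
    show ?case
    proof (cases "lower ?w n a")
      case True
      then show ?thesis by (intro exI[of _ 0]) simp
    next
      case notlower: False
      then have "a \<noteq> 0" by auto
      then obtain k a0 where a0: "top_part ?w k a0 a" using top_part_exists by blast
      have "k \<le> N" using top_part_degree_le[OF a0 Suc.prems] by simp
      have "n \<le> k"
        using notlower lower_mono[OF top_part_lower_Suc[OF a0], of n] by force
      obtain \<alpha> where \<alpha>: "a0 = single (single x k) 1 * \<alpha>" "\<alpha> \<in> polys_in (UNIV - {x})"
        using homogeneous_in_variable[of x k a0 UNIV] a0 by (auto simp: top_part_def polys_in_def)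
      let ?t = "single (single x (k - n)) 1 * \<alpha>"
      have "single (single x k) (1 :: 'k) = single (single x (k - n)) 1 * single (single x n) 1"
        using \<open>n \<le> k\<close> by (simp add: mult_single flip: single_add)
      then have H: "\<beta> * a0 = ?t * (single (single x n) 1 * \<beta>)"
        unfolding \<alpha>(1) by (simp only: mult_ac)
      have eq: "\<beta> * a - ?t * b = \<beta> * (a - a0) - ?t * (b - single (single x n) 1 * \<beta>)"
        unfolding right_diff_distrib H by simp
      have "lower ?w (0 + k) (\<beta> * (a - a0))"
        using polys_in_homogeneous_0[OF \<beta>] a0
        by (intro homogeneous_lower_mult) (auto simp: top_part_def)
      moreover have "homogeneous ?w ((k - n) + 0) ?t"
        using polys_in_homogeneous_0[OF \<alpha>(2)] by (intro homogeneous_mult homogeneous_single) auto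
      then have "lower ?w ((k - n) + n) (?t * (b - single (single x n) 1 * \<beta>))"
        using b by (intro homogeneous_lower_mult) (auto simp: top_part_def)
      ultimately have "lower ?w k (\<beta> * a - ?t * b)"
        unfolding eq using \<open>n \<le> k\<close> by (intro lower_diff) auto
      then have "lower ?w N (\<beta> * a - ?t * b)" using \<open>k \<le> N\<close> by (rule lower_mono)
      then obtain s q where "lower ?w n (\<beta> ^ s * (\<beta> * a - ?t * b) - q * b)" using Suc.IH by blast
      moreover have "\<beta> ^ s * (\<beta> * a - ?t * b) - q * b = \<beta> ^ Suc s * a - (\<beta> ^ s * ?t + q) * b"
        by (simp add: algebra_simps)
      ultimately show ?thesis by metis
    qed
  qed
  moreover obtain N where "lower ?w N a"
    using top_part_exists[of a ?w] top_part_lower_Suc[of ?w _ _ a] lower_0[of ?w] by metis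
  ultimately show ?thesis by blast
qed

text \<open>
  If \<open>a / b\<close> is almost integral, with common denominator \<open>e\<close> for all its powers, then so is
  \<open>t * (a / b) - q\<close>. The extra factor \<open>a ^ i\<close> makes the induction on \<open>j\<close> work.
\<close>

lemma power_dvd_combination:
  fixes b :: "'a::comm_ring_1"
  assumes "\<And>j. b ^ j dvd e * a ^ j"
  shows "b ^ (i + j) dvd e * a ^ i * (t * a - q * b) ^ j"
proof (induction j arbitrary: i)
  case 0
  then show ?case using assms by simp
next
  case (Suc j)
  let ?r = "t * a - q * b"
  have "e * a ^ i * ?r ^ Suc j = t * (e * a ^ Suc i * ?r ^ j) - q * (b * (e * a ^ i * ?r ^ j))"
    by (simp add: algebra_simps)
  moreover have "b ^ (i + Suc j) dvd t * (e * a ^ Suc i * ?r ^ j)"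
    using Suc[of "Suc i"] by (simp add: dvd_mult)
  moreover have "b ^ (i + Suc j) dvd q * (b * (e * a ^ i * ?r ^ j))"
    using Suc[of i] by (simp add: dvd_mult mult_dvd_mono)
  ultimately show ?case by (simp add: dvd_diff)
qed

text \<open>
  Comparing weights in \<open>e * r ^ j = b ^ j * g\<close>: if \<open>r\<close> is nonzero and has smaller weight than \<open>b\<close>, the
  left side falls behind the right side as \<open>j\<close> grows. The weight of \<open>e\<close> is fixed, so \<open>j\<close> one larger
  than that weight is enough.
\<close>

lemma power_dvd_lower_imp_0:
  fixes b :: "('v::linorder, 'k::idom) mpoly"
  assumes "top_part w n b0 b" "e \<noteq> 0" "\<And>j. b ^ j dvd e * r ^ j" "lower w n r"
  shows "r = 0"
proof (rule ccontr)
  assume "r \<noteq> 0"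
  obtain k e0 where e0: "top_part w k e0 e" using top_part_exists[OF assms(2)] by blast
  obtain l r0 where r0: "top_part w l r0 r" using top_part_exists[OF \<open>r \<noteq> 0\<close>] by blast
  have "l < n" using top_part_degree_le[OF r0 assms(4)] .
  obtain g where g: "e * r ^ Suc k = b ^ Suc k * g" using assms(3)[of "Suc k"] by (auto elim: dvdE)
  then have "g \<noteq> 0" using assms(2) \<open>r \<noteq> 0\<close> by auto
  then obtain m g0 where g0: "top_part w m g0 g" using top_part_exists by blast
  have "top_part w (k + Suc k * l) (e0 * r0 ^ Suc k) (e * r ^ Suc k)"
    by (rule top_part_mult[OF e0 top_part_power[OF r0]])
  moreover have "top_part w (Suc k * n + m) (b0 ^ Suc k * g0) (e * r ^ Suc k)"
    unfolding g by (rule top_part_mult[OF top_part_power[OF assms(1)] g0])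
  ultimately have "k + Suc k * l = Suc k * n + m" by (rule top_part_degree_unique)
  moreover have "Suc k * Suc l \<le> Suc k * n" using \<open>l < n\<close> by (intro mult_le_mono) auto
  ultimately show False by simp
qed

text \<open>
  Induction on the variables of the denominator \<open>b\<close> alone. Dividing by \<open>b\<close> with respect to one of its
  variables leaves an almost integral fraction whose numerator has smaller degree than \<open>b\<close>; it must
  vanish. So \<open>a / b = q / \<beta> ^ s\<close>, where the new denominator involves one variable less.
\<close>

lemma completely_integrally_closed_aux:
  fixes b a e :: "('v::linorder, 'k::field) mpoly"
  assumes "finite U" "b \<in> polys_in U" "b \<noteq> 0" "e \<noteq> 0" "\<And>j. b ^ j dvd e * a ^ j"
  shows "b dvd a"
  using assms
proof (induction U arbitrary: a b e rule: finite_induct)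
  case empty
  have "keys b \<subseteq> {0}" "keys b \<noteq> {}"
    using empty.prems(1,2) by (auto simp: polys_in_def)
  then have "keys b = {0}" by blast
  then have b: "b = single 0 (lookup b 0)"
    using poly_mapping_eq_sum_single[of b] by simp
  then have "lookup b 0 \<noteq> 0" using empty.prems(2) by (metis single_zero)
  then have "b * single 0 (1 / lookup b 0) = 1"
    by (subst b) (simp add: mult_single flip: single_one)
  then have "a = b * (single 0 (1 / lookup b 0) * a)" by (simp flip: mult.assoc)
  then show ?case by (rule dvdI)
next
  case (insert x U)
  let ?w = "degree_weight x"
  obtain n b0 where b0: "top_part ?w n b0 b" using top_part_exists[OF insert.prems(2)] by blast
  have "homogeneous ?w n b0" using b0 by (simp add: top_part_def)
  moreover have "b0 \<in> polys_in (insert x U)"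
  proof -
    have "m \<in> keys b" if "m \<in> keys b0" for m
    proof (rule ccontr)
      assume "m \<notin> keys b"
      then have "m \<in> keys (b - b0)" using that by (simp add: in_keys_iff lookup_minus)
      then show False using b0 that unfolding top_part_def homogeneous_def lower_def by force
    qed
    then show ?thesis using insert.prems(1) unfolding polys_in_def by blast
  qed
  ultimately obtain \<beta> where \<beta>: "b0 = single (single x n) 1 * \<beta>" "\<beta> \<in> polys_in (U - {x})"
    by (rule homogeneous_in_variable)
  have "\<beta> \<noteq> 0" using b0 \<beta>(1) by (auto simp: top_part_def)
  obtain s q where low: "lower ?w n (\<beta> ^ s * a - q * b)"
    using pseudo_division[OF b0[unfolded \<beta>(1)] \<beta>(2)] by blast
  have "b ^ j dvd e * (\<beta> ^ s * a - q * b) ^ j" for j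
    using power_dvd_combination[OF insert.prems(4), of 0 j] by simp
  then have "\<beta> ^ s * a - q * b = 0"
    by (rule power_dvd_lower_imp_0[OF b0 insert.prems(3) _ low])
  then have eq: "\<beta> ^ s * a = q * b" by simp
  have "\<beta> ^ s dvd q"
  proof (rule insert.IH)
    show "\<beta> ^ s \<in> polys_in U" using polys_in_power[OF \<beta>(2), of s] by (auto simp: polys_in_def)
    show "\<beta> ^ s \<noteq> 0" "e \<noteq> 0" using \<open>\<beta> \<noteq> 0\<close> insert.prems(3) by auto
    fix j
    obtain g where g: "e * a ^ j = b ^ j * g" using insert.prems(4)[of j] by (auto elim: dvdE)
    have "b ^ j * ((\<beta> ^ s) ^ j * g) = e * (\<beta> ^ s * a) ^ j"
      by (simp add: power_mult_distrib g flip: mult.assoc)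
    also have "\<dots> = b ^ j * (e * q ^ j)" unfolding eq by (simp add: power_mult_distrib mult_ac)
    finally have "(\<beta> ^ s) ^ j * g = e * q ^ j" using insert.prems(2) by simp
    then show "(\<beta> ^ s) ^ j dvd e * q ^ j" by (metis dvd_triv_left)
  qed
  then obtain q' where "q = \<beta> ^ s * q'" by (auto elim: dvdE)
  then have "\<beta> ^ s * a = \<beta> ^ s * (b * q')" using eq by (simp add: mult_ac)
  then show ?case using \<open>\<beta> \<noteq> 0\<close> by simp
qed

text \<open>
  This is complete integral closedness: a fraction \<open>a / b\<close> whose powers have a common denominator
  \<open>e\<close> is a polynomial. No coefficients of an integral equation occur in it, which makes it easier
  to prove by induction than integral closedness.
\<close>

theorem polynomials_completely_integrally_closed:
  fixes b a e :: "('v::linorder, 'k::field) mpoly"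
  assumes "b \<noteq> 0" "e \<noteq> 0" "\<And>j. b ^ j dvd e * a ^ j"
  shows "b dvd a"
proof (rule completely_integrally_closed_aux[OF _ _ assms])
  show "finite (\<Union>m\<in>keys b. keys m)" by simp
  show "b \<in> polys_in (\<Union>m\<in>keys b. keys m)" by (auto simp: polys_in_def)
qed

section \<open>Evaluation in the fraction field\<close>

definition embed :: "'a::idom \<Rightarrow> 'a fract" where
  "embed p = Fract p 1"

lemma embed_mult: "embed (p * q) = embed p * embed q"
  and embed_add: "embed (p + q) = embed p + embed q"
  and embed_uminus: "embed (- p) = - embed p"
  and embed_0: "embed 0 = 0"
  and embed_1: "embed 1 = 1"
  by (simp_all add: embed_def Zero_fract_def One_fract_def)

lemma embed_eq_iff: "embed p = embed q \<longleftrightarrow> p = q"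
  by (simp add: embed_def eq_fract)

lemma embed_eq_0_iff: "embed p = 0 \<longleftrightarrow> p = 0"
  by (simp add: embed_def Zero_fract_def eq_fract)

lemma embed_sum: "embed (sum f A) = (\<Sum>i\<in>A. embed (f i))"
  by (induction A rule: infinite_finite_induct) (simp_all add: embed_0 embed_add)

lemma embed_prod: "embed (prod f A) = (\<Prod>i\<in>A. embed (f i))"
  by (induction A rule: infinite_finite_induct) (simp_all add: embed_1 embed_mult)

lemma embed_power: "embed (p ^ k) = embed p ^ k"
  by (induction k) (simp_all add: embed_1 embed_mult)

context
  fixes \<sigma> :: "'v::linorder \<Rightarrow> ('v, 'k::field) mpoly fract"
begin

definition evaluate_monomial :: "('v \<Rightarrow>\<^sub>0 nat) \<Rightarrow> ('v, 'k) mpoly fract" where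
  "evaluate_monomial m = (\<Prod>v\<in>keys m. \<sigma> v ^ lookup m v)"

text \<open>
  The substitution homomorphism from polynomials to their own fraction field which fixes the
  coefficients and sends \<open>v\<close> to \<open>\<sigma> v\<close>.
\<close>

definition evaluate :: "('v, 'k) mpoly \<Rightarrow> ('v, 'k) mpoly fract" where
  "evaluate p = (\<Sum>m\<in>keys p. embed (single 0 (lookup p m)) * evaluate_monomial m)"

lemma evaluate_monomial_eq_prod:
  "finite A \<Longrightarrow> keys m \<subseteq> A \<Longrightarrow> evaluate_monomial m = (\<Prod>v\<in>A. \<sigma> v ^ lookup m v)"
  unfolding evaluate_monomial_def by (rule prod.mono_neutral_left) (auto simp: in_keys_iff)

lemma evaluate_monomial_add: "evaluate_monomial (m + m') = evaluate_monomial m * evaluate_monomial m'"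
proof -
  let ?A = "keys m \<union> keys m'"
  have "evaluate_monomial (m + m') = (\<Prod>v\<in>?A. \<sigma> v ^ lookup (m + m') v)"
    by (rule evaluate_monomial_eq_prod) (simp_all add: keys_add_nat)
  moreover have "evaluate_monomial m = (\<Prod>v\<in>?A. \<sigma> v ^ lookup m v)"
    by (rule evaluate_monomial_eq_prod) simp_all
  moreover have "evaluate_monomial m' = (\<Prod>v\<in>?A. \<sigma> v ^ lookup m' v)"
    by (rule evaluate_monomial_eq_prod) simp_all
  ultimately show ?thesis by (simp add: lookup_add power_add prod.distrib)
qed

lemma evaluate_eq_sum:
  "finite A \<Longrightarrow> keys p \<subseteq> A \<Longrightarrow>
   evaluate p = (\<Sum>m\<in>A. embed (single 0 (lookup p m)) * evaluate_monomial m)"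
  unfolding evaluate_def
  by (rule sum.mono_neutral_left) (auto simp: in_keys_iff embed_0 single_zero)

lemma evaluate_0 [simp]: "evaluate 0 = 0"
  by (simp add: evaluate_def)

lemma evaluate_add: "evaluate (p + q) = evaluate p + evaluate q"
proof -
  let ?A = "keys p \<union> keys q"
  have "evaluate (p + q) = (\<Sum>m\<in>?A. embed (single 0 (lookup (p + q) m)) * evaluate_monomial m)"
    by (rule evaluate_eq_sum) (simp_all add: keys_add)
  moreover have "evaluate p = (\<Sum>m\<in>?A. embed (single 0 (lookup p m)) * evaluate_monomial m)"
    by (rule evaluate_eq_sum) simp_all
  moreover have "evaluate q = (\<Sum>m\<in>?A. embed (single 0 (lookup q m)) * evaluate_monomial m)"
    by (rule evaluate_eq_sum) simp_all
  ultimately show ?thesis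
    by (simp add: lookup_add single_add embed_add sum.distrib distrib_right)
qed

lemma evaluate_single: "evaluate (single m c) = embed (single 0 c) * evaluate_monomial m"
  by (subst evaluate_eq_sum[of "{m}"]) simp_all

lemma evaluate_mult: "evaluate (p * q) = evaluate p * evaluate q"
proof (induction p rule: poly_mapping_single_induct)
  case (single m c)
  show ?case
  proof (induction q rule: poly_mapping_single_induct)
    case (single m' c')
    have "embed (single 0 (c * c')) = embed (single (0 :: 'v \<Rightarrow>\<^sub>0 nat) c) * embed (single 0 c')"
      by (simp add: mult_single flip: embed_mult)
    then show ?case
      by (simp add: mult_single evaluate_single evaluate_monomial_add mult_ac)
  qed (simp_all add: distrib_left evaluate_add)
qed (simp_all add: distrib_right evaluate_add)

lemma evaluate_1 [simp]: "evaluate 1 = 1"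
  using evaluate_single[of 0 1] by (simp add: evaluate_monomial_def embed_1)

lemma evaluate_uminus: "evaluate (- p) = - evaluate p"
  using evaluate_add[of p "- p"] by (simp add: eq_neg_iff_add_eq_0 add.commute)

lemma evaluate_diff: "evaluate (p - q) = evaluate p - evaluate q"
  using evaluate_add[of p "- q"] by (simp add: evaluate_uminus)

lemma evaluate_sum: "evaluate (sum f A) = (\<Sum>i\<in>A. evaluate (f i))"
  by (induction A rule: infinite_finite_induct) (simp_all add: evaluate_add)

lemma evaluate_power: "evaluate (p ^ k) = evaluate p ^ k"
  by (induction k) (simp_all add: evaluate_mult)

lemma evaluate_variable: "evaluate (variable v) = \<sigma> v"
  unfolding variable_def evaluate_single by (simp add: evaluate_monomial_def embed_1)

lemma monomial_eq_prod_variables: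
  "single (m :: 'v \<Rightarrow>\<^sub>0 nat) (1 :: 'k) = (\<Prod>v\<in>keys m. variable v ^ lookup m v)"
proof -
  have "variable v ^ k = single (single v k) (1 :: 'k)" for v :: 'v and k
    by (induction k) (simp_all add: variable_def mult_single flip: single_add)
  moreover have "(\<Prod>v\<in>A. single (g v) (1 :: 'k)) = single (\<Sum>v\<in>A. g v) 1"
    for g :: "'v \<Rightarrow> 'v \<Rightarrow>\<^sub>0 nat" and A
    by (induction A rule: infinite_finite_induct) (simp_all add: mult_single)
  ultimately have "(\<Prod>v\<in>keys m. variable v ^ lookup m v) =
      single (\<Sum>v\<in>keys m. single v (lookup m v)) (1 :: 'k)" by simp
  then show ?thesis by (simp flip: poly_mapping_eq_sum_single)
qed

lemma evaluate_eq_embed: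
  assumes "p \<in> polys_in U" "\<And>v. v \<in> U \<Longrightarrow> \<sigma> v = embed (variable v)"
  shows "evaluate p = embed p"
proof -
  have "embed (single 0 (lookup p m)) * evaluate_monomial m = embed (single m (lookup p m))"
    if m: "m \<in> keys p" for m
  proof -
    have "keys m \<subseteq> U" using assms(1) m by (auto simp: polys_in_def)
    then have "evaluate_monomial m = (\<Prod>v\<in>keys m. embed (variable v ^ lookup m v))"
      unfolding evaluate_monomial_def embed_power using assms(2) by (intro prod.cong) auto
    then have "evaluate_monomial m = embed (single m 1)"
      by (simp add: monomial_eq_prod_variables embed_prod)
    then show ?thesis by (simp add: mult_single flip: embed_mult)
  qed
  then have "evaluate p = embed (\<Sum>m\<in>keys p. single m (lookup p m))"
    unfolding evaluate_def embed_sum by (intro sum.cong) auto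
  then show ?thesis using poly_mapping_eq_sum_single[of p] by simp
qed

end

lemma mpoly_induct [case_names const variable add mult]:
  fixes p :: "('v, 'k::field) mpoly"
  assumes const: "\<And>c. P (single 0 c)" and variable: "\<And>v. P (variable v)"
    and add: "\<And>p q. P p \<Longrightarrow> P q \<Longrightarrow> P (p + q)" and mult: "\<And>p q. P p \<Longrightarrow> P q \<Longrightarrow> P (p * q)"
  shows "P p"
proof (induction p rule: poly_mapping_single_induct)
  case zero
  show ?case using const[of 0] by simp
next
  case (single m c)
  have "P (single m 1)"
  proof (induction m rule: poly_mapping_single_induct)
    case (single v k)
    show ?case
    proof (induction k)
      case 0
      show ?case using const[of 1] by simp
    next
      case (Suc k)
      have "single (single v (Suc k)) (1 :: 'k) = variable v * single (single v k) 1"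
        by (simp add: variable_def mult_single flip: single_add)
      then show ?case using mult[OF variable Suc] by simp
    qed
  next
    case (add m m')
    then show ?case using mult[of "single m 1" "single m' 1"] by (simp add: mult_single)
  next
    case zero
    show ?case using const[of 1] by simp
  qed
  then show ?case using mult[OF const[of c], of "single m 1"] by (simp add: mult_single)
qed (rule add)

section \<open>The ideal of a forest\<close>

definition lss_edge :: "nat \<Rightarrow> nat \<times> nat \<Rightarrow> (nat \<times> nat, 'k::field) mpoly" where
  "lss_edge d e = lss_gen d (fst e) (snd e)"

lemma variable_mult:
  assumes "a \<noteq> b"
  shows "variable a * variable b = single (squarefree_monomial {a, b}) (1 :: 'k::field)"
  using assms by (simp add: variable_def mult_single squarefree_monomial_def)

lemma weight_squarefree_pair:
  "a \<noteq> b \<Longrightarrow> weight w (squarefree_monomial {a, b}) = w a + w b"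
  by (simp add: squarefree_monomial_def weight_add)

text \<open>
  The hypothesis on the weights is the one supplied by \<open>leading_colors\<close>, with \<open>k0\<close> the colour
  of the edge.
\<close>

lemma top_part_lss_gen:
  assumes "v \<noteq> l" "k0 \<in> {1..d}"
    and "\<And>k. k \<in> {1..d} \<Longrightarrow> k \<noteq> k0 \<Longrightarrow> w (v, k) + w (l, k) < w (v, k0) + w (l, k0)"
  shows "top_part w (weight w (squarefree_monomial {(v, k0), (l, k0)}))
    (single (squarefree_monomial {(v, k0), (l, k0)}) 1) (lss_gen d v l :: (nat \<times> nat, 'k::field) mpoly)"
proof -
  let ?m = "\<lambda>k. squarefree_monomial {(v, k), (l, k)}"
  have "lss_gen d v l = (\<Sum>k\<in>{1..d}. single (?m k) (1 :: 'k))"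
    unfolding lss_gen_def using assms(1) by (intro sum.cong refl variable_mult) simp
  then have "lss_gen d v l - single (?m k0) (1 :: 'k) = (\<Sum>k\<in>{1..d} - {k0}. single (?m k) 1)"
    using assms(2) by (simp add: sum_diff1)
  moreover have "lower w (weight w (?m k0)) (single (?m k) (1 :: 'k))" if "k \<in> {1..d} - {k0}" for k
    using assms(1,3) that by (simp add: lower_def weight_squarefree_pair)
  ultimately have "lower w (weight w (?m k0)) (lss_gen d v l - single (?m k0) (1 :: 'k))"
    by (simp only: lower_sum)
  then show ?thesis
    by (simp add: top_part_def homogeneous_single flip: keys_eq_empty)
qed

lemma lss_gen_Suc:
  "lss_gen (Suc D) v l = lss_gen D v l + variable (v, Suc D) * variable (l, Suc D)"
  by (simp add: lss_gen_def)

text \<open>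
  The weight that is one on the first coordinates singles out the term \<open>y(v,1) y(l,1)\<close>.
\<close>

lemma lss_gen_nonzero:
  assumes "v \<noteq> l" "d \<ge> 1"
  shows "lss_gen d v l \<noteq> (0 :: (nat \<times> nat, 'k::field) mpoly)"
proof -
  let ?w = "\<lambda>(u :: nat, k :: nat). if k = 1 then 1 else 0 :: nat"
  have "top_part ?w (weight ?w (squarefree_monomial {(v, 1), (l, 1)}))
    (single (squarefree_monomial {(v, 1), (l, 1)}) 1) (lss_gen d v l :: (nat \<times> nat, 'k) mpoly)"
    using assms by (intro top_part_lss_gen) auto
  then show ?thesis by (rule top_part_nonzero)
qed

text \<open>
  The list \<open>es\<close> orders the edges of a forest, and \<open>D\<close> bounds its degrees. The ring is formed with
  \<open>Suc D\<close> coordinates, so that the coordinates \<open>1, \<dots>, D\<close> suffice as colours and the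
  coordinate \<open>Suc D\<close> is left over.
\<close>

locale lss_forest =
  fixes es :: "(nat \<times> nat) list" and D :: nat
  assumes leaf_order: "leaf_order es"
    and degree: "\<And>v. card (edges_at (set es) v) \<le> D"
begin

definition J :: "(nat \<times> nat, 'k::field) mpoly set" where
  "J = ideal_span (lss_edge (Suc D) ` set es)"

definition last_var :: "nat \<Rightarrow> (nat \<times> nat, 'k::field) mpoly" where
  "last_var u = variable (u, Suc D)"

lemma D_ge_1: "es \<noteq> [] \<Longrightarrow> D \<ge> 1"
proof -
  assume "es \<noteq> []"
  then obtain e where "e \<in> set es" by (cases es) auto
  then have "e \<in> edges_at (set es) (fst e)" by (simp add: edges_at_def undirected_def)
  moreover have "finite (edges_at (set es) (fst e))" by (simp add: edges_at_def)
  ultimately have "card (edges_at (set es) (fst e)) \<noteq> 0" by auto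
  then show "D \<ge> 1" using degree[of "fst e"] by simp
qed

text \<open>
  The generators of \<open>J\<close> together with one last coordinate, indexed so that both the nonzerodivisor
  and the radicality statement apply to the same family.
\<close>

definition edge_or_var :: "nat \<Rightarrow> (nat \<times> nat) option \<Rightarrow> (nat \<times> nat, 'k::field) mpoly" where
  "edge_or_var u i = (case i of None \<Rightarrow> last_var u | Some e \<Rightarrow> lss_edge (Suc D) e)"

lemma edge_or_var_image:
  "edge_or_var u ` Some ` set es = lss_edge (Suc D) ` set es"
  "edge_or_var u ` insert None (Some ` set es) = insert (last_var u) (lss_edge (Suc D) ` set es)"
  by (auto simp: edge_or_var_def image_image)

lemma leads_exists:
  obtains w S where
    "leads w (edge_or_var u :: _ \<Rightarrow> (nat \<times> nat, 'k::field) mpoly) S (insert None (Some ` set es))"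
proof -
  obtain c w where cw: "leading_colors D (Suc D) (set es) c w"
    using leaf_order_leading_colors[OF leaf_order degree] by blast
  have c: "\<And>e. e \<in> set es \<Longrightarrow> c e \<in> {1..D}"
    and cc: "\<And>e e'. e \<in> set es \<Longrightarrow> e' \<in> set es \<Longrightarrow> e \<noteq> e' \<Longrightarrow> c e = c e' \<Longrightarrow>
           undirected e \<inter> undirected e' = {}"
    and w: "\<And>v l k. (v, l) \<in> set es \<Longrightarrow> k \<in> {1..Suc D} \<Longrightarrow> k \<noteq> c (v, l) \<Longrightarrow>
           w (v, k) + w (l, k) < w (v, c (v, l)) + w (l, c (v, l))"
    using cw unfolding leading_colors_def by simp_all
  define S where "S = (\<lambda>i. case i of None \<Rightarrow> {(u, Suc D)} | Some e \<Rightarrow> {(fst e, c e), (snd e, c e)})"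
  have top: "top_part w (weight w (squarefree_monomial (S i))) (single (squarefree_monomial (S i)) 1)
      (edge_or_var u i :: (nat \<times> nat, 'k) mpoly)"
    if "i \<in> insert None (Some ` set es)" for i
  proof (cases i)
    case None
    then show ?thesis
      by (simp add: S_def edge_or_var_def last_var_def variable_def squarefree_monomial_def
          top_part_def homogeneous_single flip: keys_eq_empty)
  next
    case (Some e)
    obtain v l where e: "e = (v, l)" by (cases e)
    have vl: "(v, l) \<in> set es" using that Some e by auto
    have "c (v, l) \<in> {1..Suc D}" using c[OF vl] by simp
    then have "top_part w (weight w (squarefree_monomial {(v, c (v, l)), (l, c (v, l))}))
      (single (squarefree_monomial {(v, c (v, l)), (l, c (v, l))}) 1)
      (lss_gen (Suc D) v l :: (nat \<times> nat, 'k) mpoly)"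
      using w[OF vl] leaf_order_neq[OF leaf_order vl] by (intro top_part_lss_gen)
    then show ?thesis by (simp add: S_def edge_or_var_def Some e lss_edge_def)
  qed
  have "disjoint_family_on S (insert None (Some ` set es))"
  proof -
    have "S (Some e) \<inter> S (Some e') = {}" if "e \<in> set es" "e' \<in> set es" "e \<noteq> e'" for e e'
      using cc[OF that] by (auto simp: undirected_def S_def)
    moreover have "S None \<inter> S (Some e) = {}" if "e \<in> set es" for e
      using c[OF that] by (auto simp: S_def)
    ultimately show ?thesis unfolding disjoint_family_on_def by blast
  qed
  moreover have "finite (S i)" for i by (simp add: S_def split: option.split)
  ultimately have "leads w (edge_or_var u :: _ \<Rightarrow> (nat \<times> nat, 'k) mpoly) S (insert None (Some ` set es))"
    unfolding leads_def using top by simp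
  then show ?thesis by (rule that)
qed

lemma last_var_cancel:
  fixes p :: "(nat \<times> nat, 'k::field) mpoly"
  assumes "last_var u * p \<in> J" shows "p \<in> J"
proof -
  obtain w S where "leads w (edge_or_var u :: _ \<Rightarrow> (nat \<times> nat, 'k) mpoly) S (insert None (Some ` set es))"
    by (rule leads_exists)
  from ideal_span_nonzerodivisor[OF this, of p] show ?thesis
    using assms unfolding J_def edge_or_var_image by (simp add: edge_or_var_def image_iff)
qed

text \<open>
  This is the radicality of \<open>J + (y)\<close> for a last coordinate \<open>y\<close>, with membership in \<open>J + (y)\<close>
  written out.
\<close>

lemma last_var_radical:
  fixes p :: "(nat \<times> nat, 'k::field) mpoly"
  assumes "p ^ k - last_var u * h \<in> J"
  obtains g where "p - last_var u * g \<in> J"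
proof -
  obtain w S where "leads w (edge_or_var u :: _ \<Rightarrow> (nat \<times> nat, 'k) mpoly) S (insert None (Some ` set es))"
    by (rule leads_exists)
  from ideal_span_radical[OF this, of p k]
  have "\<exists>h. p ^ k - h * last_var u \<in> J \<Longrightarrow> \<exists>g. p - g * last_var u \<in> J"
    unfolding edge_or_var_image gen.span_breakdown_eq J_def .
  moreover have "p ^ k - h * last_var u \<in> J" using assms by (simp add: mult.commute)
  ultimately obtain g where "p - g * last_var u \<in> J" by blast
  then show ?thesis using that[of g] by (simp add: mult.commute)
qed

end

section \<open>Integral elements\<close>

text \<open>
  The monic equation is solved for its leading term; the signs are absorbed into \<open>c\<close>.
\<close>

definition integral_elem :: "'a::comm_ring_1 set \<Rightarrow> 'a \<Rightarrow> bool" where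
  "integral_elem A z \<longleftrightarrow> (\<exists>m c. (\<forall>i<m. c i \<in> A) \<and> z ^ m = (\<Sum>i<m. c i * z ^ i))"

lemma integral_elem_mono: "integral_elem A z \<Longrightarrow> A \<subseteq> B \<Longrightarrow> integral_elem B z"
  unfolding integral_elem_def by blast

text \<open>
  The equation of degree \<open>m\<close> is multiplied by \<open>s ^ m\<close>, and \<open>s ^ i\<close> is absorbed into the power of \<open>z\<close>.
\<close>

lemma integral_elem_scale:
  assumes "integral_elem A z" "s \<in> A" "1 \<in> A" "\<And>x y. x \<in> A \<Longrightarrow> y \<in> A \<Longrightarrow> x * y \<in> A"
  shows "integral_elem A (s * z)"
proof -
  have pow: "s ^ i \<in> A" for i by (induction i) (use assms in auto)
  obtain m c where c: "\<forall>i<m. c i \<in> A" "z ^ m = (\<Sum>i<m. c i * z ^ i)"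
    using assms(1) unfolding integral_elem_def by blast
  have "(s * z) ^ m = (\<Sum>i<m. s ^ m * (c i * z ^ i))"
    by (simp add: power_mult_distrib c(2) sum_distrib_left)
  also have "\<dots> = (\<Sum>i<m. c i * s ^ (m - i) * (s * z) ^ i)"
  proof (rule sum.cong)
    fix i assume "i \<in> {..<m}"
    then have "s ^ m = s ^ (m - i) * s ^ i" by (simp flip: power_add)
    then show "s ^ m * (c i * z ^ i) = c i * s ^ (m - i) * (s * z) ^ i"
      by (simp add: power_mult_distrib mult_ac)
  qed simp
  finally have eq: "(s * z) ^ m = (\<Sum>i<m. c i * s ^ (m - i) * (s * z) ^ i)" .
  show ?thesis unfolding integral_elem_def
    by (rule exI[of _ m], rule exI[of _ "\<lambda>i. c i * s ^ (m - i)"]) (use eq c(1) pow assms(4) in auto)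
qed

text \<open>
  Multiplying the equation by the \<open>m\<close>-th power of a common denominator \<open>t\<close> of the coefficients gives an
  equation for \<open>t * z\<close>: only one factor \<open>t\<close> is needed to clear each coefficient.
\<close>

lemma integral_elem_clear_denominators:
  fixes z :: "'a::field"
  assumes "integral_elem {a / s | a s. a \<in> A \<and> s \<in> M} z"
    and "M \<subseteq> A" "1 \<in> M" "0 \<notin> M"
    and A: "\<And>x y. x \<in> A \<Longrightarrow> y \<in> A \<Longrightarrow> x * y \<in> A" and M: "\<And>x y. x \<in> M \<Longrightarrow> y \<in> M \<Longrightarrow> x * y \<in> M"
  obtains s where "s \<in> M" "integral_elem A (s * z)"
proof -
  obtain m c where c: "\<forall>i<m. c i \<in> {a / s | a s. a \<in> A \<and> s \<in> M}" "z ^ m = (\<Sum>i<m. c i * z ^ i)"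
    using assms(1) unfolding integral_elem_def by blast
  from c(1) have "\<forall>i. \<exists>a s. i < m \<longrightarrow> c i = a / s \<and> a \<in> A \<and> s \<in> M" by blast
  then obtain a s where as: "\<And>i. i < m \<Longrightarrow> c i = a i / s i" "\<And>i. i < m \<Longrightarrow> a i \<in> A" "\<And>i. i < m \<Longrightarrow> s i \<in> M"
    by metis
  define t where "t = (\<Prod>i<m. s i)"
  have prodM: "finite I \<Longrightarrow> I \<subseteq> {..<m} \<Longrightarrow> (\<Prod>i\<in>I. s i) \<in> M" for I
    by (induction I rule: finite_induct) (use as(3) M assms(3) in auto)
  have t: "t \<in> M" unfolding t_def by (rule prodM) auto
  have pow: "t ^ i \<in> A" for i by (induction i) (use t assms(2,3) A in auto)
  have ct: "t * c i \<in> A" if "i < m" for i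
  proof -
    have "t = s i * (\<Prod>j\<in>{..<m} - {i}. s j)" unfolding t_def using that by (subst prod.remove[of _ i]) auto
    moreover have "s i \<noteq> 0" using as(3)[OF that] assms(4) by auto
    ultimately have "t * c i = a i * (\<Prod>j\<in>{..<m} - {i}. s j)" using as(1)[OF that] by simp
    moreover have "(\<Prod>j\<in>{..<m} - {i}. s j) \<in> A" using prodM[of "{..<m} - {i}"] assms(2) by auto
    ultimately show ?thesis using as(2)[OF that] A by simp
  qed
  have "(t * z) ^ m = (\<Sum>i<m. t ^ m * (c i * z ^ i))"
    by (simp add: power_mult_distrib c(2) sum_distrib_left)
  also have "\<dots> = (\<Sum>i<m. t * c i * t ^ (m - i - 1) * (t * z) ^ i)"
  proof (rule sum.cong)
    fix i assume "i \<in> {..<m}"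
    then have "t ^ m = t * t ^ (m - i - 1) * t ^ i" by (simp flip: power_add power_Suc)
    then show "t ^ m * (c i * z ^ i) = t * c i * t ^ (m - i - 1) * (t * z) ^ i"
      by (simp add: power_mult_distrib mult_ac)
  qed simp
  finally have eq: "(t * z) ^ m = (\<Sum>i<m. t * c i * t ^ (m - i - 1) * (t * z) ^ i)" .
  have "integral_elem A (t * z)" unfolding integral_elem_def
    by (rule exI[of _ m], rule exI[of _ "\<lambda>i. t * c i * t ^ (m - i - 1)"]) (use eq ct pow A in auto)
  then show ?thesis using that t by blast
qed

text \<open>
  By the integral equation of degree \<open>m\<close>, the polynomial \<open>b ^ m\<close> is a denominator for all powers of
  \<open>a / b\<close>, so complete integral closedness applies.
\<close>

theorem polynomials_integrally_closed:
  fixes a b :: "('v::linorder, 'k::field) mpoly"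
  assumes "b \<noteq> 0" "integral_elem (range embed) (embed a / embed b)"
  shows "b dvd a"
proof -
  let ?z = "embed a / embed b"
  have nz: "embed b \<noteq> 0" using assms(1) by (simp add: embed_eq_0_iff)
  obtain m c where c: "\<forall>i<m. c i \<in> range embed" "?z ^ m = (\<Sum>i<m. c i * ?z ^ i)"
    using assms(2) unfolding integral_elem_def by blast
  have mult: "x * y \<in> range embed" if "x \<in> range embed" "y \<in> range embed" for x y :: "('v, 'k) mpoly fract"
    using that by (auto simp flip: embed_mult)
  have add: "(\<Sum>i\<in>I. f i) \<in> range embed" if f: "\<And>i. i \<in> I \<Longrightarrow> f i \<in> range embed"
    for I :: "nat set" and f :: "nat \<Rightarrow> ('v, 'k) mpoly fract"
  proof -
    have "\<forall>i\<in>I. \<exists>p. f i = embed p" using f by blast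
    then obtain p where "\<forall>i\<in>I. f i = embed (p i)" by metis
    then have "(\<Sum>i\<in>I. f i) = embed (\<Sum>i\<in>I. p i)" by (simp add: embed_sum)
    then show ?thesis by simp
  qed
  have main: "embed b ^ m * ?z ^ j \<in> range embed" for j
  proof (induction j rule: less_induct)
    case (less j)
    show ?case
    proof (cases "j < m")
      case True
      then have "embed b ^ m = embed b ^ (m - j) * embed b ^ j" by (simp flip: power_add)
      then have "embed b ^ m * ?z ^ j = embed (b ^ (m - j) * a ^ j)"
        using nz by (simp add: power_divide embed_mult embed_power)
      then show ?thesis by (metis rangeI)
    next
      case False
      then have "?z ^ j = ?z ^ (j - m) * ?z ^ m" by (simp flip: power_add)
      also have "\<dots> = (\<Sum>i<m. c i * ?z ^ (j - m + i))"
        unfolding c(2) sum_distrib_left power_add by (intro sum.cong) (simp_all only: mult_ac)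
      finally have "embed b ^ m * ?z ^ j = (\<Sum>i<m. c i * (embed b ^ m * ?z ^ (j - m + i)))"
        by (simp only: sum_distrib_left mult_ac)
      moreover have "c i * (embed b ^ m * ?z ^ (j - m + i)) \<in> range embed" if "i < m" for i
        using c(1) that False by (intro mult less) auto
      ultimately show ?thesis using add[of "{..<m}"] by simp
    qed
  qed
  have "b ^ j dvd b ^ m * a ^ j" for j
  proof -
    obtain g where "embed b ^ m * ?z ^ j = embed g" using main[of j] by blast
    then have "embed b ^ m * embed a ^ j = embed g * embed b ^ j"
      using nz by (simp add: power_divide field_simps)
    then have "b ^ m * a ^ j = g * b ^ j"
      by (simp flip: embed_power embed_mult add: embed_eq_iff)
    then show ?thesis by simp
  qed
  then show ?thesis using polynomials_completely_integrally_closed assms(1) by (metis power_not_zero)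
qed

section \<open>Solving the edge equations for the last coordinates\<close>

text \<open>
  A point with coordinates in the fraction field that satisfies the equations of all edges in \<open>A\<close>. It keeps
  all variables except the last coordinates of the children. The nonvanishing of the last coordinates
  allows the extension to further leaves by division.
\<close>

definition last_coordinate_solution ::
  "nat \<Rightarrow> (nat \<times> nat) set \<Rightarrow> (nat \<times> nat \<Rightarrow> (nat \<times> nat, 'k::field) mpoly fract) \<Rightarrow> bool" where
  "last_coordinate_solution D A \<sigma> \<longleftrightarrow>
    (\<forall>v l. (v, l) \<in> A \<longrightarrow> \<sigma> (v, Suc D) * \<sigma> (l, Suc D) = - embed (lss_gen D v l)) \<and>
    (\<forall>u k. (k = Suc D \<longrightarrow> u \<notin> snd ` A) \<longrightarrow> \<sigma> (u, k) = embed (variable (u, k))) \<and>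
    (\<forall>u. \<sigma> (u, Suc D) \<noteq> 0)"

lemma last_coordinate_solution_exists:
  assumes "leaf_order es" "es \<noteq> [] \<Longrightarrow> D \<ge> 1"
  shows "\<exists>\<sigma> :: nat \<times> nat \<Rightarrow> (nat \<times> nat, 'k::field) mpoly fract. last_coordinate_solution D (set es) \<sigma>"
  using assms
proof (induction es rule: leaf_order.induct)
  case 1
  have "variable x \<noteq> (0 :: (nat \<times> nat, 'k) mpoly)" for x
    by (simp add: variable_def flip: keys_eq_empty)
  then have "last_coordinate_solution D {} (\<lambda>x. embed (variable x :: (nat \<times> nat, 'k) mpoly))"
    by (simp add: last_coordinate_solution_def embed_eq_0_iff)
  then show ?case by auto
next
  case (2 v l es)
  have new: "v \<noteq> l" "l \<notin> endpoints (set es)" "leaf_order es" and D: "D \<ge> 1" using 2(2,3) by auto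
  obtain \<sigma> :: "nat \<times> nat \<Rightarrow> (nat \<times> nat, 'k) mpoly fract" where \<sigma>: "last_coordinate_solution D (set es) \<sigma>"
    using 2(1)[OF new(3) D] by blast
  define t where "t = - embed (lss_gen D v l) / \<sigma> (v, Suc D)"
  have nz: "\<sigma> (u, Suc D) \<noteq> 0" for u using \<sigma> by (simp add: last_coordinate_solution_def)
  have "embed (lss_gen D v l :: (nat \<times> nat, 'k) mpoly) \<noteq> 0"
    unfolding embed_eq_0_iff by (rule lss_gen_nonzero[OF new(1) D])
  then have t: "t \<noteq> 0" "\<sigma> (v, Suc D) * t = - embed (lss_gen D v l)"
    using nz[of v] by (simp_all add: t_def)
  have old: "a \<noteq> l \<and> b \<noteq> l" if "(a, b) \<in> set es" for a b
    using undirected_subset_endpoints[OF that] new(2) by auto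
  let ?\<tau> = "\<sigma>((l, Suc D) := t)"
  have "?\<tau> (a, Suc D) * ?\<tau> (b, Suc D) = - embed (lss_gen D a b)" if "(a, b) \<in> set ((v, l) # es)" for a b
  proof (cases "(a, b) \<in> set es")
    case True
    then show ?thesis using \<sigma> old[OF True] by (simp add: last_coordinate_solution_def)
  next
    case False
    then have "a = v" "b = l" using that by auto
    then show ?thesis using t(2) new(1) by simp
  qed
  moreover have "?\<tau> (u, k) = embed (variable (u, k))" if "k = Suc D \<longrightarrow> u \<notin> snd ` set ((v, l) # es)" for u k
    using \<sigma> that by (auto simp: last_coordinate_solution_def)
  moreover have "?\<tau> (u, Suc D) \<noteq> 0" for u using nz t(1) by simp
  ultimately have "last_coordinate_solution D (set ((v, l) # es)) ?\<tau>"
    unfolding last_coordinate_solution_def by blast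
  then show ?case by blast
qed

context lss_forest
begin

definition free_vars :: "(nat \<times> nat) set" where
  "free_vars = {(u, k). k = Suc D \<longrightarrow> u \<notin> snd ` set es}"

definition sigma :: "nat \<times> nat \<Rightarrow> (nat \<times> nat, 'k::field) mpoly fract" where
  "sigma = (SOME \<sigma>. last_coordinate_solution D (set es) \<sigma>)"

abbreviation psi :: "(nat \<times> nat, 'k::field) mpoly \<Rightarrow> (nat \<times> nat, 'k) mpoly fract" where
  "psi \<equiv> evaluate sigma"

lemma sigma_solution: "last_coordinate_solution D (set es) sigma"
  unfolding sigma_def by (rule someI_ex[OF last_coordinate_solution_exists[OF leaf_order D_ge_1]])

lemma sigma_edge: "(v, l) \<in> set es \<Longrightarrow> sigma (v, Suc D) * sigma (l, Suc D) = - embed (lss_gen D v l)"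
  and sigma_free: "x \<in> free_vars \<Longrightarrow> sigma x = embed (variable x)"
  and sigma_nonzero: "sigma (u, Suc D) \<noteq> 0"
  using sigma_solution unfolding last_coordinate_solution_def free_vars_def by (blast, auto)

lemma psi_free: "p \<in> polys_in free_vars \<Longrightarrow> psi p = embed p"
  by (rule evaluate_eq_embed[OF _ sigma_free])

lemma lss_gen_free: "lss_gen D v l \<in> polys_in free_vars"
  unfolding lss_gen_def variable_def mult_single
  by (intro polys_in_sum polys_in_single) (auto simp: keys_add_nat free_vars_def)

lemma psi_J: "p \<in> J \<Longrightarrow> psi p = 0"
  unfolding J_def
proof (induction rule: gen.span_induct_alt)
  case base
  show ?case by simp
next
  case (step c x y)
  obtain v l where vl: "(v, l) \<in> set es" "x = lss_edge (Suc D) (v, l)" using step(1) by auto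
  have "psi x = psi (lss_gen D v l) + sigma (v, Suc D) * sigma (l, Suc D)"
    by (simp add: vl(2) lss_edge_def lss_gen_Suc evaluate_add evaluate_mult evaluate_variable)
  then have "psi x = 0" by (simp add: sigma_edge[OF vl(1)] psi_free[OF lss_gen_free])
  then show ?case using step by (simp add: evaluate_add evaluate_mult)
qed

definition cong :: "(nat \<times> nat, 'k::field) mpoly \<Rightarrow> (nat \<times> nat, 'k) mpoly \<Rightarrow> bool" (infix "\<equiv>\<^sub>J" 50) where
  "p \<equiv>\<^sub>J q \<longleftrightarrow> p - q \<in> J"

lemma cong_refl [simp]: "p \<equiv>\<^sub>J p"
  by (simp add: cong_def J_def gen.span_zero)

lemma cong_sym: "p \<equiv>\<^sub>J q \<Longrightarrow> q \<equiv>\<^sub>J p"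
  using gen.span_neg[of "p - q"] by (simp add: cong_def J_def)

lemma cong_trans [trans]: "p \<equiv>\<^sub>J q \<Longrightarrow> q \<equiv>\<^sub>J r \<Longrightarrow> p \<equiv>\<^sub>J r"
  using gen.span_add[of "p - q" _ "q - r"] by (simp add: cong_def J_def)

lemma cong_add: "p \<equiv>\<^sub>J q \<Longrightarrow> p' \<equiv>\<^sub>J q' \<Longrightarrow> p + p' \<equiv>\<^sub>J q + q'"
  using gen.span_add[of "p - q" _ "p' - q'"] by (simp add: cong_def J_def algebra_simps)

lemma cong_mult:
  assumes "p \<equiv>\<^sub>J q" "p' \<equiv>\<^sub>J q'" shows "p * p' \<equiv>\<^sub>J q * q'"
proof -
  have "p * p' - q * q' = p' * (p - q) + q * (p' - q')" by (simp add: algebra_simps)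
  then show ?thesis
    using assms unfolding cong_def J_def by (simp only:) (intro gen.span_add gen.span_scale)
qed

lemma psi_cong: "p \<equiv>\<^sub>J q \<Longrightarrow> psi p = psi q"
  using psi_J[of "p - q"] by (simp add: cong_def evaluate_diff)

definition last_prod :: "nat list \<Rightarrow> (nat \<times> nat, 'k::field) mpoly" where
  "last_prod us = prod_list (map last_var us)"

lemma last_prod_cancel: "last_prod us * p \<in> J \<Longrightarrow> p \<in> J"
proof (induction us arbitrary: p)
  case (Cons u us)
  then show ?case using last_var_cancel[of u "last_prod us * p"]
    by (simp add: last_prod_def mult.assoc)
qed (simp add: last_prod_def)

lemma psi_last_prod_nonzero: "psi (last_prod us) \<noteq> 0"
  by (induction us)
     (simp_all add: last_prod_def evaluate_mult last_var_def evaluate_variable sigma_nonzero)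

text \<open>
  Polynomials in the free variables that agree modulo \<open>J\<close> with a product of last coordinates. They can
  be cancelled modulo \<open>J\<close> like the latter, and \<open>psi\<close> leaves them unchanged like the
  former.
\<close>

definition denoms :: "(nat \<times> nat, 'k::field) mpoly set" where
  "denoms = {\<nu> \<in> polys_in free_vars. \<exists>us. \<nu> \<equiv>\<^sub>J last_prod us}"

lemma denoms_1: "1 \<in> denoms"
  unfolding denoms_def using exI[of "\<lambda>us. 1 \<equiv>\<^sub>J last_prod us" "[]"] by (simp add: last_prod_def)

lemma denoms_mult:
  assumes "\<mu> \<in> denoms" "\<nu> \<in> denoms" shows "\<mu> * \<nu> \<in> denoms"
proof -
  obtain us vs where "\<mu> \<equiv>\<^sub>J last_prod us" "\<nu> \<equiv>\<^sub>J last_prod vs" using assms by (auto simp: denoms_def)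
  then have "\<mu> * \<nu> \<equiv>\<^sub>J last_prod us * last_prod vs" by (rule cong_mult)
  also have "last_prod us * last_prod vs = last_prod (us @ vs)" by (simp add: last_prod_def)
  finally have "\<mu> * \<nu> \<equiv>\<^sub>J last_prod (us @ vs)" .
  moreover have "\<mu> * \<nu> \<in> polys_in free_vars" using assms by (simp add: denoms_def polys_in_mult)
  ultimately show ?thesis unfolding denoms_def by blast
qed

lemma denoms_cancel:
  assumes "\<nu> \<in> denoms" "\<nu> * p \<in> J" shows "p \<in> J"
proof -
  obtain us where "\<nu> \<equiv>\<^sub>J last_prod us" using assms(1) by (auto simp: denoms_def)
  then have "last_prod us * p \<equiv>\<^sub>J \<nu> * p" by (rule cong_mult[OF cong_sym cong_refl])
  also have "\<nu> * p \<equiv>\<^sub>J 0" using assms(2) by (simp add: cong_def)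
  finally show ?thesis by (intro last_prod_cancel[of us p]) (simp add: cong_def)
qed

text \<open>
  Modulo \<open>J\<close> every last coordinate is a quotient of two such denominators. For a child \<open>l\<close> with parent \<open>v\<close>
  the edge equation reads \<open>y(v,d) y(l,d) = - g\<close> with \<open>g\<close> in the free variables. If
  \<open>\<nu> y(v,d) = q\<close>, then \<open>q y(l,d) = - \<nu> g\<close>; and the right side is again congruent to a product of
  last coordinates because the left side is.
\<close>

lemma last_var_fraction:
  "\<exists>\<nu>\<in>denoms. \<exists>q\<in>denoms. \<nu> * last_var u \<equiv>\<^sub>J (q :: (nat \<times> nat, 'k::field) mpoly)"
proof (cases "u \<in> snd ` set es")
  case False
  then have "last_var u \<in> polys_in free_vars"
    by (auto simp: last_var_def variable_def polys_in_def free_vars_def)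
  moreover have "last_var u \<equiv>\<^sub>J last_prod [u]" by (simp add: last_prod_def)
  ultimately have "last_var u \<in> denoms" unfolding denoms_def by blast
  then show ?thesis using denoms_1 by (metis cong_refl mult_1)
next
  case True
  \<comment> \<open>The induction runs over the end segments \<open>es'\<close> of the list. The third premise says
    that a vertex of such a segment which has a parent at all has it within the segment.\<close>
  have "leaf_order es' \<Longrightarrow> set es' \<subseteq> set es \<Longrightarrow>
    (\<And>x. x \<in> endpoints (set es') \<Longrightarrow> x \<in> snd ` set es \<Longrightarrow> x \<in> snd ` set es') \<Longrightarrow> u \<in> snd ` set es' \<Longrightarrow>
    \<exists>\<nu>\<in>denoms. \<exists>q\<in>denoms. \<nu> * last_var u \<equiv>\<^sub>J (q :: (nat \<times> nat, 'k) mpoly)" for es' u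
  proof (induction es' arbitrary: u rule: leaf_order.induct)
    case (2 v l es')
    have new: "v \<noteq> l" "l \<notin> endpoints (set es')" "leaf_order es'" using 2(2) by auto
    have child_endpoint: "x \<in> endpoints (set es')" if "x \<in> snd ` set es'" for x
      using that by (auto simp: endpoints_def undirected_def)
    have tail: "x \<in> snd ` set es'" if "x \<in> endpoints (set es')" "x \<in> snd ` set es" for x
      using 2(4)[of x] that new(2) by auto
    note IH = 2(1)[OF new(3) _ tail]
    show ?case
    proof (cases "u = l")
      case False
      then have "u \<in> snd ` set es'" using 2(5) by auto
      then show ?thesis using IH[of u] 2(3) by auto
    next
      case True
      have "\<exists>\<nu>\<in>denoms. \<exists>q\<in>denoms. \<nu> * last_var v \<equiv>\<^sub>J (q :: (nat \<times> nat, 'k) mpoly)"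
      proof (cases "v \<in> snd ` set es")
        case True
        then have "v \<in> snd ` set es'" using 2(4)[of v] new(1) by auto
        then show ?thesis using IH[of v] 2(3) by auto
      next
        case False
        then have "last_var v \<in> polys_in free_vars"
          by (auto simp: last_var_def variable_def polys_in_def free_vars_def)
        moreover have "last_var v \<equiv>\<^sub>J last_prod [v]" by (simp add: last_prod_def)
        ultimately have "last_var v \<in> denoms" unfolding denoms_def by blast
        then show ?thesis using denoms_1 by (metis cong_refl mult_1)
      qed
      then obtain \<nu> q :: "(nat \<times> nat, 'k) mpoly" where
        \<nu>: "\<nu> \<in> denoms" "q \<in> denoms" "\<nu> * last_var v \<equiv>\<^sub>J q" by blast
      have "lss_edge (Suc D) (v, l) \<in> J"
        unfolding J_def using 2(3) by (intro gen.span_base) auto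
      then have edge: "last_var v * last_var l \<equiv>\<^sub>J (- lss_gen D v l :: (nat \<times> nat, 'k) mpoly)"
        by (simp add: cong_def lss_edge_def lss_gen_Suc last_var_def add.commute)
      have "q * last_var l \<equiv>\<^sub>J (\<nu> * last_var v) * last_var l"
        by (rule cong_mult[OF cong_sym[OF \<nu>(3)] cong_refl])
      also have "(\<nu> * last_var v) * last_var l = \<nu> * (last_var v * last_var l)" by (simp add: mult_ac)
      also have "\<nu> * (last_var v * last_var l) \<equiv>\<^sub>J \<nu> * (- lss_gen D v l)"
        by (rule cong_mult[OF cong_refl edge])
      finally have main: "q * last_var l \<equiv>\<^sub>J \<nu> * (- lss_gen D v l)" .
      obtain us where "q \<equiv>\<^sub>J last_prod us" using \<nu>(2) by (auto simp: denoms_def)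
      then have "q * last_var l \<equiv>\<^sub>J last_prod us * last_var l" by (rule cong_mult[OF _ cong_refl])
      then have "q * last_var l \<equiv>\<^sub>J last_prod (l # us)"
        by (simp add: last_prod_def mult.commute)
      then have "\<nu> * (- lss_gen D v l) \<equiv>\<^sub>J last_prod (l # us)"
        by (rule cong_trans[OF cong_sym[OF main]])
      moreover have "\<nu> * (- lss_gen D v l) \<in> polys_in free_vars"
        using \<nu>(1) by (intro polys_in_mult polys_in_uminus lss_gen_free) (simp add: denoms_def)
      ultimately have "\<nu> * (- lss_gen D v l) \<in> denoms" unfolding denoms_def by blast
      then show ?thesis using main \<nu>(2) True by blast
    qed
  qed simp
  then show ?thesis using leaf_order True by blast
qed

text \<open>
  The elements with this property form a subring that contains all variables.
\<close>

lemma free_fraction: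
  "\<exists>\<nu>\<in>denoms. \<exists>q\<in>polys_in free_vars. \<nu> * p \<equiv>\<^sub>J (q :: (nat \<times> nat, 'k::field) mpoly)"
proof (induction p rule: mpoly_induct)
  case (const c)
  have "single 0 c \<in> polys_in free_vars" by (rule polys_in_single) simp
  then show ?case using denoms_1 by (metis cong_refl mult_1)
next
  case (variable x)
  show ?case
  proof (cases "x \<in> free_vars")
    case True
    then have "variable x \<in> polys_in free_vars" by (auto simp: variable_def polys_in_def)
    then show ?thesis using denoms_1 by (metis cong_refl mult_1)
  next
    case False
    then obtain u where x: "x = (u, Suc D)" by (auto simp: free_vars_def)
    have "denoms \<subseteq> polys_in free_vars" by (auto simp: denoms_def)
    then show ?thesis using last_var_fraction[of u] unfolding x last_var_def by blast
  qed
next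
  case (add p p')
  then obtain \<nu> q \<nu>' q' where *: "\<nu> \<in> denoms" "q \<in> polys_in free_vars" "\<nu> * p \<equiv>\<^sub>J q"
    "\<nu>' \<in> denoms" "q' \<in> polys_in free_vars" "\<nu>' * p' \<equiv>\<^sub>J q'" by blast
  have "(\<nu> * \<nu>') * (p + p') = \<nu>' * (\<nu> * p) + \<nu> * (\<nu>' * p')" by (simp add: algebra_simps)
  also have "\<dots> \<equiv>\<^sub>J \<nu>' * q + \<nu> * q'" by (intro cong_add cong_mult cong_refl *)
  finally have "(\<nu> * \<nu>') * (p + p') \<equiv>\<^sub>J \<nu>' * q + \<nu> * q'" .
  moreover have "\<nu>' * q + \<nu> * q' \<in> polys_in free_vars"
    using * by (intro polys_in_add polys_in_mult) (auto simp: denoms_def)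
  ultimately show ?case using denoms_mult[OF *(1,4)] by blast
next
  case (mult p p')
  then obtain \<nu> q \<nu>' q' where *: "\<nu> \<in> denoms" "q \<in> polys_in free_vars" "\<nu> * p \<equiv>\<^sub>J q"
    "\<nu>' \<in> denoms" "q' \<in> polys_in free_vars" "\<nu>' * p' \<equiv>\<^sub>J q'" by blast
  have "(\<nu> * \<nu>') * (p * p') = (\<nu> * p) * (\<nu>' * p')" by (simp add: algebra_simps)
  also have "\<dots> \<equiv>\<^sub>J q * q'" by (intro cong_mult *)
  finally have "(\<nu> * \<nu>') * (p * p') \<equiv>\<^sub>J q * q'" .
  moreover have "q * q' \<in> polys_in free_vars" using * by (intro polys_in_mult) auto
  ultimately show ?case using denoms_mult[OF *(1,4)] by blast
qed

lemma denoms_psi: "\<nu> \<in> denoms \<Longrightarrow> psi \<nu> = embed \<nu>"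
  by (rule psi_free) (simp add: denoms_def)

text \<open>
  If \<open>psi p = 0\<close>, multiply \<open>p\<close> into a polynomial \<open>q\<close> in the free variables modulo \<open>J\<close>. Then \<open>q\<close> vanishes
  because \<open>psi\<close> fixes it, and the multiplier can be cancelled.
\<close>

theorem psi_eq_0_iff: "psi p = 0 \<longleftrightarrow> p \<in> J"
proof
  assume "psi p = 0"
  obtain \<nu> q where *: "\<nu> \<in> denoms" "q \<in> polys_in free_vars" "\<nu> * p \<equiv>\<^sub>J q" using free_fraction by blast
  then have "embed q = psi \<nu> * psi p" using psi_cong[OF *(3)] psi_free[OF *(2)] by (simp add: evaluate_mult)
  then have "q = 0" using \<open>psi p = 0\<close> by (simp add: embed_eq_0_iff)
  then show "p \<in> J" using denoms_cancel[OF *(1), of p] *(3) by (simp add: cong_def)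
qed (rule psi_J)

lemma psi_eq_iff: "psi p = psi q \<longleftrightarrow> p \<equiv>\<^sub>J q"
  using psi_eq_0_iff[of "p - q"] by (simp add: evaluate_diff cong_def)

lemma denoms_psi_nonzero: "\<nu> \<in> denoms \<Longrightarrow> psi \<nu> \<noteq> 0"
  using psi_cong psi_last_prod_nonzero by (fastforce simp: denoms_def)

lemma psi_fraction:
  "\<exists>\<nu>\<in>denoms. \<exists>q\<in>polys_in free_vars. psi p = embed q / embed \<nu>"
proof -
  obtain \<nu> q where *: "\<nu> \<in> denoms" "q \<in> polys_in free_vars" "\<nu> * p \<equiv>\<^sub>J q" using free_fraction by blast
  have "embed \<nu> * psi p = embed q"
    using psi_cong[OF *(3)] psi_free[OF *(2)] denoms_psi[OF *(1)] by (simp add: evaluate_mult)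
  moreover have "embed \<nu> \<noteq> 0" using denoms_psi_nonzero[OF *(1)] denoms_psi[OF *(1)] by simp
  ultimately have "psi p = embed q / embed \<nu>" by (metis nonzero_mult_div_cancel_left)
  then show ?thesis using * by blast
qed

section \<open>Integral closedness of the image\<close>

lemma range_psi_mult: "x \<in> range psi \<Longrightarrow> y \<in> range psi \<Longrightarrow> x * y \<in> range psi"
  by (auto simp flip: evaluate_mult)

text \<open>
  The last coordinates of the multiplier are removed one by one. If \<open>?y * ?z\<close> is \<open>psi f\<close> with \<open>?z\<close>
  integral, the integral equation of \<open>?z\<close> times \<open>?y ^ m\<close> shows that \<open>f ^ m\<close> is in \<open>J + (y)\<close>. This ideal
  is radical, so \<open>f\<close> is in it, and \<open>?z\<close> is in the image.
\<close>

lemma range_psi_descend: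
  fixes z :: "(nat \<times> nat, 'k::field) mpoly fract"
  assumes "integral_elem (range psi) z" "psi (last_prod us) * z \<in> range psi"
  shows "z \<in> range psi"
  using assms(2)
proof (induction us)
  case Nil
  then show ?case by (simp add: last_prod_def)
next
  case (Cons u us)
  let ?z = "psi (last_prod us) * z" and ?y = "psi (last_var u :: (nat \<times> nat, 'k) mpoly)"
  have "integral_elem (range psi) ?z"
  proof (rule integral_elem_scale[OF assms(1)])
    show "1 \<in> range psi" by (rule range_eqI[where x = 1]) simp
  qed (auto intro: range_psi_mult)
  then obtain m c where c: "\<forall>i<m. c i \<in> range psi" "?z ^ m = (\<Sum>i<m. c i * ?z ^ i)"
    unfolding integral_elem_def by blast
  from c(1) have "\<forall>i. \<exists>p. i < m \<longrightarrow> c i = psi p" by blast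
  then obtain p where p: "\<And>i. i < m \<Longrightarrow> c i = psi (p i)" by metis
  obtain f where f: "psi f = ?y * ?z"
    using Cons.prems by (auto simp: last_prod_def evaluate_mult mult.assoc)
  define h where "h = (\<Sum>i<m. last_var u ^ (m - i - 1) * p i * f ^ i)"
  have "psi (f ^ m) = ?y ^ m * ?z ^ m" by (simp add: evaluate_power f power_mult_distrib)
  also have "\<dots> = (\<Sum>i<m. ?y ^ m * (c i * ?z ^ i))" by (simp only: c(2) sum_distrib_left)
  also have "\<dots> = (\<Sum>i<m. ?y * (?y ^ (m - i - 1) * psi (p i) * psi f ^ i))"
  proof (rule sum.cong)
    fix i assume i: "i \<in> {..<m}"
    then have ym: "?y ^ m = ?y * ?y ^ (m - i - 1) * ?y ^ i" by (simp flip: power_add power_Suc)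
    have "c i = psi (p i)" using p i by simp
    then show "?y ^ m * (c i * ?z ^ i) = ?y * (?y ^ (m - i - 1) * psi (p i) * psi f ^ i)"
      by (simp only: ym f power_mult_distrib mult_ac)
  qed simp
  also have "\<dots> = psi (last_var u * h)"
    by (simp add: h_def evaluate_mult evaluate_sum evaluate_power sum_distrib_left)
  finally have "f ^ m - last_var u * h \<in> J" unfolding psi_eq_iff cong_def .
  then obtain g where "f - last_var u * g \<in> J" by (rule last_var_radical)
  then have "psi f = ?y * psi g" using psi_eq_iff[of f "last_var u * g"] by (simp add: cong_def evaluate_mult)
  moreover have "?y \<noteq> 0" by (simp add: last_var_def evaluate_variable sigma_nonzero)
  ultimately have "?z = psi g" using f by simp
  then show ?case using Cons.IH by blast
qed

text \<open>
  After clearing denominators with some \<open>\<delta>\<close> in \<open>denoms\<close>, the fraction is integral over the polynomials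
  in the free variables, hence equal to a polynomial \<open>q\<close>. This \<open>q\<close> need not be in the image of \<open>psi\<close>, but
  the equation \<open>\<delta> * a' = b' * q\<close> can be mapped by \<open>psi\<close>, which fixes all its members except \<open>q\<close>.
\<close>

theorem range_psi_integrally_closed:
  assumes "integral_elem (range psi) (psi a / psi b)" "psi b \<noteq> 0"
  shows "psi a / psi b \<in> range (psi :: (nat \<times> nat, 'k::field) mpoly \<Rightarrow> _)"
proof -
  let ?z = "psi a / psi b"
  let ?A = "embed ` polys_in free_vars :: (nat \<times> nat, 'k) mpoly fract set"
  let ?M = "embed ` denoms :: (nat \<times> nat, 'k) mpoly fract set"
  have "range psi \<subseteq> {x / s | x s. x \<in> ?A \<and> s \<in> ?M}" using psi_fraction by blast
  then have "integral_elem {x / s | x s. x \<in> ?A \<and> s \<in> ?M} ?z" by (rule integral_elem_mono[OF assms(1)])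
  moreover have "?M \<subseteq> ?A" by (auto simp: denoms_def)
  moreover have "1 \<in> ?M" by (rule image_eqI[where x = 1]) (simp_all add: embed_1 denoms_1)
  moreover have "0 \<notin> ?M" using denoms_psi_nonzero denoms_psi by force
  moreover have "x * y \<in> ?A" if "x \<in> ?A" "y \<in> ?A" for x y
    using that by (auto intro: polys_in_mult simp flip: embed_mult)
  moreover have "x * y \<in> ?M" if "x \<in> ?M" "y \<in> ?M" for x y
    using that by (auto intro: denoms_mult simp flip: embed_mult)
  ultimately obtain s where "s \<in> ?M" "integral_elem ?A (s * ?z)"
    by (rule integral_elem_clear_denominators)
  then obtain \<delta> where \<delta>: "\<delta> \<in> denoms" "integral_elem ?A (embed \<delta> * ?z)" by blast
  obtain \<nu>1 a1 where a1: "\<nu>1 \<in> denoms" "a1 \<in> polys_in free_vars" "psi a = embed a1 / embed \<nu>1"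
    using psi_fraction by blast
  obtain \<nu>2 b1 where b1: "\<nu>2 \<in> denoms" "b1 \<in> polys_in free_vars" "psi b = embed b1 / embed \<nu>2"
    using psi_fraction by blast
  define a' b' where "a' = a1 * \<nu>2" and "b' = b1 * \<nu>1"
  have a'b': "a' \<in> polys_in free_vars" "b' \<in> polys_in free_vars"
    using a1 b1 unfolding a'_def b'_def by (auto intro!: polys_in_mult simp: denoms_def)
  have nz: "embed \<nu>1 \<noteq> 0" "embed \<nu>2 \<noteq> 0" using denoms_psi_nonzero denoms_psi a1(1) b1(1) by metis+
  then have "embed b1 \<noteq> 0" using assms(2) b1(3) by auto
  then have b'nz: "embed b' \<noteq> 0" using nz by (simp add: b'_def embed_mult)
  have z: "?z = embed a' / embed b'"
    unfolding a1(3) b1(3) a'_def b'_def embed_mult by (simp add: divide_divide_eq_left mult.commute)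
  have "embed \<delta> * ?z = embed (\<delta> * a') / embed b'" unfolding z embed_mult by simp
  then have "integral_elem (range embed) (embed (\<delta> * a') / embed b')"
    using integral_elem_mono[OF \<delta>(2), of "range embed"] by auto
  then have "b' dvd \<delta> * a'"
    using polynomials_integrally_closed[of b' "\<delta> * a'"] b'nz unfolding embed_eq_0_iff by blast
  then obtain q where "\<delta> * a' = b' * q" by (auto elim: dvdE)
  then have "psi (\<delta> * a') = psi (b' * q)" by (rule arg_cong)
  then have "psi \<delta> * embed a' = embed b' * psi q"
    by (simp add: evaluate_mult psi_free[OF a'b'(1)] psi_free[OF a'b'(2)])
  then have "psi \<delta> * ?z = psi q" unfolding z using b'nz by (simp add: field_simps)
  moreover obtain us where "\<delta> \<equiv>\<^sub>J last_prod us" using \<delta>(1) by (auto simp: denoms_def)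
  ultimately have "psi (last_prod us) * ?z = psi q" using psi_cong[of \<delta> "last_prod us"] by simp
  then have "psi (last_prod us) * ?z \<in> range psi" by (rule range_eqI)
  then show ?thesis by (rule range_psi_descend[OF assms(1)])
qed

end

section \<open>Rings embedded in a field\<close>

text \<open>
  An injective homomorphism from a record-based ring to a field given by a type. Ring axioms,
  localizations and integral equations can then be verified in the field, where calculation
  is easy.
\<close>

definition field_embedding :: "('a, 'm) ring_scheme \<Rightarrow> ('a \<Rightarrow> 'f::field) \<Rightarrow> bool" where
  "field_embedding R \<theta> \<longleftrightarrow> inj_on \<theta> (carrier R) \<and>
     \<zero>\<^bsub>R\<^esub> \<in> carrier R \<and> \<one>\<^bsub>R\<^esub> \<in> carrier R \<and> \<theta> \<zero>\<^bsub>R\<^esub> = 0 \<and> \<theta> \<one>\<^bsub>R\<^esub> = 1 \<and>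
     (\<forall>a\<in>carrier R. \<forall>b\<in>carrier R. a \<oplus>\<^bsub>R\<^esub> b \<in> carrier R \<and> \<theta> (a \<oplus>\<^bsub>R\<^esub> b) = \<theta> a + \<theta> b) \<and>
     (\<forall>a\<in>carrier R. \<forall>b\<in>carrier R. a \<otimes>\<^bsub>R\<^esub> b \<in> carrier R \<and> \<theta> (a \<otimes>\<^bsub>R\<^esub> b) = \<theta> a * \<theta> b) \<and>
     (\<forall>a\<in>carrier R. \<exists>b\<in>carrier R. \<theta> b = - \<theta> a)"

context
  fixes R :: "('a, 'm) ring_scheme" and \<theta> :: "'a \<Rightarrow> 'f::field"
  assumes emb: "field_embedding R \<theta>"
begin

lemma embedding_eq_iff: "a \<in> carrier R \<Longrightarrow> b \<in> carrier R \<Longrightarrow> \<theta> a = \<theta> b \<longleftrightarrow> a = b"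
  using emb unfolding field_embedding_def by (meson inj_on_eq_iff)

lemma embedding_zero: "\<zero>\<^bsub>R\<^esub> \<in> carrier R" "\<theta> \<zero>\<^bsub>R\<^esub> = 0"
  and embedding_one: "\<one>\<^bsub>R\<^esub> \<in> carrier R" "\<theta> \<one>\<^bsub>R\<^esub> = 1"
  and embedding_add: "a \<in> carrier R \<Longrightarrow> b \<in> carrier R \<Longrightarrow> a \<oplus>\<^bsub>R\<^esub> b \<in> carrier R"
    "a \<in> carrier R \<Longrightarrow> b \<in> carrier R \<Longrightarrow> \<theta> (a \<oplus>\<^bsub>R\<^esub> b) = \<theta> a + \<theta> b"
  and embedding_mult: "a \<in> carrier R \<Longrightarrow> b \<in> carrier R \<Longrightarrow> a \<otimes>\<^bsub>R\<^esub> b \<in> carrier R"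
    "a \<in> carrier R \<Longrightarrow> b \<in> carrier R \<Longrightarrow> \<theta> (a \<otimes>\<^bsub>R\<^esub> b) = \<theta> a * \<theta> b"
  and embedding_uminus: "a \<in> carrier R \<Longrightarrow> \<exists>b\<in>carrier R. \<theta> b = - \<theta> a"
  using emb unfolding field_embedding_def by simp_all

lemmas embedding_simps = embedding_zero embedding_one embedding_add embedding_mult

lemma embedding_eq_0_iff: "a \<in> carrier R \<Longrightarrow> \<theta> a = 0 \<longleftrightarrow> a = \<zero>\<^bsub>R\<^esub>"
  using embedding_eq_iff[of a "\<zero>\<^bsub>R\<^esub>"] embedding_zero by simp

lemma embedding_cring: "cring R"
proof (rule cringI)
  show "abelian_group R"
  proof (rule abelian_groupI)
    fix x assume x: "x \<in> carrier R"
    obtain y where y: "y \<in> carrier R" "\<theta> y = - \<theta> x" using embedding_uminus[OF x] by blast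
    then have "y \<oplus>\<^bsub>R\<^esub> x = \<zero>\<^bsub>R\<^esub>"
      using x by (simp add: embedding_simps flip: embedding_eq_iff)
    then show "\<exists>y\<in>carrier R. y \<oplus>\<^bsub>R\<^esub> x = \<zero>\<^bsub>R\<^esub>" using y(1) by blast
  qed (simp_all add: embedding_simps add.assoc add.commute flip: embedding_eq_iff)
  show "comm_monoid R"
    by (rule comm_monoidI)
       (simp_all add: embedding_simps mult.assoc mult.commute flip: embedding_eq_iff)
qed (simp add: embedding_simps distrib_right flip: embedding_eq_iff)

lemma embedding_domain: "domain R"
proof (rule domain.intro)
  show "domain_axioms R"
  proof (rule domain_axioms.intro)
    show "\<one>\<^bsub>R\<^esub> \<noteq> \<zero>\<^bsub>R\<^esub>" by (simp add: embedding_simps flip: embedding_eq_iff)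
    fix a b assume ab: "a \<otimes>\<^bsub>R\<^esub> b = \<zero>\<^bsub>R\<^esub>" "a \<in> carrier R" "b \<in> carrier R"
    then have "\<theta> a * \<theta> b = 0" using embedding_mult(2) embedding_zero(2) by metis
    then show "a = \<zero>\<^bsub>R\<^esub> \<or> b = \<zero>\<^bsub>R\<^esub>" using ab embedding_eq_0_iff by auto
  qed
qed (rule embedding_cring)

lemma embedding_pow: "x \<in> carrier R \<Longrightarrow> x [^]\<^bsub>R\<^esub> (k::nat) \<in> carrier R \<and> \<theta> (x [^]\<^bsub>R\<^esub> k) = \<theta> x ^ k"
proof (induction k)
  case 0
  then show ?case by (simp add: embedding_simps nat_pow_def)
next
  case (Suc k)
  then show ?case by (simp add: embedding_simps nat_pow_def)
qed

lemma embedding_eval: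
  assumes "set p \<subseteq> carrier R" "x \<in> carrier R"
  shows "ring.eval R p x \<in> carrier R \<and>
    \<theta> (ring.eval R p x) = (\<Sum>i<length p. \<theta> (p ! (length p - Suc i)) * \<theta> x ^ i)"
  using assms(1)
proof (induction p)
  case Nil
  interpret cring R by (rule embedding_cring)
  show ?case by (simp add: embedding_simps)
next
  case (Cons c p)
  interpret cring R by (rule embedding_cring)
  have c: "c \<in> carrier R" using Cons.prems by simp
  have "(\<Sum>i<length p. \<theta> (p ! (length p - Suc i)) * \<theta> x ^ i) =
        (\<Sum>i<length p. \<theta> ((c # p) ! (length p - i)) * \<theta> x ^ i)"
  proof (rule sum.cong)
    fix i assume "i \<in> {..<length p}"
    then have "length p - i = Suc (length p - Suc i)" by auto
    then show "\<theta> (p ! (length p - Suc i)) * \<theta> x ^ i = \<theta> ((c # p) ! (length p - i)) * \<theta> x ^ i" by simp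
  qed simp
  then show ?case
    using Cons c embedding_pow[OF assms(2), of "length p"] by (simp add: embedding_simps)
qed

definition fraction_value :: "('a \<times> 'a) set \<Rightarrow> 'f" where
  "fraction_value C = (SOME z. \<exists>(a, s)\<in>C. z = \<theta> a / \<theta> s)"

context
  fixes M :: "'a set"
  assumes M: "M \<subseteq> carrier R" "\<one>\<^bsub>R\<^esub> \<in> M" "\<zero>\<^bsub>R\<^esub> \<notin> M" "\<And>s t. s \<in> M \<Longrightarrow> t \<in> M \<Longrightarrow> s \<otimes>\<^bsub>R\<^esub> t \<in> M"
begin

lemma denominator_nonzero: "s \<in> M \<Longrightarrow> \<theta> s \<noteq> 0"
  using M(1,3) embedding_eq_0_iff by blast

text \<open>
  The class of \<open>a / s\<close> consists of the pairs with the same value in the field, so every class is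
  determined by its value.
\<close>

lemma fraction_eq:
  assumes "a \<in> carrier R" "s \<in> M"
  shows "fraction R M a s = {(b, t). b \<in> carrier R \<and> t \<in> M \<and> \<theta> b / \<theta> t = \<theta> a / \<theta> s}"
proof -
  have "(\<exists>u\<in>M. u \<otimes>\<^bsub>R\<^esub> (a \<otimes>\<^bsub>R\<^esub> t) = u \<otimes>\<^bsub>R\<^esub> (b \<otimes>\<^bsub>R\<^esub> s)) \<longleftrightarrow> \<theta> b / \<theta> t = \<theta> a / \<theta> s"
    if b: "b \<in> carrier R" "t \<in> M" for b t
  proof -
    have in_R: "s \<in> carrier R" "t \<in> carrier R" using assms b M(1) by blast+
    have "u \<otimes>\<^bsub>R\<^esub> (a \<otimes>\<^bsub>R\<^esub> t) = u \<otimes>\<^bsub>R\<^esub> (b \<otimes>\<^bsub>R\<^esub> s) \<longleftrightarrow> \<theta> b / \<theta> t = \<theta> a / \<theta> s" if u: "u \<in> M" for u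
    proof -
      have "u \<otimes>\<^bsub>R\<^esub> (a \<otimes>\<^bsub>R\<^esub> t) = u \<otimes>\<^bsub>R\<^esub> (b \<otimes>\<^bsub>R\<^esub> s) \<longleftrightarrow> \<theta> u * (\<theta> a * \<theta> t) = \<theta> u * (\<theta> b * \<theta> s)"
        using assms(1) b(1) in_R u M(1) by (subst embedding_eq_iff[symmetric]) (auto simp: embedding_simps)
      also have "\<dots> \<longleftrightarrow> \<theta> b / \<theta> t = \<theta> a / \<theta> s"
        using denominator_nonzero u b(2) assms(2) by (auto simp: field_simps)
      finally show ?thesis .
    qed
    then show ?thesis using M(2) by blast
  qed
  then show ?thesis
    using assms unfolding fraction_def fraction_rel_def by (auto simp: Image_def)
qed

lemma fraction_value_fraction:
  assumes "a \<in> carrier R" "s \<in> M"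
  shows "fraction_value (fraction R M a s) = \<theta> a / \<theta> s"
  unfolding fraction_value_def fraction_eq[OF assms] using assms by (intro some_equality) auto

lemma fraction_self: "a \<in> carrier R \<Longrightarrow> s \<in> M \<Longrightarrow> (a, s) \<in> fraction R M a s"
  by (simp add: fraction_eq)

lemma fraction_cong:
  "a \<in> carrier R \<Longrightarrow> s \<in> M \<Longrightarrow> b \<in> carrier R \<Longrightarrow> t \<in> M \<Longrightarrow> \<theta> a / \<theta> s = \<theta> b / \<theta> t \<Longrightarrow>
   fraction R M a s = fraction R M b t"
  by (simp add: fraction_eq)

lemma carrier_localization:
  "carrier (localization R M) = {fraction R M a s | a s. a \<in> carrier R \<and> s \<in> M}"
  by (auto simp: localization_def quotient_def fraction_def)

lemma fraction_in_carrier: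
  "a \<in> carrier R \<Longrightarrow> s \<in> M \<Longrightarrow> fraction R M a s \<in> carrier (localization R M)"
  unfolding carrier_localization by blast

text \<open>
  The operations of the localization are unions over representatives; they reduce to one term when
  the term depends only on the values of the representatives.
\<close>

lemma UN_fraction:
  assumes "a \<in> carrier R" "s \<in> M" "b \<in> carrier R" "t \<in> M"
    and F: "\<And>a' s' b' t'. a' \<in> carrier R \<Longrightarrow> s' \<in> M \<Longrightarrow> \<theta> a' / \<theta> s' = \<theta> a / \<theta> s \<Longrightarrow>
      b' \<in> carrier R \<Longrightarrow> t' \<in> M \<Longrightarrow> \<theta> b' / \<theta> t' = \<theta> b / \<theta> t \<Longrightarrow> F a' s' b' t' = F a s b t"
  shows "(\<Union>(a', s')\<in>fraction R M a s. \<Union>(b', t')\<in>fraction R M b t. F a' s' b' t') = F a s b t"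
proof -
  have *: "F a' s' b' t' = F a s b t"
    if "(a', s') \<in> fraction R M a s" "(b', t') \<in> fraction R M b t" for a' s' b' t'
    using that F unfolding fraction_eq[OF assms(1,2)] fraction_eq[OF assms(3,4)] by blast
  have "(\<Union>(b', t')\<in>fraction R M b t. F a' s' b' t') = F a s b t"
    if "(a', s') \<in> fraction R M a s" for a' s'
    by (rule UN_constant_eq[OF fraction_self[OF assms(3,4)]]) (use *[OF that] in auto)
  then show ?thesis
    by (intro UN_constant_eq[OF fraction_self[OF assms(1,2)]]) auto
qed

lemma localization_mult_fraction:
  assumes "a \<in> carrier R" "s \<in> M" "b \<in> carrier R" "t \<in> M"
  shows "fraction R M a s \<otimes>\<^bsub>localization R M\<^esub> fraction R M b t = fraction R M (a \<otimes>\<^bsub>R\<^esub> b) (s \<otimes>\<^bsub>R\<^esub> t)"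
proof -
  have *: "fraction R M (a' \<otimes>\<^bsub>R\<^esub> b') (s' \<otimes>\<^bsub>R\<^esub> t') = fraction R M (a \<otimes>\<^bsub>R\<^esub> b) (s \<otimes>\<^bsub>R\<^esub> t)"
    if "a' \<in> carrier R" "s' \<in> M" "\<theta> a' / \<theta> s' = \<theta> a / \<theta> s"
      "b' \<in> carrier R" "t' \<in> M" "\<theta> b' / \<theta> t' = \<theta> b / \<theta> t" for a' s' b' t'
  proof (rule fraction_cong)
    have "s \<in> carrier R" "t \<in> carrier R" "s' \<in> carrier R" "t' \<in> carrier R" using assms that M(1) by blast+
    then have "\<theta> (a' \<otimes>\<^bsub>R\<^esub> b') / \<theta> (s' \<otimes>\<^bsub>R\<^esub> t') = (\<theta> a' / \<theta> s') * (\<theta> b' / \<theta> t')"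
      "\<theta> (a \<otimes>\<^bsub>R\<^esub> b) / \<theta> (s \<otimes>\<^bsub>R\<^esub> t) = (\<theta> a / \<theta> s) * (\<theta> b / \<theta> t)"
      using assms(1,3) that(1,4) by (simp_all add: embedding_simps)
    then show "\<theta> (a' \<otimes>\<^bsub>R\<^esub> b') / \<theta> (s' \<otimes>\<^bsub>R\<^esub> t') = \<theta> (a \<otimes>\<^bsub>R\<^esub> b) / \<theta> (s \<otimes>\<^bsub>R\<^esub> t)"
      using that(3,6) by simp
  qed (use assms that M(4) embedding_mult(1) in auto)
  show ?thesis
    unfolding localization_def monoid.simps by (rule UN_fraction[OF assms]) (rule *)
qed

lemma localization_add_fraction:
  assumes "a \<in> carrier R" "s \<in> M" "b \<in> carrier R" "t \<in> M"
  shows "fraction R M a s \<oplus>\<^bsub>localization R M\<^esub> fraction R M b t =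
    fraction R M (a \<otimes>\<^bsub>R\<^esub> t \<oplus>\<^bsub>R\<^esub> b \<otimes>\<^bsub>R\<^esub> s) (s \<otimes>\<^bsub>R\<^esub> t)"
proof -
  have val: "\<theta> (a' \<otimes>\<^bsub>R\<^esub> t' \<oplus>\<^bsub>R\<^esub> b' \<otimes>\<^bsub>R\<^esub> s') / \<theta> (s' \<otimes>\<^bsub>R\<^esub> t') = \<theta> a' / \<theta> s' + \<theta> b' / \<theta> t'"
    if "a' \<in> carrier R" "s' \<in> M" "b' \<in> carrier R" "t' \<in> M" for a' s' b' t'
  proof -
    have "s' \<in> carrier R" "t' \<in> carrier R" using that M(1) by blast+
    then show ?thesis
      using that denominator_nonzero by (simp add: embedding_simps add_frac_eq)
  qed
  have *: "fraction R M (a' \<otimes>\<^bsub>R\<^esub> t' \<oplus>\<^bsub>R\<^esub> b' \<otimes>\<^bsub>R\<^esub> s') (s' \<otimes>\<^bsub>R\<^esub> t') =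
      fraction R M (a \<otimes>\<^bsub>R\<^esub> t \<oplus>\<^bsub>R\<^esub> b \<otimes>\<^bsub>R\<^esub> s) (s \<otimes>\<^bsub>R\<^esub> t)"
    if "a' \<in> carrier R" "s' \<in> M" "\<theta> a' / \<theta> s' = \<theta> a / \<theta> s"
      "b' \<in> carrier R" "t' \<in> M" "\<theta> b' / \<theta> t' = \<theta> b / \<theta> t" for a' s' b' t'
  proof (rule fraction_cong)
    have "s \<in> carrier R" "t \<in> carrier R" "s' \<in> carrier R" "t' \<in> carrier R" using assms that M(1) by blast+
    then show "a' \<otimes>\<^bsub>R\<^esub> t' \<oplus>\<^bsub>R\<^esub> b' \<otimes>\<^bsub>R\<^esub> s' \<in> carrier R" "a \<otimes>\<^bsub>R\<^esub> t \<oplus>\<^bsub>R\<^esub> b \<otimes>\<^bsub>R\<^esub> s \<in> carrier R"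
      using assms that by (simp_all add: embedding_simps)
  qed (use assms that M(4) val in auto)
  show ?thesis
    unfolding localization_def ring.simps by (rule UN_fraction[OF assms]) (rule *)
qed

lemma fraction_value_add:
  assumes "a \<in> carrier R" "s \<in> M" "b \<in> carrier R" "t \<in> M"
  shows "fraction_value (fraction R M (a \<otimes>\<^bsub>R\<^esub> t \<oplus>\<^bsub>R\<^esub> b \<otimes>\<^bsub>R\<^esub> s) (s \<otimes>\<^bsub>R\<^esub> t)) = \<theta> a / \<theta> s + \<theta> b / \<theta> t"
    and "a \<otimes>\<^bsub>R\<^esub> t \<oplus>\<^bsub>R\<^esub> b \<otimes>\<^bsub>R\<^esub> s \<in> carrier R"
proof -
  have "s \<in> carrier R" "t \<in> carrier R" using assms M(1) by blast+
  then show "fraction_value (fraction R M (a \<otimes>\<^bsub>R\<^esub> t \<oplus>\<^bsub>R\<^esub> b \<otimes>\<^bsub>R\<^esub> s) (s \<otimes>\<^bsub>R\<^esub> t)) = \<theta> a / \<theta> s + \<theta> b / \<theta> t"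
    "a \<otimes>\<^bsub>R\<^esub> t \<oplus>\<^bsub>R\<^esub> b \<otimes>\<^bsub>R\<^esub> s \<in> carrier R"
    using assms denominator_nonzero M(4) by (simp_all add: fraction_value_fraction embedding_simps add_frac_eq)
qed

theorem field_embedding_localization: "field_embedding (localization R M) fraction_value"
proof -
  let ?L = "localization R M"
  have elem: "\<exists>a\<in>carrier R. \<exists>s\<in>M. x = fraction R M a s" if "x \<in> carrier ?L" for x
    using that unfolding carrier_localization by blast
  note mem = fraction_in_carrier
  have "inj_on fraction_value (carrier ?L)"
  proof (rule inj_onI)
    fix x y assume xy: "x \<in> carrier ?L" "y \<in> carrier ?L" "fraction_value x = fraction_value y"
    obtain a s b t where *: "a \<in> carrier R" "s \<in> M" "x = fraction R M a s"
      "b \<in> carrier R" "t \<in> M" "y = fraction R M b t" using elem[OF xy(1)] elem[OF xy(2)] by blast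
    then have "\<theta> a / \<theta> s = \<theta> b / \<theta> t" using xy(3) by (simp add: fraction_value_fraction)
    then show "x = y" unfolding *(3,6) by (rule fraction_cong[OF *(1,2,4,5)])
  qed
  moreover have "\<zero>\<^bsub>?L\<^esub> = fraction R M \<zero>\<^bsub>R\<^esub> \<one>\<^bsub>R\<^esub>" "\<one>\<^bsub>?L\<^esub> = fraction R M \<one>\<^bsub>R\<^esub> \<one>\<^bsub>R\<^esub>"
    by (simp_all add: localization_def)
  then have "\<zero>\<^bsub>?L\<^esub> \<in> carrier ?L" "\<one>\<^bsub>?L\<^esub> \<in> carrier ?L"
    "fraction_value \<zero>\<^bsub>?L\<^esub> = 0" "fraction_value \<one>\<^bsub>?L\<^esub> = 1"
    using M(2) by (simp_all add: mem embedding_simps fraction_value_fraction)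
  moreover have "x \<otimes>\<^bsub>?L\<^esub> y \<in> carrier ?L \<and> fraction_value (x \<otimes>\<^bsub>?L\<^esub> y) = fraction_value x * fraction_value y"
    if xy: "x \<in> carrier ?L" "y \<in> carrier ?L" for x y
  proof -
    obtain a s b t where *: "a \<in> carrier R" "s \<in> M" "x = fraction R M a s"
      "b \<in> carrier R" "t \<in> M" "y = fraction R M b t" using elem[OF xy(1)] elem[OF xy(2)] by blast
    moreover have "s \<in> carrier R" "t \<in> carrier R" using * M(1) by blast+
    ultimately show ?thesis
      using M(4) by (simp add: localization_mult_fraction mem fraction_value_fraction embedding_simps)
  qed
  moreover have "x \<oplus>\<^bsub>?L\<^esub> y \<in> carrier ?L \<and> fraction_value (x \<oplus>\<^bsub>?L\<^esub> y) = fraction_value x + fraction_value y"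
    if xy: "x \<in> carrier ?L" "y \<in> carrier ?L" for x y
  proof -
    obtain a s b t where *: "a \<in> carrier R" "s \<in> M" "x = fraction R M a s"
      "b \<in> carrier R" "t \<in> M" "y = fraction R M b t" using elem[OF xy(1)] elem[OF xy(2)] by blast
    show ?thesis
      using mem[OF fraction_value_add(2)[OF *(1,2,4,5)] M(4)[OF *(2,5)]]
      unfolding *(3,6) localization_add_fraction[OF *(1,2,4,5)] fraction_value_add(1)[OF *(1,2,4,5)]
        fraction_value_fraction[OF *(1,2)] fraction_value_fraction[OF *(4,5)] by simp
  qed
  moreover have "\<exists>y\<in>carrier ?L. fraction_value y = - fraction_value x" if x: "x \<in> carrier ?L" for x
  proof -
    obtain a s where *: "a \<in> carrier R" "s \<in> M" "x = fraction R M a s" using elem[OF x] by blast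
    obtain b where b: "b \<in> carrier R" "\<theta> b = - \<theta> a" using embedding_uminus[OF *(1)] by blast
    then have "fraction_value (fraction R M b s) = - fraction_value x"
      using * by (simp add: fraction_value_fraction)
    then show ?thesis using mem[OF b(1) *(2)] by blast
  qed
  ultimately show ?thesis unfolding field_embedding_def by blast
qed

lemma fraction_value_carrier:
  "fraction_value ` carrier (localization R M) = {\<theta> a / \<theta> s | a s. a \<in> carrier R \<and> s \<in> M}"
proof -
  have "fraction_value ` carrier (localization R M) =
      {fraction_value (fraction R M a s) | a s. a \<in> carrier R \<and> s \<in> M}"
    unfolding carrier_localization by blast
  also have "\<dots> = {\<theta> a / \<theta> s | a s. a \<in> carrier R \<and> s \<in> M}"
    using fraction_value_fraction by metis
  finally show ?thesis .
qed

end

end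

text \<open>
  The fraction field embeds in the same field, so an integral equation in it becomes an equation in
  that field with coefficients in the image of \<open>R\<close>.
\<close>

theorem integrally_closed_domain_if_embedded:
  fixes \<theta> :: "'a \<Rightarrow> 'f::field"
  assumes emb: "field_embedding R \<theta>"
    and closed: "\<And>a b. a \<in> carrier R \<Longrightarrow> b \<in> carrier R \<Longrightarrow> \<theta> b \<noteq> 0 \<Longrightarrow>
      integral_elem (\<theta> ` carrier R) (\<theta> a / \<theta> b) \<Longrightarrow> \<theta> a / \<theta> b \<in> \<theta> ` carrier R"
  shows "integrally_closed_domain R"
proof -
  let ?M = "carrier R - {\<zero>\<^bsub>R\<^esub>}"
  let ?Q = "fraction_field R" and ?i = "to_fraction_field R"
  let ?\<phi> = "fraction_value \<theta>"
  interpret domain R by (rule embedding_domain[OF emb])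
  have M: "?M \<subseteq> carrier R" "\<one>\<^bsub>R\<^esub> \<in> ?M" "\<zero>\<^bsub>R\<^esub> \<notin> ?M"
    "\<And>s t. s \<in> ?M \<Longrightarrow> t \<in> ?M \<Longrightarrow> s \<otimes>\<^bsub>R\<^esub> t \<in> ?M"
    using integral by auto
  have Q: "field_embedding ?Q ?\<phi>"
    unfolding fraction_field_def using field_embedding_localization[OF emb M] .
  have img: "?\<phi> (?i a) = \<theta> a" "?i a \<in> carrier ?Q" if "a \<in> carrier R" for a
  proof -
    show "?\<phi> (?i a) = \<theta> a"
      using fraction_value_fraction[OF emb M that M(2)] embedding_one(2)[OF emb]
      unfolding to_fraction_field_def by simp
    show "?i a \<in> carrier ?Q"
      unfolding to_fraction_field_def fraction_field_def
      by (rule fraction_in_carrier[OF emb M that M(2)])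
  qed
  have "x \<in> ?i ` carrier R"
    if x: "x \<in> carrier ?Q" and int: "integral_over ?Q (?i ` carrier R) x" for x
  proof -
    obtain p where p: "p \<in> carrier (univ_poly ?Q (?i ` carrier R))" "p \<noteq> []"
      "lead_coeff p = \<one>\<^bsub>?Q\<^esub>" "ring.eval ?Q p x = \<zero>\<^bsub>?Q\<^esub>"
      using int unfolding integral_over_def by blast
    have setp: "set p \<subseteq> ?i ` carrier R"
      using p(1,2) unfolding univ_poly_carrier[symmetric] polynomial_def by blast
    then have setp': "set p \<subseteq> carrier ?Q" using img(2) by blast
    obtain c q where pc: "p = c # q" using p(2) by (cases p) auto
    let ?n = "length q" and ?z = "?\<phi> x"
    have "(\<Sum>i<length p. ?\<phi> (p ! (length p - Suc i)) * ?z ^ i) = 0"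
      using embedding_eval[OF Q setp' x] p(4) embedding_zero(2)[OF Q] by simp
    then have sum: "(\<Sum>i<?n. ?\<phi> (p ! (?n - i)) * ?z ^ i) + ?z ^ ?n = 0"
      using p(3) embedding_one(2)[OF Q] by (simp add: pc)
    define d where "d i = - ?\<phi> (p ! (?n - i))" for i
    have "d i \<in> \<theta> ` carrier R" for i
    proof -
      have "p ! (?n - i) \<in> set p" by (rule nth_mem) (simp add: pc)
      then obtain a where a: "a \<in> carrier R" "p ! (?n - i) = ?i a" using setp by blast
      obtain b where b: "b \<in> carrier R" "\<theta> b = - \<theta> a" using embedding_uminus[OF emb a(1)] by blast
      then have "d i = \<theta> b" using a(2) img(1)[OF a(1)] by (simp add: d_def)
      then show ?thesis using b(1) by blast
    qed
    moreover have "?z ^ ?n = (\<Sum>i<?n. d i * ?z ^ i)"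
      using sum by (simp add: d_def sum_negf eq_neg_iff_add_eq_0 add.commute)
    ultimately have "integral_elem (\<theta> ` carrier R) ?z" unfolding integral_elem_def by blast
    moreover obtain a s where as: "a \<in> carrier R" "s \<in> ?M" "?z = \<theta> a / \<theta> s"
      using x fraction_value_carrier[OF emb M] unfolding fraction_field_def by blast
    moreover have "\<theta> s \<noteq> 0" using denominator_nonzero[OF emb M as(2)] .
    ultimately have "?z \<in> \<theta> ` carrier R" using closed[of a s] by simp
    then obtain r where r: "r \<in> carrier R" "?z = \<theta> r" by blast
    then have "?\<phi> x = ?\<phi> (?i r)" using img(1) by simp
    then have "x = ?i r" using embedding_eq_iff[OF Q x img(2)[OF r(1)]] by simp
    then show ?thesis using r(1) by blast
  qed
  then show ?thesis unfolding integrally_closed_domain_def using domain_axioms by blast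
qed

text \<open>
  A fraction integral over the localization at \<open>P\<close> becomes integral over \<open>R\<close> after multiplication by some
  \<open>r\<close> outside \<open>P\<close>. So it is an element of \<open>R\<close> divided by \<open>r\<close>.
\<close>

theorem normal_ring_if_embedded:
  fixes \<theta> :: "'a \<Rightarrow> 'f::field"
  assumes emb: "field_embedding R \<theta>"
    and closed: "\<And>a b. a \<in> carrier R \<Longrightarrow> b \<in> carrier R \<Longrightarrow> \<theta> b \<noteq> 0 \<Longrightarrow>
      integral_elem (\<theta> ` carrier R) (\<theta> a / \<theta> b) \<Longrightarrow> \<theta> a / \<theta> b \<in> \<theta> ` carrier R"
  shows "normal_ring R"
  unfolding normal_ring_def
proof (intro conjI allI impI)
  show "cring R" by (rule embedding_cring[OF emb])
  fix P assume "primeideal P R"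
  then interpret primeideal P R .
  let ?M = "carrier R - P"
  have "\<one>\<^bsub>R\<^esub> \<notin> P" using I_notcarr one_imp_carrier by blast
  then have M: "?M \<subseteq> carrier R" "\<one>\<^bsub>R\<^esub> \<in> ?M" "\<zero>\<^bsub>R\<^esub> \<notin> ?M"
    "\<And>s t. s \<in> ?M \<Longrightarrow> t \<in> ?M \<Longrightarrow> s \<otimes>\<^bsub>R\<^esub> t \<in> ?M"
    using I_prime by (auto simp: additive_subgroup.zero_closed[OF is_additive_subgroup])
  let ?L = "localization R ?M" and ?\<phi> = "fraction_value \<theta>"
  have car: "?\<phi> ` carrier ?L = {\<theta> a / \<theta> s | a s. a \<in> carrier R \<and> s \<in> ?M}"
    by (rule fraction_value_carrier[OF emb M])
  have nz: "\<theta> s \<noteq> 0" if "s \<in> ?M" for s using denominator_nonzero[OF emb M that] .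
  show "integrally_closed_domain ?L"
  proof (rule integrally_closed_domain_if_embedded[OF field_embedding_localization[OF emb M]])
    fix x y
    let ?z = "?\<phi> x / ?\<phi> y"
    assume xy: "x \<in> carrier ?L" "y \<in> carrier ?L" "?\<phi> y \<noteq> 0" "integral_elem (?\<phi> ` carrier ?L) ?z"
    obtain a s where as: "a \<in> carrier R" "s \<in> ?M" "?\<phi> x = \<theta> a / \<theta> s" using xy(1) car by blast
    obtain b t where bt: "b \<in> carrier R" "t \<in> ?M" "?\<phi> y = \<theta> b / \<theta> t" using xy(2) car by blast
    have "{\<theta> a / \<theta> s | a s. a \<in> carrier R \<and> s \<in> ?M} =
        {a / s | a s. a \<in> \<theta> ` carrier R \<and> s \<in> \<theta> ` ?M}" by blast
    then have "integral_elem {a / s | a s. a \<in> \<theta> ` carrier R \<and> s \<in> \<theta> ` ?M} ?z"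
      using xy(4) car by simp
    moreover have "\<theta> ` ?M \<subseteq> \<theta> ` carrier R" by blast
    moreover have "1 \<in> \<theta> ` ?M" using embedding_one(2)[OF emb] M(2) by (metis imageI)
    moreover have "0 \<notin> \<theta> ` ?M" using nz by force
    moreover have "x * y \<in> \<theta> ` carrier R" if xy: "x \<in> \<theta> ` carrier R" "y \<in> \<theta> ` carrier R" for x y
    proof -
      obtain a b where "a \<in> carrier R" "b \<in> carrier R" "x = \<theta> a" "y = \<theta> b" using xy by blast
      then show ?thesis using embedding_mult[OF emb, of a b] by (metis imageI)
    qed
    moreover have "x * y \<in> \<theta> ` ?M" if xy: "x \<in> \<theta> ` ?M" "y \<in> \<theta> ` ?M" for x y
    proof -
      obtain a b where ab: "a \<in> ?M" "b \<in> ?M" "x = \<theta> a" "y = \<theta> b" using xy by blast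
      then have "x * y = \<theta> (a \<otimes>\<^bsub>R\<^esub> b)" using embedding_mult(2)[OF emb, of a b] by simp
      then show ?thesis using M(4)[OF ab(1,2)] by blast
    qed
    ultimately obtain e where "e \<in> \<theta> ` ?M" "integral_elem (\<theta> ` carrier R) (e * ?z)"
      by (rule integral_elem_clear_denominators)
    then obtain r where r: "r \<in> ?M" "integral_elem (\<theta> ` carrier R) (\<theta> r * ?z)" by blast
    have in_R: "r \<in> carrier R" "s \<in> carrier R" "t \<in> carrier R" using r(1) as(2) bt(2) by blast+
    have b: "\<theta> b \<noteq> 0" using xy(3) bt(3) by auto
    have num: "r \<otimes>\<^bsub>R\<^esub> (a \<otimes>\<^bsub>R\<^esub> t) \<in> carrier R" "\<theta> (r \<otimes>\<^bsub>R\<^esub> (a \<otimes>\<^bsub>R\<^esub> t)) = \<theta> r * (\<theta> a * \<theta> t)"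
      using in_R as(1) embedding_mult[OF emb] by simp_all
    have den: "s \<otimes>\<^bsub>R\<^esub> b \<in> carrier R" "\<theta> (s \<otimes>\<^bsub>R\<^esub> b) = \<theta> s * \<theta> b"
      using in_R bt(1) embedding_mult[OF emb] by simp_all
    have eq: "\<theta> r * ?z = \<theta> (r \<otimes>\<^bsub>R\<^esub> (a \<otimes>\<^bsub>R\<^esub> t)) / \<theta> (s \<otimes>\<^bsub>R\<^esub> b)"
      unfolding num(2) den(2) as(3) bt(3) using nz[OF as(2)] nz[OF bt(2)] b by (simp add: field_simps)
    have "\<theta> (s \<otimes>\<^bsub>R\<^esub> b) \<noteq> 0" using den(2) nz[OF as(2)] b by simp
    then have "\<theta> r * ?z \<in> \<theta> ` carrier R"
      using closed[OF num(1) den(1)] r(2) unfolding eq by blast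
    then obtain q where "q \<in> carrier R" "\<theta> r * ?z = \<theta> q" by blast
    moreover from this have "?z = \<theta> q / \<theta> r" using nz[OF r(1)] by (metis nonzero_mult_div_cancel_left)
    ultimately show "?z \<in> ?\<phi> ` carrier ?L" unfolding car using r(1) by blast
  qed
qed

section \<open>Polynomial rings and their quotients\<close>

lemma polynomial_ring_simps:
  "carrier (polynomial_ring U) = polys_in U" "\<zero>\<^bsub>polynomial_ring U\<^esub> = 0" "\<one>\<^bsub>polynomial_ring U\<^esub> = 1"
  "p \<oplus>\<^bsub>polynomial_ring U\<^esub> q = p + q" "p \<otimes>\<^bsub>polynomial_ring U\<^esub> q = p * q"
  by (simp_all add: polynomial_ring_def polys_in_def)

lemma field_embedding_polynomial_ring:
  "field_embedding (polynomial_ring U) (embed :: ('v::linorder, 'k::field) mpoly \<Rightarrow> _)"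
proof -
  have "\<exists>q\<in>polys_in U. embed q = - embed p" if "p \<in> polys_in U" for p :: "('v, 'k) mpoly"
    by (rule bexI[where x = "- p"]) (simp_all add: embed_uminus polys_in_uminus that)
  then show ?thesis
    unfolding field_embedding_def polynomial_ring_simps
    by (simp add: inj_on_def embed_eq_iff embed_0 embed_1 embed_add embed_mult polys_in_add polys_in_mult)
qed

lemma cring_polynomial_ring: "cring (polynomial_ring U :: ('v::linorder, 'k::field) mpoly ring)"
  by (rule embedding_cring[OF field_embedding_polynomial_ring])

lemma polynomial_ring_a_inv:
  assumes "q \<in> polys_in U"
  shows "\<ominus>\<^bsub>polynomial_ring U\<^esub> q = - (q :: ('v::linorder, 'k::field) mpoly)"
proof -
  interpret cring "polynomial_ring U :: ('v, 'k) mpoly ring" by (rule cring_polynomial_ring)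
  have "\<ominus>\<^bsub>polynomial_ring U\<^esub> (- q) = q"
    by (rule minus_equality) (use assms polys_in_uminus in \<open>auto simp: polynomial_ring_simps\<close>)
  then show ?thesis using minus_minus[of "- q"] assms polys_in_uminus polynomial_ring_simps(1) by metis
qed

lemma polynomial_ring_minus:
  "p \<in> polys_in U \<Longrightarrow> q \<in> polys_in U \<Longrightarrow>
   p \<ominus>\<^bsub>polynomial_ring U\<^esub> q = p - (q :: ('v::linorder, 'k::field) mpoly)"
  by (simp add: a_minus_def polynomial_ring_a_inv polynomial_ring_simps)

lemma field_embedding_quotient:
  fixes \<psi> :: "('v::linorder, 'k::field) mpoly \<Rightarrow> 'f::field"
  assumes "ideal I (polynomial_ring U)"
    and kernel: "\<And>p. p \<in> polys_in U \<Longrightarrow> \<psi> p = 0 \<longleftrightarrow> p \<in> I"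
    and hom: "\<And>p q. \<psi> (p + q) = \<psi> p + \<psi> q" "\<And>p q. \<psi> (p * q) = \<psi> p * \<psi> q" "\<psi> 1 = 1"
  shows "\<exists>\<theta>. field_embedding (polynomial_ring U Quot I) \<theta> \<and>
    \<theta> ` carrier (polynomial_ring U Quot I) = \<psi> ` polys_in U"
proof -
  let ?P = "polynomial_ring U :: ('v, 'k) mpoly ring"
  interpret ideal I ?P by (rule assms(1))
  interpret cring ?P by (rule cring_polynomial_ring)
  interpret \<psi>: additive \<psi> by standard (rule hom(1))
  note \<psi>0 = \<psi>.zero and \<psi>u = \<psi>.minus and \<psi>m = \<psi>.diff
  have coset_eq: "I +>\<^bsub>?P\<^esub> p = I +>\<^bsub>?P\<^esub> q \<longleftrightarrow> \<psi> p = \<psi> q" if pq: "p \<in> polys_in U" "q \<in> polys_in U" for p q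
  proof -
    have "p - q \<in> polys_in U" using polys_in_add[OF pq(1) polys_in_uminus[OF pq(2)]] by simp
    then have "p - q \<in> I \<longleftrightarrow> \<psi> p = \<psi> q" using kernel[of "p - q"] \<psi>m by simp
    then show ?thesis
      using quotient_eq_iff_same_a_r_cos[OF assms(1), of p q] pq
      by (simp add: polynomial_ring_simps polynomial_ring_minus)
  qed
  have car: "carrier (?P Quot I) = {I +>\<^bsub>?P\<^esub> p | p. p \<in> polys_in U}"
    by (auto simp: FactRing_def A_RCOSETS_def' polynomial_ring_simps)
  define \<theta> where "\<theta> C = \<psi> (SOME p. p \<in> polys_in U \<and> C = I +>\<^bsub>?P\<^esub> p)" for C
  have \<theta>: "\<theta> (I +>\<^bsub>?P\<^esub> p) = \<psi> p" if "p \<in> polys_in U" for p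
  proof -
    let ?q = "SOME q. q \<in> polys_in U \<and> I +>\<^bsub>?P\<^esub> p = I +>\<^bsub>?P\<^esub> q"
    have "\<exists>q. q \<in> polys_in U \<and> I +>\<^bsub>?P\<^esub> p = I +>\<^bsub>?P\<^esub> q" using that by blast
    from someI_ex[OF this] have "?q \<in> polys_in U" "I +>\<^bsub>?P\<^esub> p = I +>\<^bsub>?P\<^esub> ?q" by simp_all
    then have "\<psi> p = \<psi> ?q" using coset_eq[OF that] by simp
    then show ?thesis unfolding \<theta>_def by simp
  qed
  have add: "(I +>\<^bsub>?P\<^esub> p) \<oplus>\<^bsub>?P Quot I\<^esub> (I +>\<^bsub>?P\<^esub> q) = I +>\<^bsub>?P\<^esub> (p + q)"
    and mult: "(I +>\<^bsub>?P\<^esub> p) \<otimes>\<^bsub>?P Quot I\<^esub> (I +>\<^bsub>?P\<^esub> q) = I +>\<^bsub>?P\<^esub> (p * q)"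
    if "p \<in> polys_in U" "q \<in> polys_in U" for p q
    using a_rcos_sum[of p q] rcoset_mult_add[of p q] that
    by (simp_all add: FactRing_def polynomial_ring_simps)
  have zero: "\<zero>\<^bsub>?P Quot I\<^esub> = I +>\<^bsub>?P\<^esub> 0"
    using a_coset_add_zero[OF a_subset] by (simp add: FactRing_def polynomial_ring_simps)
  have one: "\<one>\<^bsub>?P Quot I\<^esub> = I +>\<^bsub>?P\<^esub> 1"
    by (simp add: FactRing_def polynomial_ring_simps)
  have elem: "\<exists>p\<in>polys_in U. C = I +>\<^bsub>?P\<^esub> p" if "C \<in> carrier (?P Quot I)" for C
    using that unfolding car by blast
  have mem: "I +>\<^bsub>?P\<^esub> p \<in> carrier (?P Quot I)" if "p \<in> polys_in U" for p
    using that unfolding car by blast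
  have "field_embedding (?P Quot I) \<theta>"
    unfolding field_embedding_def
  proof (intro conjI ballI)
    show "inj_on \<theta> (carrier (?P Quot I))"
    proof (rule inj_onI)
      fix C D assume CD: "C \<in> carrier (?P Quot I)" "D \<in> carrier (?P Quot I)" "\<theta> C = \<theta> D"
      obtain p q where pq: "p \<in> polys_in U" "q \<in> polys_in U" "C = I +>\<^bsub>?P\<^esub> p" "D = I +>\<^bsub>?P\<^esub> q"
        using elem[OF CD(1)] elem[OF CD(2)] by blast
      then show "C = D" using CD(3) \<theta> coset_eq by simp
    qed
    show "\<zero>\<^bsub>?P Quot I\<^esub> \<in> carrier (?P Quot I)" "\<one>\<^bsub>?P Quot I\<^esub> \<in> carrier (?P Quot I)"
      unfolding zero one by (intro mem; simp)+
    show "\<theta> \<zero>\<^bsub>?P Quot I\<^esub> = 0" "\<theta> \<one>\<^bsub>?P Quot I\<^esub> = 1"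
      unfolding zero one by (simp_all add: \<theta> \<psi>0 hom(3))
  next
    fix C D assume CD: "C \<in> carrier (?P Quot I)" "D \<in> carrier (?P Quot I)"
    obtain p q where pq: "p \<in> polys_in U" "q \<in> polys_in U" "C = I +>\<^bsub>?P\<^esub> p" "D = I +>\<^bsub>?P\<^esub> q"
      using elem[OF CD(1)] elem[OF CD(2)] by blast
    have "p + q \<in> polys_in U" "p * q \<in> polys_in U" using pq polys_in_add polys_in_mult by auto
    then show "C \<oplus>\<^bsub>?P Quot I\<^esub> D \<in> carrier (?P Quot I)" "C \<otimes>\<^bsub>?P Quot I\<^esub> D \<in> carrier (?P Quot I)"
      "\<theta> (C \<oplus>\<^bsub>?P Quot I\<^esub> D) = \<theta> C + \<theta> D" "\<theta> (C \<otimes>\<^bsub>?P Quot I\<^esub> D) = \<theta> C * \<theta> D"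
      unfolding pq(3,4) add[OF pq(1,2)] mult[OF pq(1,2)]
      using mem \<theta> pq(1,2) hom by simp_all
  next
    fix C assume C: "C \<in> carrier (?P Quot I)"
    obtain p where p: "p \<in> polys_in U" "C = I +>\<^bsub>?P\<^esub> p" using elem[OF C] by blast
    then show "\<exists>D\<in>carrier (?P Quot I). \<theta> D = - \<theta> C"
      using mem[OF polys_in_uminus[OF p(1)]] \<theta>[OF p(1)] \<theta>[OF polys_in_uminus[OF p(1)]] \<psi>u by auto
  qed
  moreover have "carrier (?P Quot I) = (\<lambda>p. I +>\<^bsub>?P\<^esub> p) ` polys_in U"
    unfolding car by blast
  then have "\<theta> ` carrier (?P Quot I) = \<psi> ` polys_in U"
    using \<theta> by (simp add: image_image cong: image_cong_simp)
  ultimately show ?thesis by blast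
qed

lemma polynomial_ring_kernel_ideal:
  fixes \<psi> :: "('v::linorder, 'k::field) mpoly \<Rightarrow> 'f::field"
  assumes "\<And>p q. \<psi> (p + q) = \<psi> p + \<psi> q" "\<And>p q. \<psi> (p * q) = \<psi> p * \<psi> q"
  shows "ideal {p \<in> polys_in U. \<psi> p = 0} (polynomial_ring U)"
proof (rule idealI)
  let ?P = "polynomial_ring U :: ('v, 'k) mpoly ring"
  interpret cring ?P by (rule cring_polynomial_ring)
  show "ring ?P" by (rule ring_axioms)
  interpret \<psi>: additive \<psi> by standard (rule assms(1))
  note \<psi>0 = \<psi>.zero and \<psi>u = \<psi>.minus
  show "subgroup {p \<in> polys_in U. \<psi> p = 0} (add_monoid ?P)"
  proof (rule subgroup.intro)
    fix p assume "p \<in> {p \<in> polys_in U. \<psi> p = 0}"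
    then show "inv\<^bsub>add_monoid ?P\<^esub> p \<in> {p \<in> polys_in U. \<psi> p = 0}"
      unfolding a_inv_def[symmetric] by (simp add: polynomial_ring_a_inv polys_in_uminus \<psi>u)
  qed (auto simp: polynomial_ring_simps assms \<psi>0 polys_in_add)
qed (auto simp: polynomial_ring_simps assms polys_in_mult)

section \<open>Normality of the ring of a forest\<close>

lemma lss_gen_commute: "lss_gen d i j = lss_gen d j i"
  by (simp add: lss_gen_def mult.commute)

lemma lss_gen_in_polys_in:
  "{v, l} \<subseteq> V \<Longrightarrow> lss_gen d v l \<in> polys_in (V \<times> {1..d})"
  unfolding lss_gen_def variable_def mult_single
  by (intro polys_in_sum polys_in_single) (auto simp: keys_add_nat)

context lss_forest
begin

text \<open>
  The ideal \<open>J\<close> lives in the ring with all variables indexed by pairs of numbers, while the ideal of the ring in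
  question is generated in finitely many variables. Setting the other variables to zero fixes the generators,
  so it maps a representation of \<open>p\<close> in \<open>J\<close> to one with cofactors in the small ring.
\<close>

lemma psi_kernel_eq_lss_ideal:
  assumes "endpoints (set es) \<subseteq> {1..n}"
  shows "{p \<in> polys_in ({1..n} \<times> {1..Suc D}). psi p = 0} =
    (lss_ideal n (undirected ` set es) (Suc D) :: (nat \<times> nat, 'k::field) mpoly set)"
proof -
  let ?U = "{1..n} \<times> {1..Suc D}"
  let ?P = "polynomial_ring ?U :: (nat \<times> nat, 'k) mpoly ring"
  let ?G = "{lss_gen (Suc D) i j | i j. {i, j} \<in> undirected ` set es} :: (nat \<times> nat, 'k) mpoly set"
  interpret cring ?P by (rule cring_polynomial_ring)
  have in_U: "lss_gen (Suc D) i j \<in> polys_in ?U" if "{i, j} \<in> undirected ` set es" for i j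
    using that assms unfolding endpoints_def by (intro lss_gen_in_polys_in) blast
  then have G: "?G \<subseteq> carrier ?P" by (auto simp: polynomial_ring_simps)
  have "psi (lss_gen (Suc D) i j :: (nat \<times> nat, 'k) mpoly) = 0" if ij: "{i, j} \<in> undirected ` set es" for i j
  proof -
    have "(i, j) \<in> set es \<or> (j, i) \<in> set es" using ij by (auto simp: undirected_def doubleton_eq_iff)
    then have "lss_gen (Suc D) i j \<in> (lss_edge (Suc D) ` set es :: (nat \<times> nat, 'k) mpoly set)"
      using lss_gen_commute[of "Suc D" i j] by (force simp: lss_edge_def image_iff)
    then show ?thesis unfolding psi_eq_0_iff J_def by (rule gen.span_base)
  qed
  then have "?G \<subseteq> {p \<in> polys_in ?U. psi p = 0}" using in_U by blast
  moreover have "ideal {p \<in> polys_in ?U. psi p = 0} ?P"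
    by (rule polynomial_ring_kernel_ideal[OF evaluate_add evaluate_mult])
  ultimately have 1: "Idl\<^bsub>?P\<^esub> ?G \<subseteq> {p \<in> polys_in ?U. psi p = 0}"
    by (intro genideal_minimal)
  interpret I: ideal "Idl\<^bsub>?P\<^esub> ?G" ?P by (rule genideal_ideal[OF G])
  have restrict: "restrict_vars ?U p \<in> Idl\<^bsub>?P\<^esub> ?G" if "p \<in> J" for p
    using that unfolding J_def
  proof (induction rule: gen.span_induct_alt)
    case base
    show ?case using I.zero_closed by (simp add: polynomial_ring_simps)
  next
    case (step c x y)
    obtain e where e: "e \<in> set es" "x = lss_gen (Suc D) (fst e) (snd e)"
      using step(1) by (auto simp: lss_edge_def)
    have edge: "{fst e, snd e} \<in> undirected ` set es" using e(1) by (auto simp: undirected_def)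
    have "restrict_vars ?U x = x"
      using in_U[OF edge] unfolding e(2) polys_in_def by (intro restrict_vars_id) blast
    moreover have "x \<in> Idl\<^bsub>?P\<^esub> ?G" using genideal_self[OF G] edge e(2) by blast
    moreover have "restrict_vars ?U c \<in> carrier ?P"
      by (auto simp: polynomial_ring_simps polys_in_def keys_restrict_vars)
    ultimately have "restrict_vars ?U c * x \<in> Idl\<^bsub>?P\<^esub> ?G"
      using I.I_l_closed[of x "restrict_vars ?U c"] by (simp add: polynomial_ring_simps)
    then show ?case
      using I.a_closed[OF _ step(2)] \<open>restrict_vars ?U x = x\<close>
      by (simp add: restrict_vars_add restrict_vars_mult polynomial_ring_simps)
  qed
  have 2: "{p \<in> polys_in ?U. psi p = 0} \<subseteq> Idl\<^bsub>?P\<^esub> ?G"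
  proof
    fix p :: "(nat \<times> nat, 'k) mpoly" assume "p \<in> {p \<in> polys_in ?U. psi p = 0}"
    then have "p \<in> J" "restrict_vars ?U p = p"
      by (auto simp: psi_eq_0_iff polys_in_def intro!: restrict_vars_id)
    then show "p \<in> Idl\<^bsub>?P\<^esub> ?G" using restrict[of p] by simp
  qed
  show ?thesis using 1 2 unfolding lss_ideal_def by blast
qed

text \<open>
  For the same reason a quotient of two elements of the small ring can be taken in the small ring: the
  congruence \<open>a = b * q\<close> modulo \<open>J\<close> is preserved when the other variables are set to zero.
\<close>

lemma psi_restrict_vars_quotient:
  assumes "endpoints (set es) \<subseteq> {1..n}" "a \<in> polys_in ({1..n} \<times> {1..Suc D})" "b \<in> polys_in ({1..n} \<times> {1..Suc D})"
    and "psi a = psi b * psi q"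
  shows "psi a = psi b * psi (restrict_vars ({1..n} \<times> {1..Suc D}) q)"
proof -
  let ?U = "{1..n} \<times> {1..Suc D}"
  have "psi (restrict_vars ?U p) = 0" if "p \<in> J" for p :: "(nat \<times> nat, 'a) mpoly"
    using that unfolding J_def
  proof (induction rule: gen.span_induct_alt)
    case base
    show ?case by simp
  next
    case (step c x y)
    obtain e where e: "e \<in> set es" "x = lss_gen (Suc D) (fst e) (snd e)"
      using step(1) by (auto simp: lss_edge_def)
    have "{fst e, snd e} \<subseteq> {1..n}"
      using undirected_subset_endpoints[OF e(1)] assms(1) unfolding undirected_def by blast
    then have "x \<in> polys_in ?U" unfolding e(2) by (rule lss_gen_in_polys_in)
    then have "restrict_vars ?U x = x" unfolding polys_in_def by (intro restrict_vars_id) blast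
    moreover have "psi x = 0" unfolding psi_eq_0_iff J_def using step(1) by (rule gen.span_base)
    ultimately show ?case
      using step(2) by (simp add: restrict_vars_add restrict_vars_mult evaluate_add evaluate_mult)
  qed
  moreover have "a - b * q \<in> J"
    using assms(4) psi_eq_0_iff[of "a - b * q"] by (simp add: evaluate_diff evaluate_mult)
  ultimately have "psi (restrict_vars ?U a - restrict_vars ?U b * restrict_vars ?U q) = 0"
    by (metis restrict_vars_diff restrict_vars_mult)
  moreover have "restrict_vars ?U a = a" "restrict_vars ?U b = b"
    using assms(2,3) unfolding polys_in_def by (auto intro!: restrict_vars_id)
  ultimately show ?thesis by (simp add: evaluate_diff evaluate_mult)
qed

theorem normal_lss_ring:
  assumes "endpoints (set es) \<subseteq> {1..n}"
  shows "normal_ring (lss_ring n (undirected ` set es) (Suc D) :: (nat \<times> nat, 'k::field) mpoly set ring)"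
proof -
  let ?U = "{1..n} \<times> {1..Suc D}"
  let ?P = "polynomial_ring ?U :: (nat \<times> nat, 'k) mpoly ring"
  let ?I = "lss_ideal n (undirected ` set es) (Suc D) :: (nat \<times> nat, 'k) mpoly set"
  let ?psi = "psi :: (nat \<times> nat, 'k) mpoly \<Rightarrow> _"
  note kernel = psi_kernel_eq_lss_ideal[OF assms]
  have "ideal ?I ?P"
    unfolding kernel[symmetric]
    by (rule polynomial_ring_kernel_ideal[OF evaluate_add evaluate_mult])
  moreover have "?psi p = 0 \<longleftrightarrow> p \<in> ?I" if "p \<in> polys_in ?U" for p
    using that unfolding kernel[symmetric] by simp
  ultimately obtain \<theta> where emb: "field_embedding (?P Quot ?I) \<theta>"
    and img: "\<theta> ` carrier (?P Quot ?I) = ?psi ` polys_in ?U"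
    using field_embedding_quotient[of ?I ?U ?psi, OF _ _ evaluate_add evaluate_mult evaluate_1] by blast
  have "normal_ring (?P Quot ?I)"
  proof (rule normal_ring_if_embedded[OF emb])
    fix x y assume xy: "x \<in> carrier (?P Quot ?I)" "y \<in> carrier (?P Quot ?I)" "\<theta> y \<noteq> 0"
      "integral_elem (\<theta> ` carrier (?P Quot ?I)) (\<theta> x / \<theta> y)"
    obtain a where a: "a \<in> polys_in ?U" "\<theta> x = psi a" using xy(1) img by blast
    obtain b where b: "b \<in> polys_in ?U" "\<theta> y = psi b" using xy(2) img by blast
    have "integral_elem (range ?psi) (psi a / psi b)"
      using xy(4) unfolding img a(2) b(2) by (rule integral_elem_mono) blast
    then have "psi a / psi b \<in> range ?psi"
      using xy(3) unfolding b(2) by (rule range_psi_integrally_closed)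
    then obtain q where "psi a / psi b = psi q" by blast
    then have "psi a = psi b * psi q" using xy(3) b(2) by (simp add: field_simps)
    then have "psi a = psi b * psi (restrict_vars ?U q)"
      by (rule psi_restrict_vars_quotient[OF assms a(1) b(1)])
    then have "\<theta> x / \<theta> y = psi (restrict_vars ?U q)" using a(2) b(2) xy(3) by simp
    moreover have "restrict_vars ?U q \<in> polys_in ?U"
      by (auto simp: polys_in_def keys_restrict_vars)
    ultimately show "\<theta> x / \<theta> y \<in> \<theta> ` carrier (?P Quot ?I)" unfolding img by blast
  qed
  then show ?thesis unfolding lss_ring_def .
qed

end

theorem theorem3:
  fixes n d :: nat and E :: "nat set set"
  assumes "forest {1..n} E"
    and "d = max_degree {1..n} E + 1"
  shows "normal_ring (lss_ring n E d :: (((nat \<times> nat) \<Rightarrow>\<^sub>0 nat) \<Rightarrow>\<^sub>0 'k::field) set ring)"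
proof -
  obtain es where es: "leaf_order es" "undirected ` set es = E"
    using forest_has_leaf_order[OF assms(1)] by blast
  have ends: "endpoints (set es) \<subseteq> {1..n}"
    using assms(1) es(2) unfolding endpoints_def forest_def simple_graph_def by blast
  interpret lss_forest es "max_degree {1..n} E"
    using es(1) card_edges_at_le[OF es(1) _ ends] unfolding es(2) by unfold_locales simp_all
  show ?thesis using normal_lss_ring[OF ends] unfolding es(2) assms(2) by simp
qed

end
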